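(* Let $\gamma\in(-d,0)$ and $\nu\in(0,2)$, and suppose that $b$ satisfies, for some constants $c_1\ge c_0>0$, $$c_0|\theta|^{-(d-1)-\nu}\le b(\cos\theta)\le c_1|\theta|^{-(d-1)-\nu}.$$ Then for any $\varepsilon>0$ there is an explicit constant $C=C(B,\varepsilon)>0$, where $B(v-v_*,\sigma)=|v-v_*|^\gamma b(\cos\theta)$, such that for all $f\in L^2(\mathcal{M}^{-1})$ $$\mathbb{D}(f)\ge C\,\|f-\varrho_f\mathcal{M}\|^2_{L^2(\langle v\rangle^{\gamma+\nu-\varepsilon}\mathcal{M}^{-1})}.$$ In particular, if $\gamma+\nu>0$, there is $\lambda>0$ such that for all $f\in L^2(\mathcal{M}^{-1})$ $$\mathbb{D}(f)\ge\lambda\,\|f-\varrho_f\mathcal{M}\|^2_{L^2(\mathcal{M}^{-1})},$$ i.e. the linear Boltzmann operator $\boldsymbol{L}_B$ with kernel $B$ admits a spectral gap of size $\lambda$ in the space $L^2(\mathcal{M}^{-1})$.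
   Context: Here $d\ge2$, $\mathcal{M}(v)=(2\pi)^{-d/2}e^{-|v|^2/2}$, $\langle v\rangle=\sqrt{1+|v|^2}$. For $v,v_*\in\mathbb{R}^d$, $\sigma\in\mathbb{S}^{d-1}$: $v'=\frac{v+v_*}{2}+\frac{|v-v_*|}{2}\sigma$, $v_*'=\frac{v+v_*}{2}-\frac{|v-v_*|}{2}\sigma$, and $\theta\in[0,\pi]$ is defined by $\cos\theta=\frac{v-v_*}{|v-v_*|}\cdot\sigma$. (Under the assumption on $b$ one has $\int_{\mathbb{S}^{d-1}}b(\cos\theta)\,d\sigma=\infty$: no angular cut-off.) The linear Boltzmann operator is formally $\boldsymbol{L}_Bf(v)=\int B(v-v_*,\sigma)\big(f(v')\mathcal{M}(v_*')-f(v)\mathcal{M}(v_* )\big)\,dv_*\,d\sigma$. Its Dirichlet form is, with $h=f/\mathcal{M}$, $$\mathbb{D}(f)=\frac12\int_{\mathbb{R}^d\times\mathbb{R}^d\times\mathbb{S}^{d-1}}b(\cos\theta)|v-v_*|^\gamma\mathcal{M}(v)\mathcal{M}(v_* )\big(h(v)-h(v')\big)^2\,dv\,dv_*\,d\sigma\in[0,\infty].$$ For a weight $\omega$, $\|f\|^2_{L^2(\omega)}=\int_{\mathbb{R}^d}f(v)^2\omega(v)\,dv$. $\varrho_f=\int_{\mathbb{R}^d}f(v)\,dv$. *)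

theory Defs
  imports "HOL-Analysis.Analysis"
begin

text \<open>
  Functions live on a Euclidean space of dimension \<open>d = DIM('a)\<close>.

  The surface measure \<open>d\<sigma>\<close> of the unit sphere is obtained from polar coordinates: the cone
  \<open>{r s | 0 < r < 1, s \<in> A}\<close> has volume \<open>\<sigma>(A) / d\<close>.
\<close>

definition sphere_measure :: "'a::euclidean_space measure" where
  "sphere_measure =
     scale_measure (ennreal (real DIM('a)))
       (distr (restrict_space lborel (ball 0 1 - {0})) (restrict_space borel (sphere 0 1)) sgn)"

lemma space_sphere_measure: "space (sphere_measure :: 'a::euclidean_space measure) = sphere 0 1"
  by (simp add: sphere_measure_def space_scale_measure space_restrict_space)

lemma emeasure_sphere_measure_UNIV:
  "emeasure (sphere_measure :: 'a::euclidean_space measure) (sphere 0 1)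
     = ennreal (real DIM('a) * unit_ball_vol (real DIM('a)))"
proof -
  let ?R = "restrict_space lborel (ball 0 1 - {0::'a})"
  have m: "sgn \<in> ?R \<rightarrow>\<^sub>M restrict_space borel (sphere 0 1 :: 'a set)"
    by (rule measurable_restrict_space2)
       (auto simp: space_restrict_space norm_sgn sgn_div_norm intro!: measurable_restrict_space1)
  have "emeasure (distr ?R (restrict_space borel (sphere 0 1)) sgn) (sphere 0 1)
          = emeasure ?R (sgn -` sphere 0 1 \<inter> space ?R)"
    by (rule emeasure_distr[OF m]) (auto simp: sets_restrict_space)
  also have "sgn -` sphere 0 1 \<inter> space ?R = ball 0 1 - {0}"
    by (auto simp: space_restrict_space norm_sgn)
  also have "emeasure ?R (ball 0 1 - {0}) = emeasure lborel (ball 0 1 - {0 :: 'a})"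
    by (rule emeasure_restrict_space) auto
  also have "\<dots> = emeasure lborel (ball 0 1 :: 'a set)"
    by (rule emeasure_Diff_null_set) auto
  also have "\<dots> = ennreal (unit_ball_vol (real DIM('a)))"
    by (simp add: emeasure_ball)
  finally show ?thesis
    by (simp add: sphere_measure_def emeasure_scale_measure ennreal_mult')
qed

definition maxwellian :: "'a::euclidean_space \<Rightarrow> real" where
  "maxwellian v = (2 * pi) powr (- real DIM('a) / 2) * exp (- (norm v)\<^sup>2 / 2)"

definition japanese_bracket :: "'a::euclidean_space \<Rightarrow> real"  (\<open>\<langle>_\<rangle>\<close>) where
  "\<langle>v\<rangle> = sqrt (1 + (norm v)\<^sup>2)"

definition post_collisional :: "'a::euclidean_space \<Rightarrow> 'a \<Rightarrow> 'a \<Rightarrow> 'a" where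
  "post_collisional v w \<sigma> = (1 / 2) *\<^sub>R (v + w) + (norm (v - w) / 2) *\<^sub>R \<sigma>"

text \<open>
  Here \<open>sgn z \<bullet> \<sigma>\<close> is \<open>cos \<theta>\<close>, as \<open>sgn z = z / norm z\<close>.  The conventions \<open>sgn 0 = 0\<close> and
  \<open>0 powr \<gamma> = 0\<close> only concern the null set \<open>z = 0\<close>.
\<close>

definition collision_kernel :: "real \<Rightarrow> (real \<Rightarrow> real) \<Rightarrow> 'a::euclidean_space \<Rightarrow> 'a \<Rightarrow> real" where
  "collision_kernel \<gamma> b z \<sigma> = norm z powr \<gamma> * b (sgn z \<bullet> \<sigma>)"

definition dirichlet_form ::
    "('a::euclidean_space \<Rightarrow> 'a \<Rightarrow> real) \<Rightarrow> ('a \<Rightarrow> real) \<Rightarrow> ennreal" where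
  "dirichlet_form B f =
     ennreal (1 / 2) *
       (\<integral>\<^sup>+ (v, w, \<sigma>).
          ennreal (B (v - w) \<sigma> * maxwellian v * maxwellian w *
            (f v / maxwellian v
              - f (post_collisional v w \<sigma>) / maxwellian (post_collisional v w \<sigma>))\<^sup>2)
        \<partial>(lborel \<Otimes>\<^sub>M lborel \<Otimes>\<^sub>M sphere_measure))"

definition L2_norm_sq :: "('a::euclidean_space \<Rightarrow> real) \<Rightarrow> ('a \<Rightarrow> real) \<Rightarrow> ennreal" where
  "L2_norm_sq \<omega> f = (\<integral>\<^sup>+ v. ennreal ((f v)\<^sup>2 * \<omega> v) \<partial>lborel)"

text \<open>
  Elements of the weighted space are represented by Borel functions.
\<close>

definition L2_space :: "('a::euclidean_space \<Rightarrow> real) \<Rightarrow> ('a \<Rightarrow> real) set" where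
  "L2_space \<omega> = {f \<in> borel_measurable borel. L2_norm_sq \<omega> f < \<infinity>}"

definition mass :: "('a::euclidean_space \<Rightarrow> real) \<Rightarrow> real" where
  "mass f = (\<integral>v. f v \<partial>lborel)"

end

theory Submission
  imports Defs "HOL-Probability.Distributions"
begin

text \<open>
  Write \<open>h = f / M\<close> with \<open>M\<close> the Maxwellian, \<open>s = \<gamma> + \<nu>\<close>, \<open>d\<close> for the dimension and \<open>u = v - w\<close>, and
  let \<open>E(h)\<close> be twice the Dirichlet form. The core of the proof is the weighted Poincare inequality
  \<open>weighted_poincare\<close>: the integral of \<open>(h - m)\<^sup>2 \<langle>v\<rangle>\<^sup>s M\<close>, where \<open>m\<close> is the mean of \<open>h\<close> with respect
  to \<open>M\<close>, is at most a constant times \<open>E(h)\<close>. Both claims follow from it, since \<open>\<langle>v\<rangle> \<ge> 1\<close> implies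
  \<open>\<langle>v\<rangle> powr (s - \<epsilon>) \<le> \<langle>v\<rangle> powr s\<close>, and \<open>1 \<le> \<langle>v\<rangle> powr s\<close> when \<open>s > 0\<close>.

  Large velocities. Consider only collisions in which the jump \<open>|v' - v|\<close> lies between \<open>L\<close> and \<open>2 L\<close>.
  As \<open>|v' - v| = |u| |\<sigma> - sgn u| / 2\<close>, the deflection angle is of order \<open>L / |u|\<close>: these collisions
  fill a part of the sphere of area of order \<open>(L / |u|) powr (d - 1)\<close>, on which the kernel is at least of
  order \<open>|u| powr (\<gamma> + d - 1 + \<nu>)\<close>. A particle of large velocity \<open>v\<close> therefore undergoes
  them at a rate of order \<open>|v| powr s\<close>, which is where the weight comes from. If the partner is slow,
  \<open>|w| \<le> 1\<close>, it leaves with \<open>|w'| \<ge> L - 1\<close> and takes its energy from \<open>v\<close>: the jump goes inward. The reversed jumps start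
  from a partner with \<open>|w| \<ge> L - 1\<close> and end with \<open>|w'| \<le> 1\<close>. Their rate has the same order in \<open>|v|\<close>,
  but carries the tail mass of \<open>M\<close>, so for \<open>L\<close> large it is at most a quarter of the inward
  rate (\<open>jump_rates\<close>). Now integrate \<open>h(v)\<^sup>2 \<le> 2 h(v')\<^sup>2 + 2 (h(v) - h(v'))\<^sup>2\<close> over the inward jumps.
  The exchange of \<open>(v, w, \<sigma>)\<close> with \<open>(v', w', sgn u)\<close> preserves the measure (\<open>collision_integral_swap\<close>), so the
  first term becomes an integral of \<open>h(v)\<^sup>2\<close> against the outward rate and is absorbed on the left-hand side, up to a
  contribution of a fixed ball. This is \<open>tail_estimate\<close>.

  Bounded velocities. The velocity \<open>v'\<close> depends symmetrically on \<open>v\<close> and \<open>w\<close>. Hence in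
  \<open>(h(v) - h(w))\<^sup>2 \<le> 2 (h(v) - h(v'))\<^sup>2 + 2 (h(w) - h(v'))\<^sup>2\<close> both terms on the right have the same integral,
  and on a ball, where the kernel and \<open>M\<close> are bounded below, this integral is controlled by \<open>E(h)\<close>. This is
  \<open>local_estimate\<close>.

  Conclusion. The tail estimate is applied to \<open>h - h(w)\<close> and integrated over \<open>w\<close> in the ball, where the local estimate
  controls what remains. The Cauchy-Schwarz inequality, together with the finiteness of all moments of \<open>M\<close>,
  replaces \<open>h(w)\<close> by the mean.
\<close>

section \<open>The surface measure of the sphere and polar coordinates\<close>
text \<open>
  The surface measure transported to the Borel sets of the whole space. Integrands
  depending on \<open>v\<close>, \<open>w\<close> and \<open>\<sigma>\<close> are then plain Borel functions of three vectors, and \<open>sgn (v - w)\<close> may be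
  substituted for \<open>\<sigma>\<close> even though it leaves the sphere when \<open>v = w\<close>.
\<close>
definition sph :: "'a::euclidean_space measure" where
  "sph = distr sphere_measure borel (\<lambda>\<sigma>. \<sigma>)"

lemma sets_sphere_measure:
  "sets (sphere_measure :: 'a::euclidean_space measure) = sets (restrict_space borel (sphere 0 1))"
  by (simp add: sphere_measure_def)

lemma ident_measurable_sphere:
  "(\<lambda>\<sigma>. \<sigma>) \<in> (sphere_measure :: 'a::euclidean_space measure) \<rightarrow>\<^sub>M borel"
  by (subst measurable_cong_sets[OF sets_sphere_measure refl]) (rule measurable_restrict_space1, simp)

lemma sgn_measurable [measurable]:
  "sgn \<in> borel_measurable (borel :: 'a::euclidean_space measure)"
  unfolding sgn_div_norm[abs_def] by measurable

lemma finite_sphere_measure: "finite_measure (sphere_measure :: 'a::euclidean_space measure)"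
  by (rule finite_measureI) (simp add: space_sphere_measure emeasure_sphere_measure_UNIV)

lemma sets_sph [simp, measurable_cong]: "sets (sph :: 'a::euclidean_space measure) = sets borel"
  and space_sph [simp]: "space (sph :: 'a::euclidean_space measure) = UNIV"
  by (simp_all add: sph_def)

lemma finite_sph: "finite_measure (sph :: 'a::euclidean_space measure)"
  unfolding sph_def by (rule finite_measure.finite_measure_distr[OF finite_sphere_measure ident_measurable_sphere])

lemma sigma_finite_sph: "sigma_finite_measure (sph :: 'a::euclidean_space measure)"
  using finite_sph by (rule finite_measure.axioms(1))

lemma emeasure_sph_UNIV:
  "emeasure (sph :: 'a::euclidean_space measure) UNIV = ennreal (real DIM('a) * unit_ball_vol (real DIM('a)))"
  unfolding sph_def
  by (subst emeasure_distr[OF ident_measurable_sphere])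
    (auto simp: space_sphere_measure emeasure_sphere_measure_UNIV)

lemma AE_sph_norm: "AE \<sigma> in (sph :: 'a::euclidean_space measure). norm \<sigma> = 1"
  unfolding sph_def
  by (subst AE_distr_iff[OF ident_measurable_sphere]) (auto simp: space_sphere_measure intro!: AE_I2)

lemma nn_integral_sph:
  fixes g :: "'a::euclidean_space \<Rightarrow> ennreal"
  assumes [measurable]: "g \<in> borel_measurable borel"
  shows "(\<integral>\<^sup>+\<sigma>. g \<sigma> \<partial>sph) =
    ennreal (real DIM('a)) * (\<integral>\<^sup>+y. g (sgn y) * indicator (ball 0 1) y \<partial>lborel)"
proof -
  let ?R = "restrict_space lborel (ball 0 1 - {0::'a})"
  have m: "sgn \<in> ?R \<rightarrow>\<^sub>M restrict_space borel (sphere 0 1 :: 'a set)"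
    by (rule measurable_restrict_space2)
       (auto simp: space_restrict_space norm_sgn sgn_div_norm intro!: measurable_restrict_space1)
  have g': "g \<in> borel_measurable (restrict_space borel (sphere 0 1))"
    by (rule measurable_restrict_space1) simp
  have "(\<integral>\<^sup>+\<sigma>. g \<sigma> \<partial>sph) = (\<integral>\<^sup>+\<sigma>. g \<sigma> \<partial>sphere_measure)"
    unfolding sph_def by (rule nn_integral_distr[OF ident_measurable_sphere]) simp
  also have "\<dots> = ennreal (real DIM('a)) *
      (\<integral>\<^sup>+\<sigma>. g \<sigma> \<partial>distr ?R (restrict_space borel (sphere 0 1)) sgn)"
    unfolding sphere_measure_def by (rule nn_integral_scale_measure) (simp add: g')
  also have "(\<integral>\<^sup>+\<sigma>. g \<sigma> \<partial>distr ?R (restrict_space borel (sphere 0 1)) sgn)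
      = (\<integral>\<^sup>+y. g (sgn y) \<partial>?R)"
    by (rule nn_integral_distr[OF m]) (simp add: g')
  also have "\<dots> = (\<integral>\<^sup>+y. g (sgn y) * indicator (ball 0 1 - {0}) y \<partial>lborel)"
    by (rule nn_integral_restrict_space) simp
  also have "\<dots> = (\<integral>\<^sup>+y. g (sgn y) * indicator (ball 0 1) y \<partial>lborel)"
    by (intro nn_integral_cong_AE eventually_mono[OF AE_lborel_singleton[of "0::'a"]])
       (simp split: split_indicator)
  finally show ?thesis .
qed

lemma nn_integral_lborel_affine:
  fixes f :: "'a::euclidean_space \<Rightarrow> ennreal"
  assumes [measurable]: "f \<in> borel_measurable borel" and c: "c \<noteq> 0"
  shows "(\<integral>\<^sup>+x. f x \<partial>lborel) = ennreal (\<bar>c\<bar> ^ DIM('a)) * (\<integral>\<^sup>+x. f (t + c *\<^sub>R x) \<partial>lborel)"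
proof -
  have "(\<integral>\<^sup>+x. f x \<partial>lborel) =
      (\<integral>\<^sup>+x. f x \<partial>density (distr lborel borel (\<lambda>x. t + c *\<^sub>R x)) (\<lambda>_. \<bar>c\<bar>^DIM('a)))"
    using lborel_affine[OF c, of t] by simp
  also have "\<dots> = (\<integral>\<^sup>+x. ennreal (\<bar>c\<bar>^DIM('a)) * f x \<partial>distr lborel borel (\<lambda>x. t + c *\<^sub>R x))"
    by (rule nn_integral_density) auto
  also have "\<dots> = (\<integral>\<^sup>+x. ennreal (\<bar>c\<bar>^DIM('a)) * f (t + c *\<^sub>R x) \<partial>lborel)"
    by (rule nn_integral_distr) auto
  also have "\<dots> = ennreal (\<bar>c\<bar>^DIM('a)) * (\<integral>\<^sup>+x. f (t + c *\<^sub>R x) \<partial>lborel)"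
    by (rule nn_integral_cmult) auto
  finally show ?thesis .
qed

lemma nn_integral_lborel_scale:
  fixes f :: "'a::euclidean_space \<Rightarrow> ennreal"
  assumes "f \<in> borel_measurable borel" and "0 < c"
  shows "(\<integral>\<^sup>+x. f x \<partial>lborel) = ennreal (c ^ DIM('a)) * (\<integral>\<^sup>+x. f (c *\<^sub>R x) \<partial>lborel)"
  using nn_integral_lborel_affine[of f c 0] assms by simp

lemma sgn_scaleR_pos: "0 < c \<Longrightarrow> sgn (c *\<^sub>R x) = sgn (x :: 'a::real_normed_vector)"
  by (simp add: sgn_scaleR)

lemma borel_measurable_curried2:
  fixes \<phi> :: "'b::second_countable_topology \<Rightarrow> 'c::second_countable_topology \<Rightarrow> ennreal"
  assumes "case_prod \<phi> \<in> borel_measurable borel"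
    and "p \<in> borel_measurable M" and "q \<in> borel_measurable M"
  shows "(\<lambda>z. \<phi> (p z) (q z)) \<in> borel_measurable M"
proof -
  have "(\<lambda>z. (p z, q z)) \<in> M \<rightarrow>\<^sub>M borel" using assms(2,3) by (rule borel_measurable_Pair)
  from measurable_compose[OF this assms(1)] show ?thesis by simp
qed

text \<open>
  Polar coordinates by scaling alone. Replacing \<open>y\<close> by \<open>y / |x|\<close> turns the unit ball into the
  ball of radius \<open>|x|\<close>; replacing then \<open>x\<close> by \<open>|y| x\<close> turns the constraint \<open>|y| < |x|\<close> into \<open>|x| > 1\<close>; and
  replacing finally \<open>y\<close> by \<open>u / |x|\<close> separates the two variables. The constant displayed on the right collects
  the Jacobians.
\<close>
lemma nn_integral_polar_up_to_constant:
  fixes \<phi> :: "real \<Rightarrow> 'a::euclidean_space \<Rightarrow> ennreal"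
  assumes "case_prod \<phi> \<in> borel_measurable borel"
  shows "(\<integral>\<^sup>+x. (\<integral>\<^sup>+y. \<phi> (norm x) (sgn y) * indicator (ball 0 1) y \<partial>lborel) \<partial>(lborel::'a measure))
    = (\<integral>\<^sup>+x. (if norm (x::'a) > 1 then ennreal (norm x powr (- 2 * real DIM('a))) else 0) \<partial>lborel)
       * (\<integral>\<^sup>+u. \<phi> (norm u) (sgn u) \<partial>lborel)"
proof -
  let ?d = "real DIM('a)"
  note [measurable] = borel_measurable_curried2[OF assms]
  have pw: "ennreal (norm x ^ DIM('a)) * (ennreal (norm x powr (- 2 * ?d)) * a) = ennreal (norm x powr (- ?d)) * a"
    if "x \<noteq> 0" for x :: 'a and a
  proof -
    have "norm x ^ DIM('a) * norm x powr (- 2 * ?d) = norm x powr (- ?d)"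
      using that by (simp add: powr_realpow[symmetric] powr_add[symmetric])
    thus ?thesis by (simp add: mult.assoc[symmetric] ennreal_mult[symmetric])
  qed
  have pw1: "ennreal (norm x ^ DIM('a)) * ennreal (norm x powr (- ?d)) = 1"
    if "x \<noteq> 0" for x :: 'a
    using that by (simp add: ennreal_mult[symmetric] powr_realpow[symmetric] powr_add[symmetric])
  have inner: "(\<integral>\<^sup>+y. \<phi> (norm x) (sgn y) * indicator (ball 0 1) y \<partial>lborel)
      = (\<integral>\<^sup>+y. ennreal (norm x powr (- ?d)) * (if norm y < norm x then \<phi> (norm x) (sgn y) else 0) \<partial>lborel)"
    if "x \<noteq> 0" for x :: 'a
  proof -
    have "(\<integral>\<^sup>+y. ennreal (norm x powr (- ?d)) * (if norm y < norm x then \<phi> (norm x) (sgn y) else 0) \<partial>lborel)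
      = ennreal (norm x ^ DIM('a)) * (\<integral>\<^sup>+y. ennreal (norm x powr (- ?d)) *
          (if norm (norm x *\<^sub>R y) < norm x then \<phi> (norm x) (sgn (norm x *\<^sub>R y)) else 0) \<partial>lborel)"
      by (rule nn_integral_lborel_scale[where c="norm x"]) (measurable, simp add: that)
    also have "\<dots> = ennreal (norm x ^ DIM('a)) * ennreal (norm x powr (- ?d)) * (\<integral>\<^sup>+y.
          (if norm (norm x *\<^sub>R y) < norm x then \<phi> (norm x) (sgn (norm x *\<^sub>R y)) else 0) \<partial>lborel)"
      by (subst nn_integral_cmult) (measurable, simp add: mult.assoc)
    also have "\<dots> = (\<integral>\<^sup>+y. (if norm (norm x *\<^sub>R y) < norm x then \<phi> (norm x) (sgn (norm x *\<^sub>R y)) else 0) \<partial>lborel)"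
      by (simp only: pw1[OF that] mult_1)
    also have "\<dots> = (\<integral>\<^sup>+y. \<phi> (norm x) (sgn y) * indicator (ball 0 1) y \<partial>lborel)"
      by (rule nn_integral_cong) (simp add: that sgn_scaleR_pos split: split_indicator)
    finally show ?thesis ..
  qed
  have "(\<integral>\<^sup>+x. (\<integral>\<^sup>+y. \<phi> (norm x) (sgn y) * indicator (ball 0 1) y \<partial>lborel) \<partial>(lborel::'a measure))
    = (\<integral>\<^sup>+x. (\<integral>\<^sup>+y. ennreal (norm x powr (- ?d)) * (if norm y < norm x then \<phi> (norm x) (sgn y) else 0) \<partial>lborel) \<partial>(lborel::'a measure))"
    by (rule nn_integral_cong_AE, rule eventually_mono[OF AE_lborel_singleton[of 0]]) (rule inner)
  also have "\<dots> = (\<integral>\<^sup>+y. (\<integral>\<^sup>+x. ennreal (norm x powr (- ?d)) * (if norm y < norm x then \<phi> (norm x) (sgn y) else 0) \<partial>(lborel::'a measure)) \<partial>lborel)"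
    by (rule lborel_pair.Fubini') measurable
  also have "\<dots> = (\<integral>\<^sup>+y. (\<integral>\<^sup>+x. (if norm x > 1 then ennreal (norm x powr (- ?d)) * \<phi> (norm x * norm y) (sgn y) else 0) \<partial>(lborel::'a measure)) \<partial>lborel)"
  proof (rule nn_integral_cong_AE, rule eventually_mono[OF AE_lborel_singleton[of 0]])
    fix y :: 'a assume y: "y \<noteq> 0"
    have "(\<integral>\<^sup>+x. ennreal (norm x powr (- ?d)) * (if norm y < norm x then \<phi> (norm x) (sgn y) else 0) \<partial>(lborel::'a measure))
      = ennreal (norm y ^ DIM('a)) * (\<integral>\<^sup>+x. ennreal (norm (norm y *\<^sub>R x) powr (- ?d)) *
          (if norm y < norm (norm y *\<^sub>R x) then \<phi> (norm (norm y *\<^sub>R x)) (sgn y) else 0) \<partial>(lborel::'a measure))"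
      by (rule nn_integral_lborel_scale[where c="norm y"]) (measurable, simp add: y)
    also have "\<dots> = (\<integral>\<^sup>+x. ennreal (norm y ^ DIM('a)) * (ennreal (norm (norm y *\<^sub>R x) powr (- ?d)) *
          (if norm y < norm (norm y *\<^sub>R x) then \<phi> (norm (norm y *\<^sub>R x)) (sgn y) else 0)) \<partial>(lborel::'a measure))"
      by (rule nn_integral_cmult[symmetric]) measurable
    also have "\<dots> = (\<integral>\<^sup>+x. (if norm x > 1 then ennreal (norm x powr (- ?d)) * \<phi> (norm x * norm y) (sgn y) else 0) \<partial>(lborel::'a measure))"
    proof (rule nn_integral_cong)
      fix x :: 'a
      have "ennreal (norm y ^ DIM('a)) * (ennreal (norm (norm y *\<^sub>R x) powr (- ?d)) * a) = ennreal (norm x powr (- ?d)) * a" for a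
      proof -
        have "ennreal (norm (norm y *\<^sub>R x) powr (- ?d)) = ennreal (norm y powr (- ?d)) * ennreal (norm x powr (- ?d))"
          by (simp add: powr_mult ennreal_mult)
        thus ?thesis using pw1[OF y] by (metis mult.assoc mult_1)
      qed
      thus "ennreal (norm y ^ DIM('a)) * (ennreal (norm (norm y *\<^sub>R x) powr (- ?d)) *
          (if norm y < norm (norm y *\<^sub>R x) then \<phi> (norm (norm y *\<^sub>R x)) (sgn y) else 0)) =
          (if norm x > 1 then ennreal (norm x powr (- ?d)) * \<phi> (norm x * norm y) (sgn y) else 0)"
        using y by (auto simp: mult.commute)
    qed
    finally show "(\<integral>\<^sup>+x. ennreal (norm x powr (- ?d)) * (if norm y < norm x then \<phi> (norm x) (sgn y) else 0) \<partial>(lborel::'a measure)) = 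
      (\<integral>\<^sup>+x. (if norm x > 1 then ennreal (norm x powr (- ?d)) * \<phi> (norm x * norm y) (sgn y) else 0) \<partial>(lborel::'a measure))" .
  qed
  also have "\<dots> = (\<integral>\<^sup>+x. (\<integral>\<^sup>+y. (if norm x > 1 then ennreal (norm x powr (- ?d)) * \<phi> (norm x * norm y) (sgn y) else 0) \<partial>lborel) \<partial>(lborel::'a measure))"
    by (rule lborel_pair.Fubini') measurable
  also have "\<dots> = (\<integral>\<^sup>+x. (if norm x > 1 then ennreal (norm x powr (- 2 * ?d)) else 0) * (\<integral>\<^sup>+u. \<phi> (norm u) (sgn u) \<partial>lborel) \<partial>(lborel::'a measure))"
  proof (rule nn_integral_cong)
    fix x :: 'a
    show "(\<integral>\<^sup>+y. (if norm x > 1 then ennreal (norm x powr (- ?d)) * \<phi> (norm x * norm y) (sgn y) else 0) \<partial>lborel)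
      = (if norm x > 1 then ennreal (norm x powr (- 2 * ?d)) else 0) * (\<integral>\<^sup>+u. \<phi> (norm u) (sgn u) \<partial>lborel)"
    proof (cases "norm x > 1")
      case True
      hence x: "x \<noteq> 0" by auto
      have "(\<integral>\<^sup>+u. ennreal (norm x powr (- 2 * ?d)) * \<phi> (norm u) (sgn u) \<partial>lborel)
        = ennreal (norm x ^ DIM('a)) * (\<integral>\<^sup>+u. ennreal (norm x powr (- 2 * ?d)) * \<phi> (norm (norm x *\<^sub>R u)) (sgn (norm x *\<^sub>R u)) \<partial>lborel)"
        by (rule nn_integral_lborel_scale[where c="norm x"]) (measurable, simp add: x)
      also have "\<dots> = (\<integral>\<^sup>+u. ennreal (norm x ^ DIM('a)) * (ennreal (norm x powr (- 2 * ?d)) * \<phi> (norm (norm x *\<^sub>R u)) (sgn (norm x *\<^sub>R u))) \<partial>lborel)"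
        by (rule nn_integral_cmult[symmetric]) measurable
      also have "\<dots> = (\<integral>\<^sup>+y. ennreal (norm x powr (- ?d)) * \<phi> (norm x * norm y) (sgn y) \<partial>lborel)"
        by (subst pw[OF x]) (use x in \<open>simp add: sgn_scaleR_pos\<close>)
      finally show ?thesis using True by (simp add: nn_integral_cmult)
    qed simp
  qed
  also have "\<dots> = (\<integral>\<^sup>+x. (if norm x > 1 then ennreal (norm x powr (- 2 * ?d)) else 0) \<partial>(lborel::'a measure))
       * (\<integral>\<^sup>+u. \<phi> (norm u) (sgn u) \<partial>lborel)"
    by (rule nn_integral_multc) measurable
  finally show ?thesis .
qed

lemma borel_measurable_curried3:
  fixes F :: "'b::second_countable_topology \<Rightarrow> 'c::second_countable_topology \<Rightarrow> 'd::second_countable_topology \<Rightarrow> ennreal"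
  assumes "(\<lambda>(x, y, z). F x y z) \<in> borel_measurable borel"
    and "p \<in> borel_measurable M" and "q \<in> borel_measurable M" and "r \<in> borel_measurable M"
  shows "(\<lambda>z. F (p z) (q z) (r z)) \<in> borel_measurable M"
proof -
  have "(\<lambda>z. (p z, q z, r z)) \<in> M \<rightarrow>\<^sub>M borel"
    using assms(2-4) by (intro borel_measurable_Pair)
  from measurable_compose[OF this assms(1)] show ?thesis by simp
qed

text \<open>
  Modulus and direction are independent under Lebesgue measure. The form with two vectors, of which one
  contributes only its norm, avoids the radial density \<open>r ^ (d - 1)\<close>.
\<close>
lemma nn_integral_polar:
  fixes \<phi> :: "real \<Rightarrow> 'a::euclidean_space \<Rightarrow> ennreal"
  assumes m: "case_prod \<phi> \<in> borel_measurable borel"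
  shows "(\<integral>\<^sup>+x. (\<integral>\<^sup>+\<sigma>. \<phi> (norm x) \<sigma> \<partial>sph) \<partial>(lborel :: 'a measure))
    = emeasure (sph :: 'a measure) UNIV * (\<integral>\<^sup>+u. \<phi> (norm u) (sgn u) \<partial>lborel)"
proof -
  define k where "k = ennreal (real DIM('a)) *
    (\<integral>\<^sup>+x. (if norm (x::'a) > 1 then ennreal (norm x powr (- 2 * real DIM('a))) else 0) \<partial>lborel)"
  have *: "(\<integral>\<^sup>+x. (\<integral>\<^sup>+\<sigma>. \<psi> (norm x) \<sigma> \<partial>sph) \<partial>(lborel :: 'a measure))
    = k * (\<integral>\<^sup>+u. \<psi> (norm u) (sgn u) \<partial>lborel)"
    if m: "case_prod \<psi> \<in> borel_measurable borel" for \<psi> :: "real \<Rightarrow> 'a \<Rightarrow> ennreal"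
  proof -
    note [measurable] = borel_measurable_curried2[OF m]
    have [measurable]: "ball 0 1 \<in> sets (borel :: 'a measure)" by simp
    have "(\<integral>\<^sup>+x. (\<integral>\<^sup>+\<sigma>. \<psi> (norm x) \<sigma> \<partial>sph) \<partial>(lborel :: 'a measure))
      = (\<integral>\<^sup>+x. ennreal (real DIM('a)) *
          (\<integral>\<^sup>+y. \<psi> (norm x) (sgn y) * indicator (ball 0 1) y \<partial>lborel) \<partial>(lborel :: 'a measure))"
      by (rule nn_integral_cong, rule nn_integral_sph) measurable
    also have "\<dots> = ennreal (real DIM('a)) * (\<integral>\<^sup>+x.
          (\<integral>\<^sup>+y. \<psi> (norm x) (sgn y) * indicator (ball 0 1) y \<partial>lborel) \<partial>(lborel :: 'a measure))"
      by (rule nn_integral_cmult) measurable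
    finally show ?thesis
      by (simp only: nn_integral_polar_up_to_constant[OF m] k_def mult.assoc)
  qed
  \<comment> \<open>The constant is found by testing with the indicator of the unit ball.\<close>
  define V where "V = unit_ball_vol (real DIM('a))"
  have V: "V > 0" by (simp add: V_def)
  have ball: "(\<integral>\<^sup>+x. (if norm x < 1 then 1 else 0) \<partial>(lborel :: 'a measure)) = ennreal V"
  proof -
    have "(\<integral>\<^sup>+x. (if norm x < 1 then 1 else 0) \<partial>(lborel :: 'a measure))
      = (\<integral>\<^sup>+x. indicator (ball 0 1) x \<partial>(lborel :: 'a measure))"
      by (rule nn_integral_cong) (simp split: split_indicator)
    thus ?thesis by (simp add: emeasure_ball V_def)
  qed
  have "(\<integral>\<^sup>+x. (\<integral>\<^sup>+\<sigma>. (if norm x < 1 then 1 else 0) \<partial>(sph :: 'a measure)) \<partial>(lborel :: 'a measure))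
     = k * (\<integral>\<^sup>+x. (if norm x < 1 then 1 else 0) \<partial>(lborel :: 'a measure))"
    by (rule *[of "\<lambda>r _. if r < 1 then 1 else 0"]) (simp add: borel_prod[symmetric])
  hence "k * ennreal V = (\<integral>\<^sup>+x. (if norm x < 1 then 1 else 0) * emeasure (sph :: 'a measure) UNIV \<partial>(lborel :: 'a measure))"
    by (simp add: ball)
  also have "\<dots> = ennreal V * emeasure (sph :: 'a measure) UNIV"
    by (subst nn_integral_multc) (simp_all add: ball)
  finally have "ennreal V * k = ennreal V * emeasure (sph :: 'a measure) UNIV"
    by (simp add: mult.commute)
  hence "k = emeasure (sph :: 'a measure) UNIV"
    using V by (simp add: ennreal_mult_cancel_left)
  with *[OF m] show ?thesis by simp
qed

section \<open>Exchange of pre- and post-collisional velocities\<close>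
definition collision_integral ::
    "('a::euclidean_space \<Rightarrow> 'a \<Rightarrow> 'a \<Rightarrow> ennreal) \<Rightarrow> ennreal" where
  "collision_integral F = (\<integral>\<^sup>+v. \<integral>\<^sup>+w. \<integral>\<^sup>+\<sigma>. F v w \<sigma> \<partial>sph \<partial>lborel \<partial>lborel)"

lemma collision_integral_center_of_mass:
  fixes F :: "'a::euclidean_space \<Rightarrow> 'a \<Rightarrow> 'a \<Rightarrow> ennreal"
  assumes F: "(\<lambda>(v, w, \<sigma>). F v w \<sigma>) \<in> borel_measurable borel"
  shows "collision_integral F =
    (\<integral>\<^sup>+m. \<integral>\<^sup>+u. \<integral>\<^sup>+\<sigma>. F (m + (1/2) *\<^sub>R u) (m - (1/2) *\<^sub>R u) \<sigma> \<partial>sph \<partial>lborel \<partial>lborel)"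
proof -
  interpret sph: sigma_finite_measure "sph :: 'a measure" by (rule sigma_finite_sph)
  note [measurable] = borel_measurable_curried3[OF F]
  have tr: "(\<integral>\<^sup>+x. f x \<partial>lborel) = (\<integral>\<^sup>+x. f (t + x) \<partial>lborel)"
    if "f \<in> borel_measurable borel" for f :: "'a \<Rightarrow> ennreal" and t
    using nn_integral_lborel_affine[OF that, of 1 t] by simp
  have "collision_integral F = (\<integral>\<^sup>+w. \<integral>\<^sup>+v. \<integral>\<^sup>+\<sigma>. F v w \<sigma> \<partial>sph \<partial>lborel \<partial>lborel)"
    unfolding collision_integral_def by (rule lborel_pair.Fubini') measurable
  also have "\<dots> = (\<integral>\<^sup>+w. \<integral>\<^sup>+u. \<integral>\<^sup>+\<sigma>. F (w + u) w \<sigma> \<partial>sph \<partial>lborel \<partial>lborel)"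
    by (rule nn_integral_cong, rule tr) measurable
  also have "\<dots> = (\<integral>\<^sup>+u. \<integral>\<^sup>+w. \<integral>\<^sup>+\<sigma>. F (w + u) w \<sigma> \<partial>sph \<partial>lborel \<partial>lborel)"
    by (rule lborel_pair.Fubini') measurable
  also have "\<dots> = (\<integral>\<^sup>+u. \<integral>\<^sup>+m. \<integral>\<^sup>+\<sigma>. F (- (1/2) *\<^sub>R u + m + u) (- (1/2) *\<^sub>R u + m) \<sigma> \<partial>sph \<partial>lborel \<partial>lborel)"
    by (rule nn_integral_cong, rule tr) measurable
  also have "\<dots> = (\<integral>\<^sup>+u. \<integral>\<^sup>+m. \<integral>\<^sup>+\<sigma>. F (m + (1/2) *\<^sub>R u) (m - (1/2) *\<^sub>R u) \<sigma> \<partial>sph \<partial>lborel \<partial>lborel)"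
  proof -
    have e: "m - (1/2) *\<^sub>R u + u = m + (1/2) *\<^sub>R u" for u m :: 'a
    proof -
      have "u = (1/2) *\<^sub>R u + (1/2) *\<^sub>R u" by (simp flip: scaleR_add_left)
      thus ?thesis by (simp add: algebra_simps)
    qed
    have e2: "- (1/2) *\<^sub>R u + m = m - (1/2) *\<^sub>R u" for u m :: 'a
      by simp
    show ?thesis by (simp only: e2 e)
  qed
  also have "\<dots> = (\<integral>\<^sup>+m. \<integral>\<^sup>+u. \<integral>\<^sup>+\<sigma>. F (m + (1/2) *\<^sub>R u) (m - (1/2) *\<^sub>R u) \<sigma> \<partial>sph \<partial>lborel \<partial>lborel)"
    by (rule lborel_pair.Fubini') measurable
  finally show ?thesis .
qed

lemma post_collisional_center_of_mass:
  "post_collisional (m + (1/2) *\<^sub>R u) (m - (1/2) *\<^sub>R u) \<sigma> = m + (norm u / 2) *\<^sub>R \<sigma>"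
proof -
  have 1: "m + (1/2) *\<^sub>R u + (m - (1/2) *\<^sub>R u) = 2 *\<^sub>R m"
    by (simp add: scaleR_2)
  have 2: "m + (1/2) *\<^sub>R u - (m - (1/2) *\<^sub>R u) = u"
    by (simp flip: scaleR_add_left)
  show ?thesis unfolding post_collisional_def 1 2 by simp
qed

lemma borel_measurable_post_collisional [measurable (raw)]:
  fixes p q r :: "'b \<Rightarrow> 'a::euclidean_space"
  assumes [measurable]: "p \<in> borel_measurable M" "q \<in> borel_measurable M" "r \<in> borel_measurable M"
  shows "(\<lambda>z. post_collisional (p z) (q z) (r z)) \<in> borel_measurable M"
  unfolding post_collisional_def by measurable

text \<open>
  With the centre of mass \<open>m\<close> fixed, the collision replaces \<open>u = |u| sgn u\<close> by \<open>|u| \<sigma>\<close>, so the exchange only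
  interchanges the two unit vectors \<open>sgn u\<close> and \<open>\<sigma>\<close>. In polar coordinates for \<open>u\<close> these are
  two independent variables with the same law, and Fubini's theorem gives the invariance.
\<close>
lemma collision_integral_swap:
  fixes F :: "'a::euclidean_space \<Rightarrow> 'a \<Rightarrow> 'a \<Rightarrow> ennreal"
  assumes F: "(\<lambda>(v, w, \<sigma>). F v w \<sigma>) \<in> borel_measurable borel"
  shows "collision_integral F = collision_integral (\<lambda>v w \<sigma>.
    F (post_collisional v w \<sigma>) (v + w - post_collisional v w \<sigma>) (sgn (v - w)))"
proof -
  interpret sph: sigma_finite_measure "sph :: 'a measure" by (rule sigma_finite_sph)
  interpret ss: pair_sigma_finite "sph :: 'a measure" "sph :: 'a measure" ..
  note [measurable] = borel_measurable_curried3[OF F]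
  let ?S = "emeasure (sph :: 'a measure) UNIV"
  have S: "?S \<noteq> 0" "?S \<noteq> top"
    by (simp_all add: emeasure_sph_UNIV ennreal_eq_0_iff not_le)
  have F': "(\<lambda>(v, w, \<sigma>). F (post_collisional v w \<sigma>) (v + w - post_collisional v w \<sigma>) (sgn (v - w)))
      \<in> borel_measurable borel"
    by (simp add: borel_prod[symmetric])
  have "(\<integral>\<^sup>+u. \<integral>\<^sup>+\<sigma>. F (m + (1/2) *\<^sub>R u) (m - (1/2) *\<^sub>R u) \<sigma> \<partial>sph \<partial>lborel)
      = (\<integral>\<^sup>+u. \<integral>\<^sup>+\<sigma>. F (m + (norm u / 2) *\<^sub>R \<sigma>) (m - (norm u / 2) *\<^sub>R \<sigma>) (sgn u) \<partial>sph \<partial>lborel)" for m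
  proof -
    define G where "G r \<tau> \<sigma> = F (m + (r/2) *\<^sub>R \<tau>) (m - (r/2) *\<^sub>R \<tau>) \<sigma>" for r \<tau> \<sigma>
    have [measurable]: "(\<lambda>z. G (p z) (q z) (r z)) \<in> borel_measurable M"
      if [measurable]: "p \<in> borel_measurable M" "q \<in> borel_measurable M" "r \<in> borel_measurable M"
      for p q r and M :: "(real \<times> 'a) measure"
      unfolding G_def by measurable
    have "?S * (\<integral>\<^sup>+u. \<integral>\<^sup>+\<sigma>. G (norm u) (sgn u) \<sigma> \<partial>sph \<partial>lborel)
        = (\<integral>\<^sup>+x. \<integral>\<^sup>+\<tau>. \<integral>\<^sup>+\<sigma>. G (norm x) \<tau> \<sigma> \<partial>sph \<partial>sph \<partial>(lborel :: 'a measure))"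
      by (rule nn_integral_polar[symmetric]) (unfold G_def borel_prod[symmetric], measurable)
    also have "\<dots> = (\<integral>\<^sup>+x. \<integral>\<^sup>+\<tau>. \<integral>\<^sup>+\<sigma>. G (norm x) \<sigma> \<tau> \<partial>sph \<partial>sph \<partial>(lborel :: 'a measure))"
      by (rule nn_integral_cong, rule ss.Fubini') (unfold G_def, measurable)
    also have "\<dots> = ?S * (\<integral>\<^sup>+u. \<integral>\<^sup>+\<sigma>. G (norm u) \<sigma> (sgn u) \<partial>sph \<partial>lborel)"
      by (rule nn_integral_polar) (unfold G_def borel_prod[symmetric], measurable)
    finally have "(\<integral>\<^sup>+u. \<integral>\<^sup>+\<sigma>. G (norm u) (sgn u) \<sigma> \<partial>sph \<partial>lborel)
        = (\<integral>\<^sup>+u. \<integral>\<^sup>+\<sigma>. G (norm u) \<sigma> (sgn u) \<partial>sph \<partial>lborel)"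
      using S by (simp add: ennreal_mult_cancel_left)
    moreover have "(norm u / 2) *\<^sub>R sgn u = (1/2) *\<^sub>R u" for u :: 'a
      by (cases "u = 0") (simp_all add: sgn_div_norm)
    ultimately show ?thesis unfolding G_def by simp
  qed
  thus ?thesis
    unfolding collision_integral_center_of_mass[OF F] collision_integral_center_of_mass[OF F']
    by (simp add: post_collisional_center_of_mass algebra_simps flip: scaleR_add_left)
qed

lemma nn_integral_collision:
  fixes F :: "'a::euclidean_space \<Rightarrow> 'a \<Rightarrow> 'a \<Rightarrow> ennreal"
  assumes F: "(\<lambda>(v, w, \<sigma>). F v w \<sigma>) \<in> borel_measurable borel"
  shows "(\<integral>\<^sup>+(v, w, \<sigma>). F v w \<sigma> \<partial>(lborel \<Otimes>\<^sub>M lborel \<Otimes>\<^sub>M sphere_measure)) = collision_integral F"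
proof -
  note [measurable] = borel_measurable_curried3[OF F]
  interpret sp: finite_measure "sphere_measure :: 'a measure" by (rule finite_sphere_measure)
  interpret lsp: pair_sigma_finite lborel "sphere_measure :: 'a measure" ..
  have P: "sigma_finite_measure (lborel \<Otimes>\<^sub>M (sphere_measure :: 'a measure))"
    ..
  have s2: "(\<lambda>x. snd (snd x)) \<in> borel_measurable (lborel \<Otimes>\<^sub>M lborel \<Otimes>\<^sub>M (sphere_measure :: 'a measure))"
    and s1: "(\<lambda>x. snd x) \<in> borel_measurable (lborel \<Otimes>\<^sub>M (sphere_measure :: 'a measure))"
    by (rule measurable_compose[OF measurable_compose[OF measurable_snd measurable_snd] ident_measurable_sphere],
        rule measurable_compose[OF measurable_snd ident_measurable_sphere])
  have m1: "(\<lambda>(v, w, \<sigma>). F v w \<sigma>) \<in> borel_measurable (lborel \<Otimes>\<^sub>M lborel \<Otimes>\<^sub>M (sphere_measure :: 'a measure))"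
    unfolding split_beta'
    by (rule borel_measurable_curried3[OF F]; (rule s2)?; measurable)
  have m2: "(\<lambda>(w, \<sigma>). F v w \<sigma>) \<in> borel_measurable (lborel \<Otimes>\<^sub>M (sphere_measure :: 'a measure))" for v
    unfolding split_beta'
    by (rule borel_measurable_curried3[OF F]; (rule s1)?; measurable)
  have "(\<integral>\<^sup>+(v, w, \<sigma>). F v w \<sigma> \<partial>(lborel \<Otimes>\<^sub>M lborel \<Otimes>\<^sub>M sphere_measure))
      = (\<integral>\<^sup>+v. \<integral>\<^sup>+(w, \<sigma>). F v w \<sigma> \<partial>(lborel \<Otimes>\<^sub>M sphere_measure) \<partial>lborel)"
    by (subst sigma_finite_measure.nn_integral_fst[OF P m1, symmetric]) simp
  also have "\<dots> = (\<integral>\<^sup>+v. \<integral>\<^sup>+w. \<integral>\<^sup>+\<sigma>. F v w \<sigma> \<partial>sphere_measure \<partial>lborel \<partial>lborel)"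
    by (subst sp.nn_integral_fst[OF m2, symmetric]) simp
  also have "\<dots> = collision_integral F"
    unfolding collision_integral_def sph_def
    by (subst nn_integral_distr[OF ident_measurable_sphere]) (simp_all, measurable)
  finally show ?thesis .
qed

section \<open>Areas of spherical caps and annuli\<close>
lemma emeasure_sph:
  fixes A :: "'a::euclidean_space set"
  assumes [measurable]: "A \<in> sets borel"
  shows "emeasure sph A = ennreal (real DIM('a)) * emeasure lborel {y \<in> ball 0 1. sgn y \<in> A}"
proof -
  have [measurable]: "ball 0 1 \<in> sets (borel :: 'a measure)" by simp
  have "emeasure sph A = (\<integral>\<^sup>+\<sigma>. indicator A \<sigma> \<partial>sph)" by simp
  also have "\<dots> = ennreal (real DIM('a)) * (\<integral>\<^sup>+y. indicator A (sgn y) * indicator (ball 0 1) y \<partial>lborel)"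
    by (rule nn_integral_sph) measurable
  also have "(\<integral>\<^sup>+y. indicator A (sgn y) * indicator (ball 0 1) y \<partial>lborel)
      = (\<integral>\<^sup>+y. indicator {y \<in> ball 0 1. sgn y \<in> A} y \<partial>lborel)"
    by (rule nn_integral_cong) (auto split: split_indicator)
  also have "\<dots> = emeasure lborel {y \<in> ball 0 1. sgn y \<in> A}"
    by (rule nn_integral_indicator) measurable
  finally show ?thesis .
qed

lemma norm_scaleR_sgn: "norm y *\<^sub>R sgn y = (y :: 'a::real_normed_vector)"
  by (cases "y = 0") (simp_all add: sgn_div_norm)

text \<open>
  The cone over a cap of radius \<open>r\<close> is covered by about \<open>1 / r\<close> balls of radius \<open>3 r\<close> along its axis. Their
  total volume is of order \<open>r ^ d / r\<close>, which is the sharp power \<open>d - 1\<close>.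
\<close>
lemma emeasure_cap_le:
  shows "\<exists>C>0. \<forall>(e :: 'a::euclidean_space) r. norm e = 1 \<longrightarrow> 0 < r \<longrightarrow> r \<le> 1 \<longrightarrow>
    emeasure sph {\<sigma>. norm (\<sigma> - e) \<le> r} \<le> ennreal (C * r ^ (DIM('a) - 1))"
proof -
  define d where "d = DIM('a)"
  have d: "d \<ge> 1" by (simp add: d_def Suc_leI)
  define V where "V = unit_ball_vol (real d)"
  have V: "V > 0" by (simp add: V_def)
  define C where "C = real d * (2 * V * 3 ^ d)"
  have "C > 0" using V d by (simp add: C_def)
  moreover have "emeasure sph {\<sigma>. norm (\<sigma> - e) \<le> r} \<le> ennreal (C * r ^ (d - 1))"
    if e: "norm e = 1" and r: "0 < r" "r \<le> 1" for e :: 'a and r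
  proof -
    define N where "N = nat \<lfloor>1 / r\<rfloor>"
    have N: "real N \<le> 1 / r" using r by (simp add: N_def)
    have "{y \<in> ball 0 1. sgn y \<in> {\<sigma>. norm (\<sigma> - e) \<le> r}} \<subseteq> (\<Union>j\<in>{..N}. ball ((real j * r) *\<^sub>R e) (3 * r))"
    proof safe
      fix y :: 'a assume y: "y \<in> ball 0 1" and s: "norm (sgn y - e) \<le> r"
      define t where "t = norm y"
      define j where "j = nat \<lfloor>t / r\<rfloor>"
      have t: "0 \<le> t" "t < 1" using y by (auto simp: t_def)
      have "t / r \<le> 1 / r" using t r by (simp add: divide_right_mono)
      hence jN: "j \<le> N" unfolding j_def N_def by (intro nat_mono floor_mono)
      have j0: "real j = of_int \<lfloor>t / r\<rfloor>" using t r by (simp add: j_def)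
      hence "real j \<le> t / r" "t / r < real j + 1" by linarith+
      hence j: "real j * r \<le> t" "t < real j * r + r" using r by (simp_all add: field_simps)
      have "norm (y - (real j * r) *\<^sub>R e) = norm (t *\<^sub>R (sgn y - e) + (t - real j * r) *\<^sub>R e)"
        by (simp add: t_def norm_scaleR_sgn algebra_simps)
      also have "\<dots> \<le> t * norm (sgn y - e) + (t - real j * r)"
        by (rule order.trans[OF norm_triangle_ineq]) (use t j e in simp)
      also have "\<dots> \<le> 1 * r + r"
        by (intro add_mono mult_mono) (use t j s in auto)
      also have "\<dots> < 3 * r" using r by simp
      finally have "y \<in> ball ((real j * r) *\<^sub>R e) (3 * r)"
        by (simp add: dist_norm norm_minus_commute)
      with jN show "y \<in> (\<Union>j\<in>{..N}. ball ((real j * r) *\<^sub>R e) (3 * r))" by blast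
    qed
    hence "emeasure lborel {y \<in> ball 0 1. sgn y \<in> {\<sigma>. norm (\<sigma> - e) \<le> r}}
        \<le> emeasure lborel (\<Union>j\<in>{..N}. ball ((real j * r) *\<^sub>R e) (3 * r))"
      by (rule emeasure_mono) auto
    also have "\<dots> \<le> (\<Sum>j\<in>{..N}. emeasure lborel (ball ((real j * r) *\<^sub>R e) (3 * r)))"
      by (rule emeasure_subadditive_finite) auto
    also have "\<dots> = (\<Sum>j\<in>{..N}. ennreal (V * (3 * r) ^ d))"
      using r by (simp add: emeasure_ball V_def d_def)
    also have "\<dots> = ennreal (real (N + 1) * (V * (3 * r) ^ d))"
      using V r by (simp add: ennreal_mult ennreal_of_nat_eq_real_of_nat add.commute)
    also have "\<dots> \<le> ennreal ((2 / r) * (V * (3 * r) ^ d))"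
    proof (intro ennreal_leI mult_right_mono)
      have "1 \<le> 1 / r" using r by simp
      thus "real (N + 1) \<le> 2 / r" using N by (simp add: add_divide_distrib[symmetric])
    qed (use V r in simp)
    also have "(2 / r) * (V * (3 * r) ^ d) = 2 * V * 3 ^ d * r ^ (d - 1)"
      using d r by (cases d) (simp_all add: power_mult_distrib field_simps)
    finally have "emeasure lborel {y \<in> ball 0 1. sgn y \<in> {\<sigma>. norm (\<sigma> - e) \<le> r}}
      \<le> ennreal (2 * V * 3 ^ d * r ^ (d - 1))" .
    hence "ennreal (real d) * emeasure lborel {y \<in> ball 0 1. sgn y \<in> {\<sigma>. norm (\<sigma> - e) \<le> r}}
      \<le> ennreal (real d) * ennreal (2 * V * 3 ^ d * r ^ (d - 1))"
      by (rule mult_left_mono) simp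
    also have "\<dots> = ennreal (C * r ^ (d - 1))"
      using V r by (simp add: C_def ennreal_mult[symmetric] mult.assoc)
    finally show ?thesis by (subst emeasure_sph) (simp_all add: d_def)
  qed
  ultimately show ?thesis unfolding d_def by blast
qed

lemma norm_sgn_diff_le:
  fixes y x :: "'a::real_normed_vector"
  assumes "norm x = 1" and "0 < t"
  shows "norm (sgn y - x) \<le> 2 * norm (y - t *\<^sub>R x) / t"
proof -
  have "t * norm (sgn y - x) = norm (t *\<^sub>R (sgn y - x))"
    using assms by simp
  also have "\<dots> = norm ((t - norm y) *\<^sub>R sgn y + (y - t *\<^sub>R x))"
    by (simp add: norm_scaleR_sgn algebra_simps)
  also have "\<dots> \<le> \<bar>t - norm y\<bar> * norm (sgn y) + norm (y - t *\<^sub>R x)"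
    by (rule order.trans[OF norm_triangle_ineq]) simp
  also have "\<dots> \<le> \<bar>t - norm y\<bar> + norm (y - t *\<^sub>R x)"
    by (simp add: norm_sgn)
  also have "\<bar>t - norm y\<bar> \<le> norm (y - t *\<^sub>R x)"
    using norm_triangle_ineq3[of "t *\<^sub>R x" y] assms by (simp add: norm_minus_commute)
  finally show ?thesis using assms by (simp add: field_simps)
qed

text \<open>
  Counterpart of the preceding covering: some unit vector lies at distance \<open>3 r / 2\<close> from \<open>e\<close>, because the
  sphere is connected in dimension at least two, and the cone over the annulus contains
  about \<open>1 / r\<close> disjoint balls of radius \<open>r / 8\<close> along the ray through it.
\<close>
lemma emeasure_annulus_ge:
  assumes dim: "DIM('a::euclidean_space) \<ge> 2"
  shows "\<exists>c>0. \<forall>(e :: 'a) r. norm e = 1 \<longrightarrow> 0 < r \<longrightarrow> r \<le> 1 / 2 \<longrightarrow>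
    ennreal (c * r ^ (DIM('a) - 1)) \<le> emeasure sph {\<sigma>. r \<le> norm (\<sigma> - e) \<and> norm (\<sigma> - e) \<le> 2 * r}"
proof -
  define d where "d = DIM('a)"
  have d: "d \<ge> 1" using dim by (simp add: d_def)
  define V where "V = unit_ball_vol (real d)"
  have V: "V > 0" by (simp add: V_def)
  define c where "c = real d * (V / 8 ^ d)"
  have "c > 0" using V d by (simp add: c_def)
  moreover have "ennreal (c * r ^ (d - 1)) \<le> emeasure sph {\<sigma>. r \<le> norm (\<sigma> - e) \<and> norm (\<sigma> - e) \<le> 2 * r}"
    if e: "norm e = 1" and r: "0 < r" "r \<le> 1 / 2" for e :: 'a and r
  proof -
    let ?A = "{\<sigma>. r \<le> norm (\<sigma> - e) \<and> norm (\<sigma> - e) \<le> 2 * r}"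
    obtain s where s: "norm s = 1" "norm (s - e) = 3 / 2 * r"
    proof -
      have "connected ((\<lambda>s. norm (s - e)) ` sphere 0 1)"
        by (intro connected_continuous_image connected_sphere dim continuous_intros)
      moreover have "0 \<in> (\<lambda>s. norm (s - e)) ` sphere 0 1"
        using e by (intro image_eqI[of _ _ e]) auto
      moreover have "norm (- e - e) \<in> (\<lambda>s. norm (s - e)) ` sphere 0 1"
        using e by (intro imageI) auto
      moreover have "norm (- e - e) = 2"
      proof -
        have "- e - e = (- 2) *\<^sub>R e" by (simp add: scaleR_2)
        thus ?thesis using e by simp
      qed
      ultimately have "3 / 2 * r \<in> (\<lambda>s. norm (s - e)) ` sphere 0 1"
        using r connectedD_interval[of "(\<lambda>s. norm (s - e)) ` sphere 0 1" 0 2 "3 / 2 * r"] by simp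
      thus thesis using that by auto
    qed
    define N where "N = nat \<lceil>1 / r\<rceil>"
    have N: "1 / r \<le> real N" by (simp add: N_def real_nat_ceiling_ge)
    define t where "t j = 1 / 2 + real j * (r / 4)" for j :: nat
    have jb: "real j * r \<le> 1" if "j < N" for j
    proof -
      from that have "int j < \<lceil>1 / r\<rceil>" by (simp add: N_def)
      hence "real j < 1 / r" by (simp add: less_ceiling_iff)
      thus ?thesis using r by (simp add: field_simps)
    qed
    have t: "1 / 2 \<le> t j" "t j \<le> 3 / 4" if "j < N" for j
      using jb[OF that] r by (simp_all add: t_def)
    have sub: "(\<Union>j\<in>{..<N}. ball (t j *\<^sub>R s) (r / 8)) \<subseteq> {y \<in> ball 0 1. sgn y \<in> ?A}"
    proof
      fix y assume "y \<in> (\<Union>j\<in>{..<N}. ball (t j *\<^sub>R s) (r / 8))"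
      then obtain j where j: "j \<in> {..<N}" and y: "y \<in> ball (t j *\<^sub>R s) (r / 8)" by blast
      have y': "norm (y - t j *\<^sub>R s) < r / 8" using y by (simp add: dist_norm norm_minus_commute)
      have tj: "1 / 2 \<le> t j" "t j \<le> 3 / 4" using t j by auto
      have "norm y \<le> norm (y - t j *\<^sub>R s) + norm (t j *\<^sub>R s)"
        using norm_triangle_ineq[of "y - t j *\<^sub>R s" "t j *\<^sub>R s"] by simp
      also have "\<dots> < 1" using y' tj s r by simp
      finally have y1: "y \<in> ball 0 1" by simp
      have "norm (sgn y - s) \<le> 2 * norm (y - t j *\<^sub>R s) / t j"
        by (rule norm_sgn_diff_le) (use s tj in auto)
      also have "\<dots> \<le> 2 * (r / 8) / (1 / 2)"
        by (rule frac_le) (use y' tj r in auto)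
      finally have *: "norm (sgn y - s) \<le> r / 2" by simp
      have "r \<le> norm (sgn y - e)"
        using norm_triangle_ineq[of "s - sgn y" "sgn y - e"] * s by (simp add: norm_minus_commute)
      moreover have "norm (sgn y - e) \<le> 2 * r"
        using norm_triangle_ineq[of "sgn y - s" "s - e"] * s by simp
      ultimately show "y \<in> {y \<in> ball 0 1. sgn y \<in> ?A}" using y1 by simp
    qed
    have disj: "disjoint_family_on (\<lambda>j. ball (t j *\<^sub>R s) (r / 8)) {..<N}"
      unfolding disjoint_family_on_def
    proof (intro ballI impI)
      fix i j :: nat assume "i \<noteq> j"
      have "1 \<le> \<bar>real i - real j\<bar>" using \<open>i \<noteq> j\<close> by linarith
      hence "r / 4 \<le> \<bar>real i - real j\<bar> * (r / 4)" using r by simp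
      also have "\<dots> = \<bar>t i - t j\<bar>"
      proof -
        have e: "t i - t j = (real i - real j) * (r / 4)" by (simp add: t_def left_diff_distrib)
        show ?thesis unfolding e abs_mult using r by simp
      qed
      also have "\<dots> = norm (t i *\<^sub>R s - t j *\<^sub>R s)" using s by (simp flip: scaleR_left_diff_distrib)
      finally have *: "r / 4 \<le> dist (t i *\<^sub>R s) (t j *\<^sub>R s)" by (simp add: dist_norm)
      show "ball (t i *\<^sub>R s) (r / 8) \<inter> ball (t j *\<^sub>R s) (r / 8) = {}"
        by (rule disjoint_ballI) (use * in simp)
    qed
    have "ennreal (V / 8 ^ d * r ^ (d - 1)) = ennreal ((1 / r) * (V * (r / 8) ^ d))"
      using d r by (cases d) (simp_all add: power_divide field_simps)
    also have "\<dots> \<le> ennreal (real N * (V * (r / 8) ^ d))"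
      using N V r by (intro ennreal_leI mult_right_mono) auto
    also have "\<dots> = (\<Sum>j\<in>{..<N}. emeasure lborel (ball (t j *\<^sub>R s) (r / 8)))"
      using V r by (simp add: emeasure_ball V_def d_def ennreal_mult ennreal_of_nat_eq_real_of_nat)
    also have "\<dots> = emeasure lborel (\<Union>j\<in>{..<N}. ball (t j *\<^sub>R s) (r / 8))"
      using disj by (intro sum_emeasure) auto
    also have "\<dots> \<le> emeasure lborel {y \<in> ball 0 1. sgn y \<in> ?A}"
      by (intro emeasure_mono sub) measurable
    finally have "ennreal (real d) * ennreal (V / 8 ^ d * r ^ (d - 1)) \<le> ennreal (real d) * emeasure lborel {y \<in> ball 0 1. sgn y \<in> ?A}"
      by (rule mult_left_mono) simp
    also have "ennreal (real d) * ennreal (V / 8 ^ d * r ^ (d - 1)) = ennreal (c * r ^ (d - 1))"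
      using V r by (simp add: c_def ennreal_mult[symmetric] mult.assoc)
    finally show ?thesis by (subst emeasure_sph) (simp_all add: d_def)
  qed
  ultimately show ?thesis unfolding d_def by blast
qed

section \<open>The Maxwellian and its moments\<close>
lemma maxwellian_pos: "maxwellian v > 0"
  by (simp add: maxwellian_def)

lemma borel_measurable_maxwellian [measurable]: "maxwellian \<in> borel_measurable borel"
  unfolding maxwellian_def[abs_def] by measurable

lemma borel_measurable_japanese_bracket [measurable]:
  "japanese_bracket \<in> borel_measurable borel"
  unfolding japanese_bracket_def[abs_def] by measurable

lemma japanese_bracket_ge_1: "\<langle>v\<rangle> \<ge> 1"
  by (simp add: japanese_bracket_def)

lemma nn_integral_maxwellian:
  "(\<integral>\<^sup>+v. ennreal (maxwellian (v :: 'a::euclidean_space)) \<partial>lborel) = 1"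
proof -
  have "maxwellian v = (\<Prod>b\<in>Basis. std_normal_density (v \<bullet> b))" for v :: 'a
  proof -
    have "(\<Prod>b\<in>Basis. std_normal_density (v \<bullet> b))
        = (1 / sqrt (2 * pi)) ^ DIM('a) * exp (\<Sum>b\<in>Basis. - (v \<bullet> b)\<^sup>2 / 2)"
      unfolding std_normal_density_def prod.distrib prod_constant by (simp add: exp_sum)
    also have "(\<Sum>b\<in>Basis. - (v \<bullet> b)\<^sup>2 / 2) = - (norm v)\<^sup>2 / 2"
      unfolding power2_norm_eq_inner
      by (subst euclidean_inner) (simp add: power2_eq_square sum_negf sum_divide_distrib)
    also have "(1 / sqrt (2 * pi)) ^ DIM('a) = (2 * pi) powr (- real DIM('a) / 2)"
    proof -
      have "1 / sqrt (2 * pi) = (2 * pi) powr (- (1 / 2))"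
        by (simp only: powr_minus_divide) (simp add: powr_half_sqrt)
      hence "(1 / sqrt (2 * pi)) ^ DIM('a) = ((2 * pi) powr (- (1 / 2))) powr real DIM('a)"
        by (simp only: powr_realpow[symmetric] powr_gt_zero) (simp add: powr_realpow)
      thus ?thesis by (simp add: powr_powr)
    qed
    finally show ?thesis by (simp add: maxwellian_def)
  qed
  hence "(\<integral>\<^sup>+v. ennreal (maxwellian (v :: 'a)) \<partial>lborel)
      = (\<integral>\<^sup>+v. (\<Prod>b\<in>Basis. ennreal (std_normal_density (v \<bullet> b))) \<partial>(lborel :: 'a measure))"
    by (simp add: prod_ennreal)
  also have "\<dots> = (\<Prod>b\<in>(Basis::'a set). \<integral>\<^sup>+x. ennreal (std_normal_density x) \<partial>lborel)"
    by (rule nn_integral_lborel_prod) auto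
  also have "(\<integral>\<^sup>+x. ennreal (std_normal_density x) \<partial>lborel) = 1"
    by (subst nn_integral_eq_integral) auto
  finally show ?thesis by simp
qed

text \<open>
  Any power of \<open>\<langle>v\<rangle>\<close> is absorbed by \<open>exp (|v|\<^sup>2 / 4)\<close>; what is left is a rescaled Maxwellian.
\<close>
lemma maxwellian_moment_finite:
  "(\<integral>\<^sup>+v. ennreal (\<langle>v\<rangle> powr q * maxwellian (v :: 'a::euclidean_space)) \<partial>lborel) < \<infinity>"
proof -
  define k where "k = nat \<lceil>\<bar>q\<bar>\<rceil>"
  have k: "\<bar>q\<bar> \<le> real k" by (simp add: k_def real_nat_ceiling_ge)
  define C where "C = 4 ^ k * fact k * exp (1 / 4 :: real)"
  have C: "C \<ge> 0" by (simp add: C_def)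
  have bound: "\<langle>v\<rangle> powr q * maxwellian v \<le> C * maxwellian ((1 / sqrt 2) *\<^sub>R v)" for v :: 'a
  proof -
    define x where "x = 1 + (norm v)\<^sup>2"
    have x: "x \<ge> 1" by (simp add: x_def)
    have "\<langle>v\<rangle> powr q \<le> \<langle>v\<rangle> powr (2 * real k)"
      using k by (intro powr_mono japanese_bracket_ge_1) auto
    also have "\<dots> = x ^ k"
    proof -
      have "\<langle>v\<rangle> powr (2 * real k) = (\<langle>v\<rangle> ^ 2) ^ k"
        using japanese_bracket_ge_1[of v]
        by (subst power_mult[symmetric], subst powr_realpow[symmetric]) auto
      also have "\<langle>v\<rangle> ^ 2 = x" by (simp add: japanese_bracket_def x_def)
      finally show ?thesis .
    qed
    also have "\<dots> \<le> 4 ^ k * fact k * exp (x / 4)"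
    proof -
      have "(\<Sum>n\<in>{k}. (x / 4) ^ n /\<^sub>R fact n) \<le> (\<Sum>n. (x / 4) ^ n /\<^sub>R fact n)"
        using x by (intro sum_le_suminf sums_summable[OF exp_converges]) auto
      hence "(x / 4) ^ k / fact k \<le> exp (x / 4)"
        using sums_unique[OF exp_converges[of "x / 4"]]
        by (simp add: divide_inverse_commute[of _ "fact k"])
      thus ?thesis by (simp add: power_divide field_simps)
    qed
    also have "\<dots> = C * exp ((norm v)\<^sup>2 / 4)"
      by (simp add: C_def x_def add_divide_distrib exp_add)
    finally have "\<langle>v\<rangle> powr q * maxwellian v \<le> C * exp ((norm v)\<^sup>2 / 4) * maxwellian v"
      using maxwellian_pos[of v] by (intro mult_right_mono) auto
    also have "\<dots> = C * maxwellian ((1 / sqrt 2) *\<^sub>R v)"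
    proof -
      have "exp ((norm v)\<^sup>2 / 4) * exp (- (norm v)\<^sup>2 / 2) = exp (- (norm ((1 / sqrt 2) *\<^sub>R v))\<^sup>2 / 2)"
        by (simp add: exp_add[symmetric] power_divide)
      thus ?thesis by (simp add: maxwellian_def)
    qed
    finally show ?thesis .
  qed
  have "(\<integral>\<^sup>+v. ennreal (maxwellian ((1 / sqrt 2) *\<^sub>R (v::'a))) \<partial>lborel) < \<infinity>"
  proof -
    have "1 = ennreal ((1 / sqrt 2) ^ DIM('a)) * (\<integral>\<^sup>+v. ennreal (maxwellian ((1 / sqrt 2) *\<^sub>R (v::'a))) \<partial>lborel)"
      using nn_integral_lborel_scale[of "\<lambda>v::'a. ennreal (maxwellian v)" "1 / sqrt 2"]
      by (simp add: nn_integral_maxwellian)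
    thus ?thesis by (cases "(\<integral>\<^sup>+v. ennreal (maxwellian ((1 / sqrt 2) *\<^sub>R (v::'a))) \<partial>lborel)")
      (auto simp: ennreal_mult_top)
  qed
  hence "ennreal C * (\<integral>\<^sup>+v. ennreal (maxwellian ((1 / sqrt 2) *\<^sub>R (v::'a))) \<partial>lborel) < \<infinity>"
    by (simp add: ennreal_mult_less_top)
  moreover have "(\<integral>\<^sup>+v. ennreal (\<langle>v\<rangle> powr q * maxwellian (v :: 'a)) \<partial>lborel)
     \<le> (\<integral>\<^sup>+v. ennreal C * ennreal (maxwellian ((1 / sqrt 2) *\<^sub>R (v::'a))) \<partial>lborel)"
    using bound C by (intro nn_integral_mono)
      (subst ennreal_mult[symmetric], auto intro: ennreal_leI less_imp_le[OF maxwellian_pos])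
  moreover have "\<dots> = ennreal C * (\<integral>\<^sup>+v. ennreal (maxwellian ((1 / sqrt 2) *\<^sub>R (v::'a))) \<partial>lborel)"
    by (rule nn_integral_cmult) measurable
  ultimately show ?thesis by simp
qed

section \<open>Lower bound for the collision kernel\<close>
lemma half_le_sin:
  assumes "0 \<le> x" "x \<le> pi / 2"
  shows "x / 2 \<le> sin x"
proof (cases "x \<le> pi / 3")
  case True
  have "\<exists>z. 0 \<le> z \<and> z \<le> x \<and> sin x - sin 0 = (x - 0) * cos z"
  proof (cases "x = 0")
    case False
    hence "\<exists>z. 0 < z \<and> z < x \<and> sin x - sin 0 = (x - 0) * cos z"
      using assms by (intro MVT2) auto
    thus ?thesis by (auto intro: less_imp_le)
  qed auto
  then obtain z where z: "0 \<le> z" "z \<le> x" "sin x = x * cos z" by auto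
  have "cos (pi / 3) \<le> cos z"
    using z True by (intro cos_monotone_0_pi_le) auto
  hence "x * (1 / 2) \<le> x * cos z"
    using assms by (intro mult_left_mono) (auto simp: cos_60)
  thus ?thesis using z by simp
next
  case False
  have "sin (pi / 3) \<le> sin x"
    using False assms by (intro sin_monotone_2pi_le) auto
  moreover have "sqrt 3 \<ge> 1.7" by (rule real_le_rsqrt) (simp add: power2_eq_square)
  moreover have "pi < 3.2" using pi_approx by simp
  ultimately show ?thesis using assms by (simp add: sin_60)
qed

lemma angle_le_chord:
  fixes a s :: "'a::euclidean_space"
  assumes "norm a = 1" "norm s = 1"
  shows "arccos (a \<bullet> s) \<le> 2 * norm (a - s)"
proof -
  define \<theta> where "\<theta> = arccos (a \<bullet> s)"
  have b: "- 1 \<le> a \<bullet> s" "a \<bullet> s \<le> 1"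
    using Cauchy_Schwarz_ineq2[of a s] assms by auto
  have \<theta>: "0 \<le> \<theta>" "\<theta> \<le> pi" "cos \<theta> = a \<bullet> s"
    using b by (auto simp: \<theta>_def arccos_lbound arccos_ubound)
  have "(norm (a - s))\<^sup>2 = 2 - 2 * cos \<theta>"
  proof -
    have "(norm (a - s))\<^sup>2 = (norm a)\<^sup>2 + (norm s)\<^sup>2 - 2 * (a \<bullet> s)"
      by (simp add: power2_norm_eq_inner inner_diff_left inner_diff_right inner_commute)
    thus ?thesis using assms \<theta>(3) by simp
  qed
  also have "\<dots> = (2 * sin (\<theta> / 2))\<^sup>2"
    using cos_double_sin[of "\<theta> / 2"] by (simp add: power_mult_distrib)
  finally have "norm (a - s) = 2 * sin (\<theta> / 2)"
    using \<theta> by (elim power2_eq_imp_eq) (auto intro!: sin_ge_zero)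
  moreover have "\<theta> / 2 / 2 \<le> sin (\<theta> / 2)" using \<theta> by (intro half_le_sin) auto
  ultimately show ?thesis by (simp add: \<theta>_def)
qed

text \<open>
  The angular singularity in terms of the chord \<open>|\<sigma> - sgn u|\<close>, which is proportional
  to \<open>|v' - v|\<close>. The chord is at least half of the angle, hence the factor \<open>2 powr (- p)\<close>.
\<close>
lemma collision_kernel_ge:
  fixes u \<sigma> :: "'a::euclidean_space"
  assumes b: "\<And>\<theta>. \<theta> \<in> {0<..pi} \<Longrightarrow> c0 * \<bar>\<theta>\<bar> powr (- p) \<le> b (cos \<theta>)"
    and "c0 > 0" "p \<ge> 0" and u: "u \<noteq> 0" and s: "norm \<sigma> = 1" "\<sigma> \<noteq> sgn u"
  shows "c0 * 2 powr (- p) * norm u powr \<gamma> * norm (\<sigma> - sgn u) powr (- p) \<le> collision_kernel \<gamma> b u \<sigma>"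
proof -
  define \<theta> where "\<theta> = arccos (sgn u \<bullet> \<sigma>)"
  have nu: "norm (sgn u) = 1" using u by (simp add: norm_sgn)
  have bd: "- 1 \<le> sgn u \<bullet> \<sigma>" "sgn u \<bullet> \<sigma> \<le> 1"
    using Cauchy_Schwarz_ineq2[of "sgn u" \<sigma>] nu s by auto
  have \<theta>: "0 \<le> \<theta>" "\<theta> \<le> pi" "cos \<theta> = sgn u \<bullet> \<sigma>"
    using bd by (auto simp: \<theta>_def arccos_lbound arccos_ubound)
  have "\<theta> \<noteq> 0"
  proof
    assume "\<theta> = 0"
    hence "sgn u \<bullet> \<sigma> = norm (sgn u) * norm \<sigma>" using \<theta>(3) nu s by simp
    hence "norm (sgn u) *\<^sub>R \<sigma> = norm \<sigma> *\<^sub>R sgn u" by (subst (asm) norm_cauchy_schwarz_eq)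
    thus False using nu s by simp
  qed
  hence pos: "\<theta> \<in> {0<..pi}" using \<theta> by auto
  have "\<theta> \<le> 2 * norm (\<sigma> - sgn u)"
    using angle_le_chord[OF nu s(1)] by (simp add: \<theta>_def norm_minus_commute)
  hence "(2 * norm (\<sigma> - sgn u)) powr (- p) \<le> \<theta> powr (- p)"
    using pos \<open>p \<ge> 0\<close> by (intro powr_mono2') auto
  hence "c0 * (2 powr (- p) * norm (\<sigma> - sgn u) powr (- p)) \<le> c0 * \<bar>\<theta>\<bar> powr (- p)"
    using \<open>c0 > 0\<close> pos by (intro mult_left_mono) (auto simp: powr_mult)
  also have "\<dots> \<le> b (cos \<theta>)" by (rule b[OF pos])
  finally have "norm u powr \<gamma> * (c0 * (2 powr (- p) * norm (\<sigma> - sgn u) powr (- p))) \<le> norm u powr \<gamma> * b (sgn u \<bullet> \<sigma>)"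
    unfolding \<theta>(3) by (rule mult_left_mono) simp
  thus ?thesis by (simp add: collision_kernel_def mult_ac)
qed

lemma norm_post_collisional_diff:
  "norm (post_collisional v w \<sigma> - v) = norm (v - w) / 2 * norm (\<sigma> - sgn (v - w))"
proof -
  have e: "(1 / 2) *\<^sub>R (v + w) - v = - (1 / 2) *\<^sub>R (v - w)"
    using scaleR_half_double[of v] by (simp add: algebra_simps)
  have "post_collisional v w \<sigma> - v = (norm (v - w) / 2) *\<^sub>R \<sigma> + ((1 / 2) *\<^sub>R (v + w) - v)"
    by (simp add: post_collisional_def)
  also have "\<dots> = (norm (v - w) / 2) *\<^sub>R (\<sigma> - sgn (v - w))"
  proof -
    have "(1 / 2) *\<^sub>R (v - w) = (norm (v - w) / 2) *\<^sub>R sgn (v - w)"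
      using arg_cong[OF norm_scaleR_sgn[of "v - w"], of "scaleR (1 / 2)"] by simp
    hence "(norm (v - w) / 2) *\<^sub>R (\<sigma> - sgn (v - w)) = (norm (v - w) / 2) *\<^sub>R \<sigma> - (1 / 2) *\<^sub>R (v - w)"
      by (simp only: scaleR_diff_right)
    thus ?thesis unfolding e by simp
  qed
  finally show ?thesis by simp
qed

section \<open>Grazing collisions of a prescribed size\<close>
lemma powr_comparable:
  fixes x y s :: real
  assumes "0 < x" "x / 2 \<le> y" "y \<le> 2 * x"
  shows "y powr s \<le> 2 powr \<bar>s\<bar> * x powr s"
proof (cases "0 \<le> s")
  case True
  hence "y powr s \<le> (2 * x) powr s" using assms by (intro powr_mono2) auto
  thus ?thesis using True assms by (simp add: powr_mult)
next
  case False
  hence "y powr s \<le> (x / 2) powr s" using assms by (intro powr_mono2') auto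
  thus ?thesis using False assms by (simp add: powr_divide powr_minus_divide)
qed

lemma post_collisional_relative:
  "post_collisional v w \<sigma> - (v + w - post_collisional v w \<sigma>) = norm (v - w) *\<^sub>R \<sigma>"
proof -
  define c where "c = (1 / 2) *\<^sub>R (v + w)"
  define z where "z = (norm (v - w) / 2) *\<^sub>R \<sigma>"
  have "v + w = c + c" by (simp only: c_def flip: scaleR_add_left) simp
  moreover have "post_collisional v w \<sigma> = c + z" by (simp add: post_collisional_def c_def z_def)
  ultimately have "post_collisional v w \<sigma> - (v + w - post_collisional v w \<sigma>) = z + z"
    by (simp only:) simp
  thus ?thesis by (simp add: z_def flip: scaleR_add_left)
qed

lemma post_collisional_involutive:
  assumes "norm \<sigma> = 1"
  shows "post_collisional (post_collisional v w \<sigma>) (v + w - post_collisional v w \<sigma>) (sgn (v - w)) = v"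
proof -
  have "post_collisional (post_collisional v w \<sigma>) (v + w - post_collisional v w \<sigma>) (sgn (v - w))
     = (1 / 2) *\<^sub>R (v + w) + (norm (norm (v - w) *\<^sub>R \<sigma>) / 2) *\<^sub>R sgn (v - w)"
    by (subst post_collisional_def, subst post_collisional_relative) simp
  also have "\<dots> = (1 / 2) *\<^sub>R (v + w) + (1 / 2) *\<^sub>R (norm (v - w) *\<^sub>R sgn (v - w))"
    using assms by simp
  also have "\<dots> = (1 / 2) *\<^sub>R (v + w + (v - w))"
    by (simp only: norm_scaleR_sgn scaleR_add_right)
  also have "v + w + (v - w) = 2 *\<^sub>R v" by (simp add: scaleR_2)
  finally show ?thesis by simp
qed

lemma maxwellian_collision:
  assumes "norm \<sigma> = 1"
  shows "maxwellian (post_collisional v w \<sigma>) * maxwellian (v + w - post_collisional v w \<sigma>)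
    = maxwellian v * maxwellian w"
proof -
  have par: "(norm x)\<^sup>2 + (norm y)\<^sup>2 = ((norm (x + y))\<^sup>2 + (norm (x - y))\<^sup>2) / 2" for x y :: 'a
    by (simp add: power2_norm_eq_inner inner_add inner_diff inner_commute)
  have "(norm (post_collisional v w \<sigma>))\<^sup>2 + (norm (v + w - post_collisional v w \<sigma>))\<^sup>2 = (norm v)\<^sup>2 + (norm w)\<^sup>2"
    using par[of "post_collisional v w \<sigma>" "v + w - post_collisional v w \<sigma>"] par[of v w] assms
    unfolding post_collisional_relative by simp
  hence "exp (- (norm (post_collisional v w \<sigma>))\<^sup>2 / 2) * exp (- (norm (v + w - post_collisional v w \<sigma>))\<^sup>2 / 2)
      = exp (- (norm v)\<^sup>2 / 2) * exp (- (norm w)\<^sup>2 / 2)"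
    by (simp add: exp_add[symmetric] add_divide_distrib[symmetric])
  thus ?thesis by (simp add: maxwellian_def)
qed

text \<open>
  Up to a constant a minorant of the kernel, supported on the jumps with \<open>L \<le> |v' - v| \<le> 2 L\<close>; the exponent
  \<open>s + d - 1\<close> is the one for which the integral over \<open>\<sigma>\<close> has order \<open>|u| powr s\<close>. Depending only on \<open>|u|\<close> and
  \<open>|\<sigma> - sgn u|\<close>, it is invariant under the exchange of pre- and post-collisional velocities.
\<close>
definition grazing_weight :: "real \<Rightarrow> real \<Rightarrow> 'a::euclidean_space \<Rightarrow> 'a \<Rightarrow> ennreal" where
  "grazing_weight s L u \<sigma> = ennreal (norm u powr (s + real (DIM('a) - 1))) *
     (if L \<le> norm u / 2 * norm (\<sigma> - sgn u) \<and> norm u / 2 * norm (\<sigma> - sgn u) \<le> 2 * L then 1 else 0)"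

lemma borel_measurable_grazing_weight [measurable (raw)]:
  fixes p q :: "'b \<Rightarrow> 'a::euclidean_space"
  assumes [measurable]: "p \<in> borel_measurable M" "q \<in> borel_measurable M"
  shows "(\<lambda>z. grazing_weight s L (p z) (q z)) \<in> borel_measurable M"
  unfolding grazing_weight_def by measurable

lemma grazing_weight_swap:
  assumes "norm \<sigma> = 1"
  shows "grazing_weight s L (norm u *\<^sub>R \<sigma>) (sgn u) = grazing_weight s L u \<sigma>"
proof (cases "u = 0")
  case False
  hence "sgn (norm u *\<^sub>R \<sigma>) = \<sigma>" using assms by (simp add: sgn_scaleR sgn_div_norm)
  thus ?thesis using assms by (simp add: grazing_weight_def norm_minus_commute)
qed (simp add: grazing_weight_def)

text \<open>
  The upper and lower constants depend on the dimension only. In particular their ratio does not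
  grow with \<open>L\<close>, so that a gain from a large \<open>L\<close> survives it.
\<close>
lemma grazing_weight_bounds:
  assumes dim: "DIM('a::euclidean_space) \<ge> 2"
  shows "\<exists>c>0. \<exists>C>0. \<forall>s L (u :: 'a). 0 < L \<longrightarrow> 4 * L \<le> norm u \<longrightarrow>
    ennreal (c * (2 * L) ^ (DIM('a) - 1) * norm u powr s) \<le> (\<integral>\<^sup>+\<sigma>. grazing_weight s L u \<sigma> \<partial>sph) \<and>
    (\<integral>\<^sup>+\<sigma>. grazing_weight s L u \<sigma> \<partial>sph) \<le> ennreal (C * (2 * L) ^ (DIM('a) - 1) * norm u powr s)"
proof -
  define n where "n = DIM('a) - 1"
  obtain C where C: "C > 0" and C': "\<And>(e :: 'a) r. norm e = 1 \<Longrightarrow> 0 < r \<Longrightarrow> r \<le> 1 \<Longrightarrow>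
    emeasure sph {\<sigma>. norm (\<sigma> - e) \<le> r} \<le> ennreal (C * r ^ n)"
    using emeasure_cap_le[where 'a='a] unfolding n_def by blast
  obtain c where c: "c > 0" and c': "\<And>(e :: 'a) r. norm e = 1 \<Longrightarrow> 0 < r \<Longrightarrow> r \<le> 1 / 2 \<Longrightarrow>
    ennreal (c * r ^ n) \<le> emeasure sph {\<sigma>. r \<le> norm (\<sigma> - e) \<and> norm (\<sigma> - e) \<le> 2 * r}"
    using emeasure_annulus_ge[OF dim] unfolding n_def by blast
  have "ennreal (c * (2 * L) ^ n * norm u powr s) \<le> (\<integral>\<^sup>+\<sigma>. grazing_weight s L u \<sigma> \<partial>sph) \<and>
    (\<integral>\<^sup>+\<sigma>. grazing_weight s L u \<sigma> \<partial>sph) \<le> ennreal (C * 2 ^ n * (2 * L) ^ n * norm u powr s)"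
    if L: "0 < L" and u: "4 * L \<le> norm u" for s L and u :: 'a
  proof -
    define r where "r = 2 * L / norm u"
    define A where "A = {\<sigma>. r \<le> norm (\<sigma> - sgn u) \<and> norm (\<sigma> - sgn u) \<le> 2 * r}"
    have [measurable]: "A \<in> sets borel" unfolding A_def by measurable
    have n0: "norm u > 0" using L u by linarith
    have e: "norm (sgn u) = 1" using n0 by (simp add: norm_sgn)
    have r: "0 < r" "r \<le> 1 / 2" using L u n0 by (simp_all add: r_def field_simps)
    have rp: "norm u powr (s + real n) * r ^ n = (2 * L) ^ n * norm u powr s"
      using n0 by (simp add: r_def power_divide powr_add powr_realpow)
    have "(\<integral>\<^sup>+\<sigma>. grazing_weight s L u \<sigma> \<partial>sph)
        = (\<integral>\<^sup>+\<sigma>. ennreal (norm u powr (s + real n)) * indicator A \<sigma> \<partial>sph)"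
      using n0 by (intro nn_integral_cong)
        (auto simp: grazing_weight_def A_def r_def n_def field_simps split: split_indicator)
    also have "\<dots> = ennreal (norm u powr (s + real n)) * emeasure sph A"
      by (rule nn_integral_cmult_indicator) simp
    finally have eq: "(\<integral>\<^sup>+\<sigma>. grazing_weight s L u \<sigma> \<partial>sph) = ennreal (norm u powr (s + real n)) * emeasure sph A" .
    have "ennreal (c * (2 * L) ^ n * norm u powr s) = ennreal (norm u powr (s + real n)) * ennreal (c * r ^ n)"
      using c r rp by (simp add: ennreal_mult[symmetric] mult_ac)
    also have "\<dots> \<le> ennreal (norm u powr (s + real n)) * emeasure sph A"
      unfolding A_def by (rule mult_left_mono[OF c'[OF e r]]) simp
    finally have 1: "ennreal (c * (2 * L) ^ n * norm u powr s) \<le> (\<integral>\<^sup>+\<sigma>. grazing_weight s L u \<sigma> \<partial>sph)"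
      unfolding eq .
    have "emeasure sph A \<le> emeasure sph {\<sigma>. norm (\<sigma> - sgn u) \<le> 2 * r}"
      by (rule emeasure_mono) (auto simp: A_def)
    also have "\<dots> \<le> ennreal (C * (2 * r) ^ n)" using r by (intro C' e) auto
    finally have "ennreal (norm u powr (s + real n)) * emeasure sph A
        \<le> ennreal (norm u powr (s + real n)) * ennreal (C * (2 * r) ^ n)"
      by (rule mult_left_mono) simp
    also have "\<dots> = ennreal (C * 2 ^ n * (norm u powr (s + real n) * r ^ n))"
      using C r by (simp add: ennreal_mult[symmetric] mult_ac power_mult_distrib)
    finally have 2: "(\<integral>\<^sup>+\<sigma>. grazing_weight s L u \<sigma> \<partial>sph) \<le> ennreal (C * 2 ^ n * (2 * L) ^ n * norm u powr s)"
      unfolding eq rp by (simp add: mult_ac)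
    from 1 2 show ?thesis by blast
  qed
  moreover have "C * 2 ^ n > 0" using C by simp
  ultimately show ?thesis using c unfolding n_def by blast
qed

lemma grazing_weight_le_kernel:
  fixes u \<sigma> :: "'a::euclidean_space"
  assumes K: "k0 * norm u powr \<gamma> * norm (\<sigma> - sgn u) powr (- p) \<le> B"
    and k0: "k0 > 0" and p: "p = real (DIM('a) - 1) + \<nu>" "p \<ge> 0" and L: "L > 0"
    and ne: "u \<noteq> 0" "\<sigma> \<noteq> sgn u"
  shows "grazing_weight (\<gamma> + \<nu>) L u \<sigma> \<le> ennreal ((4 * L) powr p / k0 * B)"
proof (cases "norm u / 2 * norm (\<sigma> - sgn u) \<le> 2 * L")
  case True
  define n where "n = real (DIM('a) - 1)"
  have "norm (\<sigma> - sgn u) \<le> 4 * L / norm u" using True ne by (simp add: field_simps)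
  hence "(4 * L / norm u) powr (- p) \<le> norm (\<sigma> - sgn u) powr (- p)"
    using p ne by (intro powr_mono2') auto
  hence "k0 * norm u powr \<gamma> * (4 * L / norm u) powr (- p) \<le> B"
    using k0 by (intro order.trans[OF _ K] mult_left_mono) auto
  hence "(4 * L) powr p / k0 * (k0 * norm u powr \<gamma> * (4 * L / norm u) powr (- p)) \<le> (4 * L) powr p / k0 * B"
    using k0 by (intro mult_left_mono) auto
  also have "(4 * L) powr p / k0 * (k0 * norm u powr \<gamma> * (4 * L / norm u) powr (- p)) = norm u powr (\<gamma> + p)"
    using k0 L ne by (simp add: powr_divide powr_minus powr_add field_simps)
  also have "\<gamma> + p = \<gamma> + \<nu> + n" using p by (simp add: n_def)
  finally show ?thesis by (auto simp: grazing_weight_def n_def intro: ennreal_leI)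
qed (simp add: grazing_weight_def)

section \<open>Comparison of integrals with the Dirichlet form\<close>
definition energy :: "('a::euclidean_space \<Rightarrow> 'a \<Rightarrow> real) \<Rightarrow> ('a \<Rightarrow> real) \<Rightarrow> ennreal" where
  "energy B h = (\<integral>\<^sup>+(v, w, \<sigma>). ennreal (B (v - w) \<sigma> * maxwellian v * maxwellian w *
      (h v - h (post_collisional v w \<sigma>))\<^sup>2) \<partial>(lborel \<Otimes>\<^sub>M lborel \<Otimes>\<^sub>M sphere_measure))"

text \<open>
  The way in which the kernel enters all estimates. The integrand of the energy may fail to be measurable, and then a
  constant cannot be moved out of its integral; hence \<open>F\<close> is divided by \<open>C\<close> before the integrands are compared.
\<close>
lemma collision_integral_le_energy:
  fixes F :: "'a::euclidean_space \<Rightarrow> 'a \<Rightarrow> 'a \<Rightarrow> ennreal"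
  assumes F: "(\<lambda>(v, w, \<sigma>). F v w \<sigma>) \<in> borel_measurable borel" and C0: "0 < C"
    and le: "\<And>v w \<sigma>. norm \<sigma> = 1 \<Longrightarrow> F v w \<sigma> \<le> ennreal (C * (B (v - w) \<sigma> * maxwellian v * maxwellian w *
      (h v - h (post_collisional v w \<sigma>))\<^sup>2))"
  shows "collision_integral F \<le> ennreal C * energy B h"
proof -
  have F': "(\<lambda>(v, w, \<sigma>). ennreal (1 / C) * F v w \<sigma>) \<in> borel_measurable borel"
  proof -
    have "(\<lambda>x. ennreal (1 / C) * (case x of (v, w, \<sigma>) \<Rightarrow> F v w \<sigma>)) \<in> borel_measurable borel"
      by (rule borel_measurable_times_ennreal[OF borel_measurable_const F])
    thus ?thesis by (simp add: split_beta')
  qed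
  note [measurable] = borel_measurable_curried3[OF F]
  have "ennreal (1 / C) * collision_integral F = collision_integral (\<lambda>v w \<sigma>. ennreal (1 / C) * F v w \<sigma>)"
  proof -
    interpret sph: sigma_finite_measure "sph :: 'a measure" by (rule sigma_finite_sph)
    show ?thesis unfolding collision_integral_def
      by (simp add: nn_integral_cmult)
  qed
  also have "\<dots> \<le> energy B h"
    unfolding nn_integral_collision[OF F', symmetric] energy_def
  proof (intro nn_integral_mono)
    fix x :: "'a \<times> 'a \<times> 'a" assume "x \<in> space (lborel \<Otimes>\<^sub>M lborel \<Otimes>\<^sub>M sphere_measure)"
    then obtain v w \<sigma> where x: "x = (v, w, \<sigma>)" "norm \<sigma> = 1"
      by (auto simp: space_pair_measure space_sphere_measure)
    let ?E = "B (v - w) \<sigma> * maxwellian v * maxwellian w * (h v - h (post_collisional v w \<sigma>))\<^sup>2"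
    have "ennreal (1 / C) * F v w \<sigma> \<le> ennreal (1 / C) * ennreal (C * ?E)"
      by (rule mult_left_mono[OF le[OF x(2)]]) simp
    also have "\<dots> = ennreal (1 / C * (C * ?E))" using C0 by (subst ennreal_mult') auto
    also have "1 / C * (C * ?E) = ?E" using C0 by simp
    finally show "(case x of (v, w, \<sigma>) \<Rightarrow> ennreal (1 / C) * F v w \<sigma>) \<le>
      (case x of (v, w, \<sigma>) \<Rightarrow> ennreal (B (v - w) \<sigma> * maxwellian v * maxwellian w * (h v - h (post_collisional v w \<sigma>))\<^sup>2))"
      by (simp add: x)
  qed
  finally have "ennreal C * (ennreal (1 / C) * collision_integral F) \<le> ennreal C * energy B h"
    by (rule mult_left_mono) simp
  moreover have "ennreal C * (ennreal (1 / C) * collision_integral F) = collision_integral F"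
    using C0 by (simp add: mult.assoc[symmetric] ennreal_mult[symmetric])
  ultimately show ?thesis by simp
qed

lemma collision_integral_mono:
  assumes "\<And>v w \<sigma>. norm \<sigma> = 1 \<Longrightarrow> F v w \<sigma> \<le> G v w \<sigma>"
  shows "collision_integral F \<le> collision_integral G"
  unfolding collision_integral_def
  by (intro nn_integral_mono nn_integral_mono_AE eventually_mono[OF AE_sph_norm]) (rule assms)

lemma collision_integral_cong:
  assumes "\<And>v w \<sigma>. norm \<sigma> = 1 \<Longrightarrow> F v w \<sigma> = G v w \<sigma>"
  shows "collision_integral F = collision_integral G"
  by (intro antisym collision_integral_mono) (simp_all add: assms)

lemma collision_integral_add:
  fixes F G :: "'a::euclidean_space \<Rightarrow> 'a \<Rightarrow> 'a \<Rightarrow> ennreal"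
  assumes F: "(\<lambda>(v, w, \<sigma>). F v w \<sigma>) \<in> borel_measurable borel"
    and G: "(\<lambda>(v, w, \<sigma>). G v w \<sigma>) \<in> borel_measurable borel"
  shows "collision_integral (\<lambda>v w \<sigma>. F v w \<sigma> + G v w \<sigma>) = collision_integral F + collision_integral G"
proof -
  interpret sph: sigma_finite_measure "sph :: 'a measure" by (rule sigma_finite_sph)
  note [measurable] = borel_measurable_curried3[OF F] borel_measurable_curried3[OF G]
  show ?thesis unfolding collision_integral_def by (simp add: nn_integral_add)
qed

lemma collision_integral_cmult:
  fixes F :: "'a::euclidean_space \<Rightarrow> 'a \<Rightarrow> 'a \<Rightarrow> ennreal" and G :: "'a \<Rightarrow> ennreal"
  assumes F: "(\<lambda>(v, w, \<sigma>). F v w \<sigma>) \<in> borel_measurable borel"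
  shows "collision_integral (\<lambda>v w \<sigma>. G v * F v w \<sigma>) = (\<integral>\<^sup>+v. G v * (\<integral>\<^sup>+w. \<integral>\<^sup>+\<sigma>. F v w \<sigma> \<partial>sph \<partial>lborel) \<partial>lborel)"
proof -
  interpret sph: sigma_finite_measure "sph :: 'a measure" by (rule sigma_finite_sph)
  note [measurable] = borel_measurable_curried3[OF F]
  show ?thesis unfolding collision_integral_def by (simp add: nn_integral_cmult)
qed

section \<open>Rates of inward and outward jumps\<close>
text \<open>
  The inward jumps start at \<open>|v| \<ge> R\<close> and hit a slow partner. The outward jumps are their images under the exchange of
  pre- and post-collisional velocities: the same conditions are imposed on \<open>v'\<close> and \<open>w'\<close>.
\<close>
definition inward_rate :: "real \<Rightarrow> real \<Rightarrow> real \<Rightarrow> 'a::euclidean_space \<Rightarrow> ennreal" where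
  "inward_rate s L R v = (\<integral>\<^sup>+w. \<integral>\<^sup>+\<sigma>. ennreal (maxwellian w) *
     (grazing_weight s L (v - w) \<sigma> * (if R \<le> norm v \<and> norm w \<le> 1 then 1 else 0)) \<partial>sph \<partial>lborel)"

definition outward_rate :: "real \<Rightarrow> real \<Rightarrow> real \<Rightarrow> 'a::euclidean_space \<Rightarrow> ennreal" where
  "outward_rate s L R v = (\<integral>\<^sup>+w. \<integral>\<^sup>+\<sigma>. ennreal (maxwellian w) *
     (grazing_weight s L (v - w) \<sigma> * (if R \<le> norm (post_collisional v w \<sigma>) \<and>
        norm (v + w - post_collisional v w \<sigma>) \<le> 1 then 1 else 0)) \<partial>sph \<partial>lborel)"

lemma maxwellian_ball_pos:
  "\<exists>m>0. (\<integral>\<^sup>+w. ennreal (maxwellian w) * (if norm (w :: 'a::euclidean_space) \<le> 1 then 1 else 0) \<partial>lborel) = ennreal m"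
proof -
  let ?I = "\<integral>\<^sup>+w. ennreal (maxwellian w) * (if norm (w :: 'a) \<le> 1 then 1 else 0) \<partial>lborel"
  have "?I \<le> (\<integral>\<^sup>+w. ennreal (maxwellian (w :: 'a)) \<partial>lborel)"
    by (rule nn_integral_mono) auto
  hence le1: "?I \<le> 1" by (simp add: nn_integral_maxwellian)
  have "0 < ennreal ((2 * pi) powr (- real DIM('a) / 2) * exp (- 1 / 2)) * emeasure lborel (ball (0 :: 'a) 1)"
    by (simp add: emeasure_ball ennreal_zero_less_mult_iff)
  also have "\<dots> = (\<integral>\<^sup>+w. ennreal ((2 * pi) powr (- real DIM('a) / 2) * exp (- 1 / 2)) * indicator (ball (0 :: 'a) 1) w \<partial>lborel)"
    by (rule nn_integral_cmult_indicator[symmetric]) simp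
  also have "\<dots> \<le> ?I"
  proof (rule nn_integral_mono)
    fix w :: 'a
    show "ennreal ((2 * pi) powr (- real DIM('a) / 2) * exp (- 1 / 2)) * indicator (ball (0 :: 'a) 1) w
       \<le> ennreal (maxwellian w) * (if norm w \<le> 1 then 1 else 0)"
    proof (cases "norm w < 1")
      case True
      hence "(norm w)\<^sup>2 \<le> 1" by (simp add: power_le_one)
      thus ?thesis using True
        by (auto simp: maxwellian_def intro!: ennreal_leI mult_left_mono)
    qed (simp split: split_indicator)
  qed
  finally have "?I > 0" .
  with le1 show ?thesis
    by (cases ?I) (auto simp: ennreal_less_zero_iff top_unique)
qed

lemma maxwellian_tail_le:
  "\<exists>m\<ge>0. \<forall>r>0. (\<integral>\<^sup>+w. ennreal (maxwellian w) * (if r \<le> norm (w :: 'a::euclidean_space) then 1 else 0) \<partial>lborel) \<le> ennreal (m / r)"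
proof -
  obtain m where m: "m \<ge> 0" "(\<integral>\<^sup>+v. ennreal (\<langle>v\<rangle> powr 1 * maxwellian (v :: 'a)) \<partial>lborel) = ennreal m"
    using maxwellian_moment_finite[of 1, where 'a='a]
    by (cases "\<integral>\<^sup>+v. ennreal (\<langle>v\<rangle> powr 1 * maxwellian (v :: 'a)) \<partial>lborel") auto
  have "(\<integral>\<^sup>+w. ennreal (maxwellian w) * (if r \<le> norm (w :: 'a) then 1 else 0) \<partial>lborel) \<le> ennreal (m / r)"
    if r: "r > 0" for r
  proof -
    have "(\<integral>\<^sup>+w. ennreal (maxwellian w) * (if r \<le> norm (w :: 'a) then 1 else 0) \<partial>lborel)
       \<le> (\<integral>\<^sup>+w. ennreal (1 / r) * ennreal (\<langle>w\<rangle> powr 1 * maxwellian (w :: 'a)) \<partial>lborel)"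
    proof (rule nn_integral_mono)
      fix w :: 'a
      show "ennreal (maxwellian w) * (if r \<le> norm w then 1 else 0)
        \<le> ennreal (1 / r) * ennreal (\<langle>w\<rangle> powr 1 * maxwellian w)"
      proof (cases "r \<le> norm w")
        case True
        have "norm w = sqrt ((norm w)\<^sup>2)" by simp
        also have "\<dots> \<le> \<langle>w\<rangle>" unfolding japanese_bracket_def by (rule real_sqrt_le_mono) simp
        finally have "r \<le> \<langle>w\<rangle>" using True by simp
        hence "maxwellian w * 1 \<le> maxwellian w * (\<langle>w\<rangle> / r)"
          using r maxwellian_pos[of w] by (intro mult_left_mono) auto
        hence "maxwellian w \<le> 1 / r * (\<langle>w\<rangle> powr 1 * maxwellian w)"
          using japanese_bracket_ge_1[of w] by (simp add: mult.commute)
        thus ?thesis using True r by (subst ennreal_mult[symmetric])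
          (auto intro!: ennreal_leI mult_nonneg_nonneg less_imp_le[OF maxwellian_pos])
      qed simp
    qed
    also have "\<dots> = ennreal (1 / r) * ennreal m"
      by (subst nn_integral_cmult) (use m in auto)
    also have "\<dots> = ennreal (m / r)" using r m by (simp add: ennreal_mult[symmetric])
    finally show ?thesis .
  qed
  with m show ?thesis by blast
qed

text \<open>
  A jump of size at least \<open>L\<close> that leaves the partner with \<open>|w'| \<le> 1\<close> requires \<open>|w| \<ge> L - 1\<close>, so
  the outward rate gains a factor that is at most of order \<open>1 / (L - 1)\<close> from the tail of the Maxwellian, by Markov's inequality. It
  beats the fixed ratio of the other constants once \<open>L\<close> is large. The radius \<open>8 L + 2\<close> guarantees
  \<open>|u| \<ge> 4 L\<close> in all jumps of either kind, and that \<open>|u|\<close> is comparable to \<open>|v|\<close> in those with \<open>|v| \<ge> R\<close>.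
\<close>
lemma jump_rates:
  assumes dim: "DIM('a::euclidean_space) \<ge> 2"
  shows "\<exists>L\<ge>1. \<exists>c>0. \<exists>C>0. \<exists>R. R = 8 * L + 2 \<and>
    (\<forall>v::'a. R \<le> norm v \<longrightarrow> ennreal (c * norm v powr s) \<le> inward_rate s L R v \<and>
        inward_rate s L R v \<le> ennreal (C * norm v powr s) \<and>
        outward_rate s L R v \<le> ennreal (1 / 4) * inward_rate s L R v) \<and>
    (\<forall>v::'a. norm v < R \<longrightarrow> outward_rate s L R v \<le> ennreal C)"
proof -
  interpret sph: sigma_finite_measure "sph :: 'a measure" by (rule sigma_finite_sph)
  obtain c C where c: "c > 0" and C: "C > 0" and
    lo: "\<And>L (u::'a). 0 < L \<Longrightarrow> 4 * L \<le> norm u \<Longrightarrow>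
      ennreal (c * (2 * L) ^ (DIM('a) - 1) * norm u powr s) \<le> (\<integral>\<^sup>+\<sigma>. grazing_weight s L u \<sigma> \<partial>sph)" and
    hi: "\<And>L (u::'a). 0 < L \<Longrightarrow> 4 * L \<le> norm u \<Longrightarrow>
      (\<integral>\<^sup>+\<sigma>. grazing_weight s L u \<sigma> \<partial>sph) \<le> ennreal (C * (2 * L) ^ (DIM('a) - 1) * norm u powr s)"
    using grazing_weight_bounds[OF dim] by blast
  obtain m1 where m1: "m1 > 0"
    "(\<integral>\<^sup>+w. ennreal (maxwellian w) * (if norm (w :: 'a) \<le> 1 then 1 else 0) \<partial>lborel) = ennreal m1"
    using maxwellian_ball_pos by blast
  obtain m where m: "m \<ge> 0" "\<And>r. r > 0 \<Longrightarrow>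
     (\<integral>\<^sup>+w. ennreal (maxwellian w) * (if r \<le> norm (w :: 'a) then 1 else 0) \<partial>lborel) \<le> ennreal (m / r)"
    using maxwellian_tail_le by blast
  define T where "T = 2 powr \<bar>s\<bar>"
  have T: "T \<ge> 1" by (simp add: T_def ge_one_powr_ge_zero)
  \<comment> \<open>the choice for which the outward rate is at most a quarter of the inward rate, see \<open>Lm\<close>\<close>
  define L where "L = 2 + 4 * C * T * T * m / (c * m1)"
  have L: "L \<ge> 2" using c C T m m1 by (simp add: L_def)
  have Lm: "C * T * (m / (L - 1)) \<le> 1 / 4 * (c / T * m1)"
  proof -
    have "4 * C * T * T * m / (c * m1) \<le> L - 1" by (simp add: L_def)
    hence *: "4 * C * T * T * m \<le> (L - 1) * (c * m1)"
      using c m1 by (subst (asm) pos_divide_le_eq) auto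
    have "C * T * (m / (L - 1)) = (4 * C * T * T * m) / (4 * T * (L - 1))"
      using T L by (simp add: divide_simps)
    also have "\<dots> \<le> ((L - 1) * (c * m1)) / (4 * T * (L - 1))"
      using T L by (intro divide_right_mono *) auto
    also have "\<dots> = 1 / 4 * (c / T * m1)" using T L by simp
    finally show ?thesis .
  qed
  define R where "R = 8 * L + 2"
  define Q where "Q = (2 * L) ^ (DIM('a) - 1)"
  have Q: "Q > 0" using L by (simp add: Q_def)
  define J where "J u = (\<integral>\<^sup>+\<sigma>. grazing_weight s L u \<sigma> \<partial>sph)" for u :: 'a
  have [measurable]: "J \<in> borel_measurable borel" unfolding J_def by measurable
  \<comment> \<open>Partners in question satisfy \<open>|w| \<le> 2 L + 1 \<le> |v| / 2\<close>, so powers of \<open>|u|\<close> may be replaced by powers of \<open>|v|\<close>.\<close>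
  have near: "ennreal (c * Q / T * norm v powr s) \<le> J (v - w) \<and> J (v - w) \<le> ennreal (C * Q * T * norm v powr s)"
    if v: "R \<le> norm v" and w: "norm w \<le> 2 * L + 1" for v w :: 'a
  proof -
    have n: "norm v - norm w \<le> norm (v - w)" "norm (v - w) \<le> norm v + norm w"
      by (rule norm_triangle_ineq2, rule norm_triangle_ineq4)
    have v0: "norm v > 0" and h1: "norm v / 2 \<le> norm (v - w)" "norm (v - w) \<le> 2 * norm v"
      and L4: "4 * L \<le> norm (v - w)"
      using n v w L by (auto simp: R_def)
    have a: "norm (v - w) powr s \<le> T * norm v powr s"
      unfolding T_def using v0 h1 by (intro powr_comparable) auto
    have b: "norm v powr s \<le> T * norm (v - w) powr s"
      unfolding T_def using v0 h1 by (intro powr_comparable) auto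
    have "c * Q / T * norm v powr s \<le> c * Q / T * (T * norm (v - w) powr s)"
      using c Q T b by (intro mult_left_mono) auto
    also have "\<dots> = c * Q * norm (v - w) powr s" using T by simp
    finally have "ennreal (c * Q / T * norm v powr s) \<le> ennreal (c * Q * norm (v - w) powr s)"
      by (rule ennreal_leI)
    also have "\<dots> \<le> J (v - w)"
      unfolding J_def Q_def by (rule lo) (use L L4 in auto)
    finally have 1: "ennreal (c * Q / T * norm v powr s) \<le> J (v - w)" .
    have "C * Q * norm (v - w) powr s \<le> C * Q * (T * norm v powr s)"
      using C Q a by (intro mult_left_mono) auto
    hence le: "ennreal (C * Q * norm (v - w) powr s) \<le> ennreal (C * Q * T * norm v powr s)"
      by (intro ennreal_leI) (simp add: mult.assoc)
    have "J (v - w) \<le> ennreal (C * Q * norm (v - w) powr s)"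
      unfolding J_def Q_def by (rule hi) (use L L4 in auto)
    hence 2: "J (v - w) \<le> ennreal (C * Q * T * norm v powr s)" using le by (rule order.trans)
    from 1 2 show ?thesis ..
  qed
  have M1: "(\<integral>\<^sup>+w. ennreal (maxwellian (w::'a)) * (if P w then 1 else 0) \<partial>lborel) \<le> 1" for P
  proof -
    have "(\<integral>\<^sup>+w. ennreal (maxwellian (w::'a)) * (if P w then 1 else 0) \<partial>lborel) \<le> (\<integral>\<^sup>+w. ennreal (maxwellian (w :: 'a)) \<partial>lborel)"
      by (rule nn_integral_mono) auto
    thus ?thesis by (simp add: nn_integral_maxwellian)
  qed
  have inw: "inward_rate s L R v = (\<integral>\<^sup>+w. ennreal (maxwellian w) * (if norm w \<le> 1 then 1 else 0) * J (v - w) \<partial>lborel)"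
    if v: "R \<le> norm v" for v :: 'a
    unfolding inward_rate_def J_def
    by (rule nn_integral_cong) (simp add: v nn_integral_cmult)
  \<comment> \<open>\<open>P\<close> is any consequence for \<open>w\<close> of an outward jump from \<open>v\<close>; once it is recorded, \<open>\<sigma>\<close> is integrated freely.\<close>
  have outw: "outward_rate s L R v \<le> (\<integral>\<^sup>+w. ennreal (maxwellian w) * (if P w then 1 else 0) * J (v - w) \<partial>lborel)"
    if P: "\<And>w \<sigma>. norm \<sigma> = 1 \<Longrightarrow> R \<le> norm (post_collisional v w \<sigma>) \<Longrightarrow>
      norm (v + w - post_collisional v w \<sigma>) \<le> 1 \<Longrightarrow> L \<le> norm (post_collisional v w \<sigma> - v) \<Longrightarrow>
      norm (post_collisional v w \<sigma> - v) \<le> 2 * L \<Longrightarrow> P w" for v :: 'a and P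
    unfolding outward_rate_def
  proof (rule nn_integral_mono)
    fix w :: 'a
    have "(\<integral>\<^sup>+\<sigma>. ennreal (maxwellian w) *
     (grazing_weight s L (v - w) \<sigma> * (if R \<le> norm (post_collisional v w \<sigma>) \<and>
        norm (v + w - post_collisional v w \<sigma>) \<le> 1 then 1 else 0)) \<partial>sph)
      \<le> (\<integral>\<^sup>+\<sigma>. (ennreal (maxwellian w) * (if P w then 1 else 0)) * grazing_weight s L (v - w) \<sigma> \<partial>sph)"
    proof (rule nn_integral_mono_AE, rule eventually_mono[OF AE_sph_norm])
      fix \<sigma> :: 'a assume s1: "norm \<sigma> = 1"
      show "ennreal (maxwellian w) *
         (grazing_weight s L (v - w) \<sigma> * (if R \<le> norm (post_collisional v w \<sigma>) \<and>
         norm (v + w - post_collisional v w \<sigma>) \<le> 1 then 1 else 0))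
         \<le> (ennreal (maxwellian w) * (if P w then 1 else 0)) * grazing_weight s L (v - w) \<sigma>"
      proof (cases "P w")
        case False
        hence "R \<le> norm (post_collisional v w \<sigma>) \<and> norm (v + w - post_collisional v w \<sigma>) \<le> 1 \<Longrightarrow>
            grazing_weight s L (v - w) \<sigma> = 0"
          using P[OF s1, of w] unfolding norm_post_collisional_diff by (auto simp: grazing_weight_def)
        thus ?thesis by (cases "R \<le> norm (post_collisional v w \<sigma>) \<and> norm (v + w - post_collisional v w \<sigma>) \<le> 1") auto
      qed auto
    qed
    also have "\<dots> = ennreal (maxwellian w) * (if P w then 1 else 0) * J (v - w)"
      unfolding J_def by (rule nn_integral_cmult) measurable
    finally show "(\<integral>\<^sup>+\<sigma>. ennreal (maxwellian w) *
     (grazing_weight s L (v - w) \<sigma> * (if R \<le> norm (post_collisional v w \<sigma>) \<and>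
        norm (v + w - post_collisional v w \<sigma>) \<le> 1 then 1 else 0)) \<partial>sph)
      \<le> ennreal (maxwellian w) * (if P w then 1 else 0) * J (v - w)" .
  qed
  have wdiff: "norm (w - (v + w - v')) = norm (v' - v)" for v w v' :: 'a
    by simp
  have far: "ennreal (c * Q / T * m1 * norm v powr s) \<le> inward_rate s L R v \<and>
        inward_rate s L R v \<le> ennreal (C * Q * T * norm v powr s) \<and>
        outward_rate s L R v \<le> ennreal (1 / 4) * inward_rate s L R v" if v: "R \<le> norm v" for v :: 'a
  proof -
    have "ennreal (c * Q / T * m1 * norm v powr s) = ennreal (c * Q / T * norm v powr s) *
        (\<integral>\<^sup>+w. ennreal (maxwellian w) * (if norm (w :: 'a) \<le> 1 then 1 else 0) \<partial>lborel)"
      unfolding m1(2) using c Q T m1 by (subst ennreal_mult[symmetric]) (auto simp: mult_ac)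
    also have "\<dots> = (\<integral>\<^sup>+w. ennreal (c * Q / T * norm v powr s) * (ennreal (maxwellian w) * (if norm (w :: 'a) \<le> 1 then 1 else 0)) \<partial>lborel)"
      by (rule nn_integral_cmult[symmetric]) measurable
    also have "\<dots> \<le> inward_rate s L R v"
      unfolding inw[OF v]
    proof (rule nn_integral_mono)
      fix w :: 'a
      show "ennreal (c * Q / T * norm v powr s) * (ennreal (maxwellian w) * (if norm w \<le> 1 then 1 else 0))
         \<le> ennreal (maxwellian w) * (if norm w \<le> 1 then 1 else 0) * J (v - w)"
        using near[OF v, of w] L by (auto simp: mult.commute intro!: mult_left_mono)
    qed
    finally have 1: "ennreal (c * Q / T * m1 * norm v powr s) \<le> inward_rate s L R v" .
    have "inward_rate s L R v \<le> (\<integral>\<^sup>+w. ennreal (C * Q * T * norm v powr s) * (ennreal (maxwellian w) * (if norm (w :: 'a) \<le> 1 then 1 else 0)) \<partial>lborel)"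
      unfolding inw[OF v]
    proof (rule nn_integral_mono)
      fix w :: 'a
      show "ennreal (maxwellian w) * (if norm w \<le> 1 then 1 else 0) * J (v - w) \<le>
        ennreal (C * Q * T * norm v powr s) * (ennreal (maxwellian w) * (if norm w \<le> 1 then 1 else 0))"
        using near[OF v, of w] L by (auto simp: mult.commute intro!: mult_left_mono)
    qed
    also have "\<dots> = ennreal (C * Q * T * norm v powr s) * (\<integral>\<^sup>+w. (ennreal (maxwellian w) * (if norm (w :: 'a) \<le> 1 then 1 else 0)) \<partial>lborel)"
      by (rule nn_integral_cmult) measurable
    also have "\<dots> \<le> ennreal (C * Q * T * norm v powr s) * 1"
      by (rule mult_left_mono[OF M1]) simp
    finally have 2: "inward_rate s L R v \<le> ennreal (C * Q * T * norm v powr s)" by simp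
    have "outward_rate s L R v \<le> (\<integral>\<^sup>+w. ennreal (maxwellian w) * (if L - 1 \<le> norm w \<and> norm w \<le> 2 * L + 1 then 1 else 0) * J (v - w) \<partial>lborel)"
    proof (rule outw)
      fix w \<sigma> :: 'a
      let ?v = "post_collisional v w \<sigma>"
      assume "norm (v + w - ?v) \<le> 1" "L \<le> norm (?v - v)" "norm (?v - v) \<le> 2 * L"
      moreover have "norm (?v - v) \<le> norm w + norm (v + w - ?v)"
        using norm_triangle_ineq4[of w "v + w - ?v"] wdiff[of w v ?v] by simp
      moreover have "norm w \<le> norm (?v - v) + norm (v + w - ?v)"
        using norm_triangle_ineq[of "?v - v" "v + w - ?v"] by simp
      ultimately show "L - 1 \<le> norm w \<and> norm w \<le> 2 * L + 1" by linarith
    qed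
    also have "\<dots> \<le> (\<integral>\<^sup>+w. ennreal (C * Q * T * norm v powr s) * (ennreal (maxwellian w) * (if L - 1 \<le> norm (w :: 'a) then 1 else 0)) \<partial>lborel)"
    proof (rule nn_integral_mono)
      fix w :: 'a
      show "ennreal (maxwellian w) * (if L - 1 \<le> norm w \<and> norm w \<le> 2 * L + 1 then 1 else 0) * J (v - w) \<le>
        ennreal (C * Q * T * norm v powr s) * (ennreal (maxwellian w) * (if L - 1 \<le> norm w then 1 else 0))"
        using near[OF v, of w] by (auto simp: mult.commute intro!: mult_left_mono)
    qed
    also have "\<dots> = ennreal (C * Q * T * norm v powr s) * (\<integral>\<^sup>+w. (ennreal (maxwellian w) * (if L - 1 \<le> norm (w :: 'a) then 1 else 0)) \<partial>lborel)"
      by (rule nn_integral_cmult) measurable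
    also have "\<dots> \<le> ennreal (C * Q * T * norm v powr s) * ennreal (m / (L - 1))"
      by (rule mult_left_mono[OF m(2)]) (use L in auto)
    also have "\<dots> = ennreal (Q * norm v powr s * (C * T * (m / (L - 1))))"
      using C Q T m L by (subst ennreal_mult[symmetric]) (auto simp: mult_ac)
    also have "\<dots> \<le> ennreal (Q * norm v powr s * (1 / 4 * (c / T * m1)))"
      using Q by (intro ennreal_leI mult_left_mono Lm) auto
    also have "\<dots> = ennreal (1 / 4) * ennreal (c * Q / T * m1 * norm v powr s)"
      using c Q T m1 by (subst ennreal_mult[symmetric]) (auto simp: mult_ac)
    also have "\<dots> \<le> ennreal (1 / 4) * inward_rate s L R v"
      by (rule mult_left_mono[OF 1]) simp
    finally show ?thesis using 1 2 by blast
  qed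
  define H where "H = C * Q * (10 * L + 3) powr \<bar>s\<bar>"
  have H: "H > 0" using C Q L by (simp add: H_def)
  have close: "outward_rate s L R v \<le> ennreal H" if v: "norm v < R" for v :: 'a
  proof -
    have "outward_rate s L R v \<le> (\<integral>\<^sup>+w. ennreal (maxwellian w) * (if 4 * L \<le> norm (v - w) \<and> norm (v - w) \<le> 10 * L + 3 then 1 else 0) * J (v - w) \<partial>lborel)"
    proof (rule outw)
      fix w \<sigma> :: 'a
      let ?v = "post_collisional v w \<sigma>"
      assume a: "norm \<sigma> = 1" "R \<le> norm ?v" "norm (v + w - ?v) \<le> 1" "norm (?v - v) \<le> 2 * L"
      have "norm w \<le> norm (?v - v) + norm (v + w - ?v)"
        using norm_triangle_ineq[of "?v - v" "v + w - ?v"] by simp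
      moreover have "norm (v - w) \<le> norm v + norm w" by (rule norm_triangle_ineq4)
      moreover have "norm (v - w) = norm (?v - (v + w - ?v))"
        unfolding post_collisional_relative using a by simp
      moreover have "norm ?v - norm (v + w - ?v) \<le> norm (?v - (v + w - ?v))"
        by (rule norm_triangle_ineq2)
      ultimately show "4 * L \<le> norm (v - w) \<and> norm (v - w) \<le> 10 * L + 3"
        using a v L unfolding R_def by linarith
    qed
    also have "\<dots> \<le> (\<integral>\<^sup>+w. ennreal H * (ennreal (maxwellian (w :: 'a)) * (if True then 1 else 0)) \<partial>lborel)"
    proof (rule nn_integral_mono)
      fix w :: 'a
      show "ennreal (maxwellian w) * (if 4 * L \<le> norm (v - w) \<and> norm (v - w) \<le> 10 * L + 3 then 1 else 0) * J (v - w)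
        \<le> ennreal H * (ennreal (maxwellian w) * (if True then 1 else 0))"
      proof (cases "4 * L \<le> norm (v - w) \<and> norm (v - w) \<le> 10 * L + 3")
        case True
        have "norm (v - w) powr s \<le> norm (v - w) powr \<bar>s\<bar>"
          using True L by (intro powr_mono) auto
        also have "\<dots> \<le> (10 * L + 3) powr \<bar>s\<bar>" using True by (intro powr_mono2) auto
        finally have "C * Q * norm (v - w) powr s \<le> H" unfolding H_def using C Q by (intro mult_left_mono) auto
        hence le: "ennreal (C * Q * norm (v - w) powr s) \<le> ennreal H" by (rule ennreal_leI)
        have "J (v - w) \<le> ennreal (C * Q * norm (v - w) powr s)"
          unfolding J_def Q_def by (rule hi) (use L True in auto)
        hence "J (v - w) \<le> ennreal H" using le by (rule order.trans)
        hence "ennreal (maxwellian w) * J (v - w) \<le> ennreal (maxwellian w) * ennreal H"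
          by (rule mult_left_mono) simp
        thus ?thesis using True by (simp add: mult.commute[of "ennreal H"])
      qed auto
    qed
    also have "\<dots> = ennreal H * (\<integral>\<^sup>+w. ennreal (maxwellian (w :: 'a)) * (if True then 1 else 0) \<partial>lborel)"
      by (rule nn_integral_cmult) measurable
    also have "\<dots> \<le> ennreal H * 1"
      by (rule mult_left_mono[OF M1]) simp
    finally show ?thesis by simp
  qed
  define D where "D = max H (C * Q * T)"
  have D: "D > 0" "H \<le> D" "C * Q * T \<le> D" using H by (auto simp: D_def)
  have cc: "c * Q / T * m1 > 0" using c Q T m1 by simp
  have far': "inward_rate s L R v \<le> ennreal (D * norm v powr s)" if "R \<le> norm v" for v :: 'a
  proof -
    have "ennreal (C * Q * T * norm v powr s) \<le> ennreal (D * norm v powr s)"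
      using D by (intro ennreal_leI mult_right_mono) auto
    with far[OF that] show ?thesis by (meson order.trans)
  qed
  have close': "outward_rate s L R v \<le> ennreal D" if "norm v < R" for v :: 'a
    using close[OF that] ennreal_leI[OF D(2)] by (rule order.trans)
  show ?thesis
    by (intro exI[of _ L] conjI exI[of _ "c * Q / T * m1"] exI[of _ D] exI[of _ R])
      (use far far' close' L D cc in \<open>auto simp: R_def\<close>)
qed

section \<open>Control of the tail\<close>
lemma ennreal_absorb_half:
  fixes X Y :: ennreal
  assumes "X \<le> ennreal (1 / 2) * X + Y" and "X < \<infinity>"
  shows "X \<le> 2 * Y"
proof (cases Y)
  case (real y)
  obtain x where x: "X = ennreal x" "x \<ge> 0" using assms(2) by (cases X) auto
  have "ennreal x \<le> ennreal (1 / 2 * x + y)"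
  proof -
    have "ennreal (1 / 2 * x + y) = ennreal (1 / 2 * x) + ennreal y"
      by (rule ennreal_plus) (use x real in auto)
    also have "ennreal (1 / 2 * x) = ennreal (1 / 2) * ennreal x"
      by (rule ennreal_mult) (use x in auto)
    finally show ?thesis using assms(1) x real by (simp only:)
  qed
  hence "x \<le> 2 * y" using x real by (subst (asm) ennreal_le_iff) auto
  hence "ennreal x \<le> ennreal (2 * y)" by (rule ennreal_leI)
  thus ?thesis using x real by (simp add: ennreal_mult)
qed (simp add: ennreal_mult_eq_top_iff)

lemma japanese_bracket_powr_le:
  fixes v :: "'a::euclidean_space"
  assumes "1 \<le> norm v"
  shows "\<langle>v\<rangle> powr s \<le> 2 powr \<bar>s\<bar> * norm v powr s" "norm v powr s \<le> 2 powr \<bar>s\<bar> * \<langle>v\<rangle> powr s"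
proof -
  have "norm v = sqrt ((norm v)\<^sup>2)" by simp
  also have "\<dots> \<le> \<langle>v\<rangle>" unfolding japanese_bracket_def by (rule real_sqrt_le_mono) simp
  finally have 1: "norm v \<le> \<langle>v\<rangle>" .
  have "1 \<le> (norm v)\<^sup>2" using assms by simp
  hence "\<langle>v\<rangle> \<le> sqrt ((2 * norm v)\<^sup>2)"
    unfolding japanese_bracket_def by (intro real_sqrt_le_mono) (simp add: power_mult_distrib)
  hence 2: "\<langle>v\<rangle> \<le> 2 * norm v" by (simp only: real_sqrt_abs) simp
  show "\<langle>v\<rangle> powr s \<le> 2 powr \<bar>s\<bar> * norm v powr s" "norm v powr s \<le> 2 powr \<bar>s\<bar> * \<langle>v\<rangle> powr s"
    using assms 1 2 by (auto intro!: powr_comparable)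
qed

lemma inward_rate_measurable [measurable]:
  "inward_rate s L R \<in> borel_measurable (borel :: 'a::euclidean_space measure)"
proof -
  interpret sph: sigma_finite_measure "sph :: 'a measure" by (rule sigma_finite_sph)
  show ?thesis unfolding inward_rate_def[abs_def] by measurable
qed

lemma inward_rate_zero: "norm v < R \<Longrightarrow> inward_rate s L R v = 0"
  by (simp add: inward_rate_def)

text \<open>
  The inequality \<open>h(v)\<^sup>2 \<le> 2 h(v')\<^sup>2 + 2 (h(v) - h(v'))\<^sup>2\<close> integrated over all inward jumps. The exchange of pre- and
  post-collisional velocities turns the first term into an integral against the
  outward rate, because \<open>M(v) M(w) = M(v') M(w')\<close>; the second is dominated by the energy.
\<close>
lemma inward_outward_comparison:
  fixes h :: "'a::euclidean_space \<Rightarrow> real"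
  assumes [measurable]: "h \<in> borel_measurable borel"
    and A: "0 < A" "\<And>(u::'a) \<sigma>. norm \<sigma> = 1 \<Longrightarrow> u \<noteq> 0 \<Longrightarrow> \<sigma> \<noteq> sgn u \<Longrightarrow> grazing_weight s L u \<sigma> \<le> ennreal (A * B u \<sigma>)"
    and L: "L > 0"
  shows "(\<integral>\<^sup>+v. ennreal ((h v)\<^sup>2 * maxwellian v) * inward_rate s L R v \<partial>lborel)
    \<le> 2 * (\<integral>\<^sup>+v. ennreal ((h v)\<^sup>2 * maxwellian v) * outward_rate s L R v \<partial>lborel) + 2 * (ennreal A * energy B h)"
proof -
  let ?v = "\<lambda>v w \<sigma>. post_collisional v w \<sigma> :: 'a"
  let ?w = "\<lambda>v w \<sigma>. v + w - post_collisional v w \<sigma> :: 'a"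
  define I where "I v w = (if R \<le> norm (v :: 'a) \<and> norm (w :: 'a) \<le> 1 then 1 else 0 :: ennreal)" for v w
  have [measurable]: "(\<lambda>z. I (p z) (q z)) \<in> borel_measurable M"
    if [measurable]: "p \<in> borel_measurable M" "q \<in> borel_measurable M" for p q and M :: "('a \<times> 'a \<times> 'a) measure"
    unfolding I_def by measurable
  define F1 where "F1 v w \<sigma> = ennreal ((h (?v v w \<sigma>))\<^sup>2) * (ennreal (maxwellian v * maxwellian w) *
      (grazing_weight s L (v - w) \<sigma> * I v w))" for v w \<sigma> :: 'a
  define F2 where "F2 v w \<sigma> = ennreal ((h v - h (?v v w \<sigma>))\<^sup>2) * (ennreal (maxwellian v * maxwellian w) *
      (grazing_weight s L (v - w) \<sigma> * I v w))" for v w \<sigma> :: 'a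
  have F1: "(\<lambda>(v, w, \<sigma>). F1 v w \<sigma>) \<in> borel_measurable borel"
    unfolding F1_def borel_prod[symmetric] by measurable
  have F2: "(\<lambda>(v, w, \<sigma>). F2 v w \<sigma>) \<in> borel_measurable borel"
    unfolding F2_def borel_prod[symmetric] by measurable
  have G0: "(\<lambda>(v, w, \<sigma>). ennreal (maxwellian w) * (grazing_weight s L (v - w) \<sigma> * I v w)) \<in> borel_measurable borel"
    unfolding borel_prod[symmetric] by measurable
  have G1: "(\<lambda>(v, w, \<sigma>). ennreal (maxwellian w) * (grazing_weight s L (v - w) \<sigma> * I (?v v w \<sigma>) (?w v w \<sigma>))) \<in> borel_measurable borel"
    unfolding borel_prod[symmetric] by measurable
  have cmult2: "collision_integral (\<lambda>v w \<sigma>. 2 * F v w \<sigma>) = 2 * collision_integral F"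
    if F: "(\<lambda>(v, w, \<sigma>). F v w \<sigma>) \<in> borel_measurable borel" for F :: "'a \<Rightarrow> 'a \<Rightarrow> 'a \<Rightarrow> ennreal"
  proof -
    interpret sph: sigma_finite_measure "sph :: 'a measure" by (rule sigma_finite_sph)
    note [measurable] = borel_measurable_curried3[OF F]
    show ?thesis unfolding collision_integral_cmult[OF F] 
      by (simp add: nn_integral_cmult collision_integral_def)
  qed
  have F12: "(\<lambda>(v, w, \<sigma>). 2 * F1 v w \<sigma>) \<in> borel_measurable borel" "(\<lambda>(v, w, \<sigma>). 2 * F2 v w \<sigma>) \<in> borel_measurable borel"
    unfolding F1_def F2_def borel_prod[symmetric] by measurable
  have "(\<integral>\<^sup>+v. ennreal ((h v)\<^sup>2 * maxwellian v) * inward_rate s L R v \<partial>lborel)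
    = collision_integral (\<lambda>v w \<sigma>. ennreal ((h v)\<^sup>2 * maxwellian v) * (ennreal (maxwellian w) * (grazing_weight s L (v - w) \<sigma> * I v w)))"
    unfolding collision_integral_cmult[OF G0] unfolding inward_rate_def I_def ..
  also have "\<dots> \<le> collision_integral (\<lambda>v w \<sigma>. 2 * F1 v w \<sigma> + 2 * F2 v w \<sigma>)"
  proof (rule collision_integral_mono)
    fix v w \<sigma> :: 'a
    define a b where "a = h v" and "b = h (?v v w \<sigma>)"
    have "a\<^sup>2 \<le> 2 * b\<^sup>2 + 2 * (a - b)\<^sup>2"
      using zero_le_power2[of "a - 2 * b"] by (simp add: power2_eq_square algebra_simps)
    hence "a\<^sup>2 * maxwellian v \<le> (2 * b\<^sup>2 + 2 * (a - b)\<^sup>2) * maxwellian v"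
      by (intro mult_right_mono less_imp_le[OF maxwellian_pos])
    hence "ennreal (a\<^sup>2 * maxwellian v) \<le> ennreal ((2 * b\<^sup>2 + 2 * (a - b)\<^sup>2) * maxwellian v)"
      by (rule ennreal_leI)
    also have "\<dots> = (2 * ennreal (b\<^sup>2) + 2 * ennreal ((a - b)\<^sup>2)) * ennreal (maxwellian v)"
      using maxwellian_pos[of v] by (simp add: ennreal_mult)
    finally have "ennreal (a\<^sup>2 * maxwellian v) * (ennreal (maxwellian w) * (grazing_weight s L (v - w) \<sigma> * I v w))
      \<le> (2 * ennreal (b\<^sup>2) + 2 * ennreal ((a - b)\<^sup>2)) * ennreal (maxwellian v) * (ennreal (maxwellian w) * (grazing_weight s L (v - w) \<sigma> * I v w))"
      by (rule mult_right_mono) simp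
    also have "\<dots> = 2 * F1 v w \<sigma> + 2 * F2 v w \<sigma>"
      using maxwellian_pos[of v] maxwellian_pos[of w]
      by (simp add: F1_def F2_def a_def b_def ennreal_mult distrib_right mult.assoc)
    finally show "ennreal ((h v)\<^sup>2 * maxwellian v) * (ennreal (maxwellian w) * (grazing_weight s L (v - w) \<sigma> * I v w))
      \<le> 2 * F1 v w \<sigma> + 2 * F2 v w \<sigma>" by (simp only: a_def)
  qed
  also have "\<dots> = 2 * collision_integral F1 + 2 * collision_integral F2"
    by (simp only: collision_integral_add[OF F12] cmult2[OF F1] cmult2[OF F2])
  also have "collision_integral F1 = (\<integral>\<^sup>+v. ennreal ((h v)\<^sup>2 * maxwellian v) * outward_rate s L R v \<partial>lborel)"
  proof -
    have "collision_integral F1 = collision_integral (\<lambda>v w \<sigma>. F1 (?v v w \<sigma>) (?w v w \<sigma>) (sgn (v - w)))"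
      by (rule collision_integral_swap[OF F1])
    also have "\<dots> = collision_integral (\<lambda>v w \<sigma>. ennreal ((h v)\<^sup>2 * maxwellian v) *
        (ennreal (maxwellian w) * (grazing_weight s L (v - w) \<sigma> * I (?v v w \<sigma>) (?w v w \<sigma>))))"
    proof (rule collision_integral_cong)
      fix v w \<sigma> :: 'a assume s1: "norm \<sigma> = 1"
      show "F1 (?v v w \<sigma>) (?w v w \<sigma>) (sgn (v - w)) = ennreal ((h v)\<^sup>2 * maxwellian v) *
        (ennreal (maxwellian w) * (grazing_weight s L (v - w) \<sigma> * I (?v v w \<sigma>) (?w v w \<sigma>)))"
        unfolding F1_def post_collisional_involutive[OF s1] maxwellian_collision[OF s1]
          post_collisional_relative grazing_weight_swap[OF s1]
        using maxwellian_pos[of v] maxwellian_pos[of w]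
        by (simp add: ennreal_mult mult.assoc)
    qed
    also have "\<dots> = (\<integral>\<^sup>+v. ennreal ((h v)\<^sup>2 * maxwellian v) * outward_rate s L R v \<partial>lborel)"
      unfolding collision_integral_cmult[OF G1] unfolding outward_rate_def I_def ..
    finally show ?thesis .
  qed
  also have "collision_integral F2 \<le> ennreal A * energy B h"
  proof (rule collision_integral_le_energy[OF F2 A(1)])
    fix v w \<sigma> :: 'a assume s1: "norm \<sigma> = 1"
    let ?E = "(h v - h (?v v w \<sigma>))\<^sup>2"
    show "F2 v w \<sigma> \<le> ennreal (A * (B (v - w) \<sigma> * maxwellian v * maxwellian w * ?E))"
    proof (cases "v - w = 0 \<or> \<sigma> = sgn (v - w)")
      case True
      hence "grazing_weight s L (v - w) \<sigma> = 0" using L by (auto simp: grazing_weight_def)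
      thus ?thesis by (simp add: F2_def)
    next
      case False
      have "F2 v w \<sigma> \<le> ennreal ?E * (ennreal (maxwellian v * maxwellian w) * (ennreal (A * B (v - w) \<sigma>) * 1))"
        unfolding F2_def using False s1 by (intro mult_mono A(2)) (auto simp: I_def)
      also have "\<dots> = ennreal (A * (B (v - w) \<sigma> * maxwellian v * maxwellian w * ?E))"
      proof -
        have "ennreal ?E * (ennreal (maxwellian v * maxwellian w) * (ennreal (A * B (v - w) \<sigma>) * 1))
          = ennreal (?E * (maxwellian v * maxwellian w)) * ennreal (A * B (v - w) \<sigma>)"
          using maxwellian_pos[of v] maxwellian_pos[of w] by (simp add: ennreal_mult mult.assoc)
        also have "\<dots> = ennreal (?E * (maxwellian v * maxwellian w) * (A * B (v - w) \<sigma>))"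
          using maxwellian_pos[of v] maxwellian_pos[of w] by (intro ennreal_mult'[symmetric]) simp
        finally show ?thesis by (simp only: mult_ac)
      qed
      finally show ?thesis .
    qed
  qed
  finally show ?thesis by (simp add: mult_left_mono add_left_mono)
qed

lemma energy_diff_const: "energy B (\<lambda>v. h v - a) = energy B h"
  by (simp add: energy_def)

text \<open>
  Truncations do not increase the energy, which allows absorbing terms that are only
  known to be finite for bounded functions.
\<close>
lemma energy_contraction:
  assumes "\<And>x y. \<bar>\<phi> x - \<phi> y\<bar> \<le> \<bar>x - y\<bar>"
  shows "energy B (\<lambda>v. \<phi> (h v)) \<le> energy B h"
  unfolding energy_def
proof (intro nn_integral_mono, clarify)
  fix v w \<sigma> :: 'a
  let ?k = "B (v - w) \<sigma> * maxwellian v * maxwellian w"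
  let ?a = "(\<phi> (h v) - \<phi> (h (post_collisional v w \<sigma>)))\<^sup>2" and ?b = "(h v - h (post_collisional v w \<sigma>))\<^sup>2"
  have "?a \<le> ?b" using assms by (simp add: abs_le_square_iff[symmetric])
  show "ennreal (?k * ?a) \<le> ennreal (?k * ?b)"
  proof (cases "?k \<ge> 0")
    case True
    with \<open>?a \<le> ?b\<close> show ?thesis by (intro ennreal_leI mult_left_mono)
  next
    case False
    hence "?k * ?a \<le> 0" using mult_nonpos_nonneg[of ?k ?a] by auto
    thus ?thesis by (simp add: ennreal_neg)
  qed
qed

text \<open>
  The pointwise lower bound on \<open>B\<close> behind all estimates, with the angular singularity expressed through
  the chord. The excluded case \<open>\<sigma> = sgn u\<close> is the one in which nothing happens, \<open>v' = v\<close>.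
\<close>
locale kernel_lower_bound =
  fixes B :: "'a::euclidean_space \<Rightarrow> 'a \<Rightarrow> real" and \<gamma> \<nu> p k0 :: real
  assumes dim: "DIM('a) \<ge> 2"
    and p: "p = real (DIM('a) - 1) + \<nu>" "p \<ge> 0"
    and \<gamma>: "\<gamma> \<le> 0"
    and k0: "k0 > 0"
    and lower: "\<And>u \<sigma>. u \<noteq> 0 \<Longrightarrow> norm \<sigma> = 1 \<Longrightarrow> \<sigma> \<noteq> sgn u \<Longrightarrow>
      k0 * norm u powr \<gamma> * norm (\<sigma> - sgn u) powr (- p) \<le> B u \<sigma>"
begin

text \<open>
  Boundedness of \<open>h\<close> makes \<open>X\<close>, the integral of \<open>h\<^sup>2\<close> against the inward rate, finite, so that
  \<open>X \<le> X / 2 + Y\<close> may be solved for \<open>X\<close>. The outward rate is at most a quarter of the inward rate for \<open>|v| \<ge> R\<close> and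
  bounded for \<open>|v| < R\<close>, which produces the integral over the ball.
\<close>
lemma tail_estimate_bounded:
  "\<exists>R>0. \<exists>C>0. \<forall>h \<in> borel_measurable borel. (\<exists>N. \<forall>v. \<bar>h v\<bar> \<le> N) \<longrightarrow>
    (\<integral>\<^sup>+v. ennreal ((h v)\<^sup>2 * (\<langle>v\<rangle> powr (\<gamma> + \<nu>) * maxwellian v)) * (if R \<le> norm v then 1 else 0) \<partial>lborel)
    \<le> ennreal C * (energy B h + (\<integral>\<^sup>+v. ennreal ((h v)\<^sup>2 * maxwellian v) * (if norm v < R then 1 else 0) \<partial>lborel))"
proof -
  define s where "s = \<gamma> + \<nu>"
  obtain L c C R where L: "L \<ge> 1" and c: "c > 0" and C: "C > 0" and R: "R = 8 * L + 2"
    and far: "\<And>v::'a. R \<le> norm v \<Longrightarrow> ennreal (c * norm v powr s) \<le> inward_rate s L R v \<and>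
        inward_rate s L R v \<le> ennreal (C * norm v powr s) \<and>
        outward_rate s L R v \<le> ennreal (1 / 4) * inward_rate s L R v"
    and close: "\<And>v::'a. norm v < R \<Longrightarrow> outward_rate s L R v \<le> ennreal C"
    using jump_rates[OF dim, of s] by blast
  define A where "A = (4 * L) powr p / k0"
  have A: "A > 0" using k0 L by (simp add: A_def)
  define T where "T = 2 powr \<bar>s\<bar>"
  have T: "T > 0" by (simp add: T_def)
  define C' where "C' = T / c * (4 * max C A)"
  have C': "C' > 0" using T c C by (simp add: C'_def less_max_iff_disj)
  have R1: "R \<ge> 1" using L R by simp
  have main: "(\<integral>\<^sup>+v. ennreal ((h v)\<^sup>2 * (\<langle>v\<rangle> powr s * maxwellian v)) * (if R \<le> norm v then 1 else 0) \<partial>lborel)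
    \<le> ennreal C' * (energy B h + (\<integral>\<^sup>+v. ennreal ((h v)\<^sup>2 * maxwellian v) * (if norm v < R then 1 else 0) \<partial>lborel))"
    if [measurable]: "h \<in> borel_measurable borel" and N: "\<And>v. \<bar>h v\<bar> \<le> N" for h N
  proof -
    define G where "G v = ennreal ((h v)\<^sup>2 * maxwellian v)" for v
    have [measurable]: "G \<in> borel_measurable borel" unfolding G_def by measurable
    define X where "X = (\<integral>\<^sup>+v. G v * inward_rate s L R v \<partial>lborel)"
    define I where "I = (\<integral>\<^sup>+v. G v * (if norm v < R then 1 else 0) \<partial>lborel)"
    have gw: "grazing_weight s L u \<sigma> \<le> ennreal (A * B u \<sigma>)"
      if "norm \<sigma> = 1" "u \<noteq> 0" "\<sigma> \<noteq> sgn u" for u \<sigma>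
      unfolding s_def A_def
      by (rule grazing_weight_le_kernel[OF lower k0 p]) (use that L in auto)
    have "X \<le> 2 * (\<integral>\<^sup>+v. G v * outward_rate s L R v \<partial>lborel) + 2 * (ennreal A * energy B h)"
      unfolding X_def G_def using L by (intro inward_outward_comparison A gw) auto
    also have "(\<integral>\<^sup>+v. G v * outward_rate s L R v \<partial>lborel)
      \<le> (\<integral>\<^sup>+v. ennreal (1 / 4) * (G v * inward_rate s L R v) + ennreal C * (G v * (if norm v < R then 1 else 0)) \<partial>lborel)"
    proof (rule nn_integral_mono)
      fix v
      show "G v * outward_rate s L R v \<le> ennreal (1 / 4) * (G v * inward_rate s L R v) + ennreal C * (G v * (if norm v < R then 1 else 0))"
      proof (cases "norm v < R")
        case True
        have "G v * outward_rate s L R v \<le> G v * ennreal C"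
          by (rule mult_left_mono[OF close[OF True]]) simp
        thus ?thesis using True by (simp add: inward_rate_zero mult.commute[of "ennreal C"])
      next
        case False
        have "G v * outward_rate s L R v \<le> G v * (ennreal (1 / 4) * inward_rate s L R v)"
          using far[of v] False by (intro mult_left_mono) auto
        thus ?thesis using False by (simp only: mult_ac) simp
      qed
    qed
    also have "\<dots> = ennreal (1 / 4) * X + ennreal C * I"
      unfolding X_def I_def by (subst nn_integral_add) (auto simp: nn_integral_cmult)
    finally have "X \<le> 2 * (ennreal (1 / 4) * X + ennreal C * I) + 2 * (ennreal A * energy B h)"
      by (simp add: mult_left_mono add_right_mono)
    also have "\<dots> = ennreal (1 / 2) * X + (2 * (ennreal C * I) + 2 * (ennreal A * energy B h))"
    proof -
      have "2 * ennreal (1 / 4) = ennreal (1 / 2)"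
        by (subst ennreal_numeral[symmetric], subst ennreal_mult[symmetric]) auto
      thus ?thesis by (simp only: distrib_left mult.assoc[symmetric] add.assoc)
    qed
    finally have step: "X \<le> ennreal (1 / 2) * X + (2 * (ennreal C * I) + 2 * (ennreal A * energy B h))" .
    have "X < \<infinity>"
    proof -
      have "X \<le> (\<integral>\<^sup>+v. ennreal (N\<^sup>2 * C * T) * ennreal (\<langle>v\<rangle> powr s * maxwellian (v::'a)) \<partial>lborel)"
        unfolding X_def
      proof (rule nn_integral_mono)
        fix v :: 'a
        show "G v * inward_rate s L R v \<le> ennreal (N\<^sup>2 * C * T) * ennreal (\<langle>v\<rangle> powr s * maxwellian v)"
        proof (cases "norm v < R")
          case False
          have "(h v)\<^sup>2 \<le> N\<^sup>2" using N[of v] by (intro abs_le_square_iff[THEN iffD1]) auto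
          hence "(h v)\<^sup>2 * maxwellian v \<le> N\<^sup>2 * maxwellian v"
            by (intro mult_right_mono less_imp_le[OF maxwellian_pos])
          hence g: "G v \<le> ennreal (N\<^sup>2 * maxwellian v)" unfolding G_def by (rule ennreal_leI)
          have "C * norm v powr s \<le> C * (T * \<langle>v\<rangle> powr s)"
            unfolding T_def using C False R1 by (intro mult_left_mono japanese_bracket_powr_le(2)) auto
          hence "inward_rate s L R v \<le> ennreal (C * (T * \<langle>v\<rangle> powr s))"
            using far[of v] False by (meson ennreal_leI not_less order.trans)
          hence "G v * inward_rate s L R v \<le> ennreal (N\<^sup>2 * maxwellian v) * ennreal (C * (T * \<langle>v\<rangle> powr s))"
            by (intro mult_mono g) auto
          also have "\<dots> = ennreal (N\<^sup>2 * C * T) * ennreal (\<langle>v\<rangle> powr s * maxwellian v)"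
            using C T maxwellian_pos[of v] by (simp add: ennreal_mult[symmetric] mult_ac)
          finally show ?thesis .
        qed (simp add: inward_rate_zero)
      qed
      also have "\<dots> = ennreal (N\<^sup>2 * C * T) * (\<integral>\<^sup>+v. ennreal (\<langle>v\<rangle> powr s * maxwellian (v::'a)) \<partial>lborel)"
        by (rule nn_integral_cmult) measurable
      also have "\<dots> < \<infinity>" using maxwellian_moment_finite[of s, where 'a='a] by (simp add: ennreal_mult_less_top)
      finally show ?thesis .
    qed
    with step have "X \<le> 2 * (2 * (ennreal C * I) + 2 * (ennreal A * energy B h))"
      by (rule ennreal_absorb_half)
    also have "\<dots> \<le> 2 * (2 * (ennreal (max C A) * I) + 2 * (ennreal (max C A) * energy B h))"
      by (intro mult_left_mono add_mono mult_right_mono ennreal_leI) auto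
    also have "\<dots> = ennreal (4 * max C A) * (energy B h + I)"
    proof -
      have "ennreal (4 * max C A) = 2 * 2 * ennreal (max C A)"
        using C by (simp add: ennreal_mult' less_max_iff_disj le_max_iff_disj)
      thus ?thesis by (simp add: distrib_left mult.assoc add.commute)
    qed
    finally have X: "X \<le> ennreal (4 * max C A) * (energy B h + I)" .
    have "(\<integral>\<^sup>+v. ennreal ((h v)\<^sup>2 * (\<langle>v\<rangle> powr s * maxwellian v)) * (if R \<le> norm v then 1 else 0) \<partial>lborel)
      \<le> (\<integral>\<^sup>+v. ennreal (T / c) * (G v * inward_rate s L R v) \<partial>lborel)"
    proof (rule nn_integral_mono)
      fix v
      show "ennreal ((h v)\<^sup>2 * (\<langle>v\<rangle> powr s * maxwellian v)) * (if R \<le> norm v then 1 else 0)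
        \<le> ennreal (T / c) * (G v * inward_rate s L R v)"
      proof (cases "R \<le> norm v")
        case True
        have "\<langle>v\<rangle> powr s \<le> T * norm v powr s"
          unfolding T_def using True R1 by (intro japanese_bracket_powr_le(1)) auto
        hence "(h v)\<^sup>2 * (\<langle>v\<rangle> powr s * maxwellian v) \<le> (h v)\<^sup>2 * ((T * norm v powr s) * maxwellian v)"
          by (intro mult_left_mono mult_right_mono less_imp_le[OF maxwellian_pos]) auto
        also have "\<dots> = T / c * (((h v)\<^sup>2 * maxwellian v) * (c * norm v powr s))"
          using c by (simp add: mult_ac)
        finally have "ennreal ((h v)\<^sup>2 * (\<langle>v\<rangle> powr s * maxwellian v))
          \<le> ennreal (T / c * (((h v)\<^sup>2 * maxwellian v) * (c * norm v powr s)))" by (rule ennreal_leI)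
        also have "\<dots> = ennreal (T / c) * (G v * ennreal (c * norm v powr s))"
        proof -
          have "ennreal (((h v)\<^sup>2 * maxwellian v) * (c * norm v powr s)) = G v * ennreal (c * norm v powr s)"
            unfolding G_def by (rule ennreal_mult) (use c maxwellian_pos[of v] in auto)
          moreover have "ennreal (T / c * (((h v)\<^sup>2 * maxwellian v) * (c * norm v powr s)))
            = ennreal (T / c) * ennreal (((h v)\<^sup>2 * maxwellian v) * (c * norm v powr s))"
            by (rule ennreal_mult) (use T c maxwellian_pos[of v] in auto)
          ultimately show ?thesis by (simp only:)
        qed
        also have "\<dots> \<le> ennreal (T / c) * (G v * inward_rate s L R v)"
          using far[OF True] by (intro mult_left_mono) auto
        finally show ?thesis using True by simp
      qed simp
    qed
    also have "\<dots> = ennreal (T / c) * X"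
      unfolding X_def by (rule nn_integral_cmult) measurable
    also have "\<dots> \<le> ennreal (T / c) * (ennreal (4 * max C A) * (energy B h + I))"
      by (rule mult_left_mono[OF X]) simp
    also have "\<dots> = ennreal C' * (energy B h + I)"
      unfolding C'_def using T c C by (subst ennreal_mult) (auto simp: mult.assoc le_max_iff_disj)
    finally show ?thesis unfolding I_def G_def .
  qed
  show ?thesis
    using main C' R1 unfolding s_def by (intro exI[of _ R] conjI exI[of _ C']) auto
qed

text \<open>
  Passage to unbounded functions: truncate at height \<open>n\<close> and use monotone convergence.
\<close>
lemma tail_estimate:
  "\<exists>R>0. \<exists>C>0. \<forall>h \<in> borel_measurable borel.
    (\<integral>\<^sup>+v. ennreal ((h v)\<^sup>2 * (\<langle>v\<rangle> powr (\<gamma> + \<nu>) * maxwellian v)) * (if R \<le> norm v then 1 else 0) \<partial>lborel)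
    \<le> ennreal C * (energy B h + (\<integral>\<^sup>+v. ennreal ((h v)\<^sup>2 * maxwellian v) * (if norm v < R then 1 else 0) \<partial>lborel))"
proof -
  obtain R C where R: "R > 0" and C: "C > 0" and bd: "\<And>h N. h \<in> borel_measurable borel \<Longrightarrow> (\<And>v. \<bar>h v\<bar> \<le> N) \<Longrightarrow>
    (\<integral>\<^sup>+v. ennreal ((h v)\<^sup>2 * (\<langle>v\<rangle> powr (\<gamma> + \<nu>) * maxwellian v)) * (if R \<le> norm v then 1 else 0) \<partial>lborel)
    \<le> ennreal C * (energy B h + (\<integral>\<^sup>+v. ennreal ((h v)\<^sup>2 * maxwellian v) * (if norm v < R then 1 else 0) \<partial>lborel))"
    using tail_estimate_bounded by blast
  have "(\<integral>\<^sup>+v. ennreal ((h v)\<^sup>2 * (\<langle>v\<rangle> powr (\<gamma> + \<nu>) * maxwellian v)) * (if R \<le> norm v then 1 else 0) \<partial>lborel)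
    \<le> ennreal C * (energy B h + (\<integral>\<^sup>+v. ennreal ((h v)\<^sup>2 * maxwellian v) * (if norm v < R then 1 else 0) \<partial>lborel))"
    (is "?l \<le> ?r") if [measurable]: "h \<in> borel_measurable borel" for h
  proof -
    define \<phi> where "\<phi> n x = max (- real n) (min (real n) x)" for n :: nat and x
    have \<phi>_lip: "\<bar>\<phi> n x - \<phi> n y\<bar> \<le> \<bar>x - y\<bar>" for n x y by (auto simp: \<phi>_def)
    have \<phi>_bd: "\<bar>\<phi> n x\<bar> \<le> real n" for n x by (auto simp: \<phi>_def)
    have \<phi>_sq: "(\<phi> n x)\<^sup>2 \<le> x\<^sup>2" for n x
      unfolding abs_le_square_iff[symmetric] by (auto simp: \<phi>_def)
    have \<phi>_mono: "(\<phi> n x)\<^sup>2 \<le> (\<phi> m x)\<^sup>2" if "n \<le> m" for n m x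
      unfolding abs_le_square_iff[symmetric] using that by (auto simp: \<phi>_def)
    have \<phi>_meas [measurable]: "(\<lambda>v. \<phi> n (h v)) \<in> borel_measurable borel" for n
      unfolding \<phi>_def by measurable
    define g where "g n v = ennreal ((\<phi> n (h v))\<^sup>2 * (\<langle>v\<rangle> powr (\<gamma> + \<nu>) * maxwellian v)) * (if R \<le> norm v then 1 else 0)" for n v
    have [measurable]: "g n \<in> borel_measurable borel" for n unfolding g_def by measurable
    have "incseq g"
      unfolding incseq_def le_fun_def g_def
      by (intro allI impI mult_right_mono ennreal_leI \<phi>_mono)
        (auto intro: mult_nonneg_nonneg less_imp_le[OF maxwellian_pos])
    have sup: "(SUP n. g n v) = ennreal ((h v)\<^sup>2 * (\<langle>v\<rangle> powr (\<gamma> + \<nu>) * maxwellian v)) * (if R \<le> norm v then 1 else 0)" for v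
    proof (rule antisym)
      show "(SUP n. g n v) \<le> ennreal ((h v)\<^sup>2 * (\<langle>v\<rangle> powr (\<gamma> + \<nu>) * maxwellian v)) * (if R \<le> norm v then 1 else 0)"
        unfolding g_def
        by (intro SUP_least mult_right_mono ennreal_leI \<phi>_sq)
          (auto intro: mult_nonneg_nonneg less_imp_le[OF maxwellian_pos])
      obtain n where "\<bar>h v\<bar> \<le> real n" using real_arch_simple by blast
      hence "\<phi> n (h v) = h v" by (auto simp: \<phi>_def)
      hence "ennreal ((h v)\<^sup>2 * (\<langle>v\<rangle> powr (\<gamma> + \<nu>) * maxwellian v)) * (if R \<le> norm v then 1 else 0) = g n v"
        by (simp add: g_def)
      also have "\<dots> \<le> (SUP n. g n v)" by (rule SUP_upper) simp
      finally show "ennreal ((h v)\<^sup>2 * (\<langle>v\<rangle> powr (\<gamma> + \<nu>) * maxwellian v)) * (if R \<le> norm v then 1 else 0) \<le> (SUP n. g n v)" .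
    qed
    have "?l = (\<integral>\<^sup>+v. (SUP n. g n v) \<partial>lborel)" by (simp only: sup)
    also have "\<dots> = (SUP n. \<integral>\<^sup>+v. g n v \<partial>lborel)"
      by (rule nn_integral_monotone_convergence_SUP[OF \<open>incseq g\<close>]) simp
    also have "\<dots> \<le> ?r"
    proof (rule SUP_least)
      fix n
      have "(\<integral>\<^sup>+v. g n v \<partial>lborel) \<le> ennreal C * (energy B (\<lambda>v. \<phi> n (h v)) +
          (\<integral>\<^sup>+v. ennreal ((\<phi> n (h v))\<^sup>2 * maxwellian v) * (if norm v < R then 1 else 0) \<partial>lborel))"
        unfolding g_def by (rule bd[OF \<phi>_meas \<phi>_bd])
      also have "\<dots> \<le> ?r"
        by (intro mult_left_mono add_mono energy_contraction \<phi>_lip nn_integral_mono mult_right_mono ennreal_leI \<phi>_sq)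
          (auto intro: less_imp_le[OF maxwellian_pos])
      finally show "(\<integral>\<^sup>+v. g n v \<partial>lborel) \<le> ?r" .
    qed
    finally show ?thesis .
  qed
  with R C show ?thesis by blast
qed

text \<open>
  The point \<open>v'\<close> is common to the collisions of \<open>(v, w)\<close> and of \<open>(w, v)\<close>, so it serves as an
  intermediate point between \<open>v\<close> and \<open>w\<close>. Averaging over \<open>\<sigma>\<close>, the steps from \<open>v\<close> to \<open>v'\<close> and
  from \<open>w\<close> to \<open>v'\<close> contribute equally.
\<close>
lemma local_estimate:
  assumes R: "R > 0"
  shows "\<exists>C>0. \<forall>h \<in> borel_measurable borel.
    (\<integral>\<^sup>+v. \<integral>\<^sup>+w. ennreal ((h v - h w)\<^sup>2) * (if norm v < R \<and> norm w < R then 1 else 0) \<partial>lborel \<partial>lborel)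
    \<le> ennreal C * energy B h"
proof -
  define S where "S = real DIM('a) * unit_ball_vol (real DIM('a))"
  have S: "S > 0" by (simp add: S_def)
  have ES: "emeasure (sph :: 'a measure) UNIV = ennreal S" by (simp add: emeasure_sph_UNIV S_def)
  define m0 where "m0 = (2 * pi) powr (- real DIM('a) / 2) * exp (- R\<^sup>2 / 2)"
  have m0: "m0 > 0" by (simp add: m0_def)
  have m0le: "m0 \<le> maxwellian v" if "norm v < R" for v :: 'a
  proof -
    have "(norm v)\<^sup>2 \<le> R\<^sup>2" using that R by (intro power_mono) auto
    thus ?thesis by (simp add: m0_def maxwellian_def)
  qed
  define k where "k = k0 * (2 * R) powr \<gamma> * 2 powr (- p)"
  have k: "k > 0" using k0 R by (simp add: k_def)
  have kB: "k \<le> B u \<sigma>" if u: "u \<noteq> 0" "norm u \<le> 2 * R" and s: "norm \<sigma> = 1" "\<sigma> \<noteq> sgn u" for u \<sigma>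
  proof -
    have "norm (\<sigma> - sgn u) \<le> 2"
      using norm_triangle_ineq4[of \<sigma> "sgn u"] u s by (simp add: norm_sgn)
    hence "2 powr (- p) \<le> norm (\<sigma> - sgn u) powr (- p)"
      using p(2) s by (intro powr_mono2') auto
    moreover have "(2 * R) powr \<gamma> \<le> norm u powr \<gamma>"
      using \<gamma> u by (intro powr_mono2') auto
    ultimately have "k \<le> k0 * norm u powr \<gamma> * norm (\<sigma> - sgn u) powr (- p)"
      unfolding k_def using k0 by (intro mult_mono) auto
    also have "\<dots> \<le> B u \<sigma>" by (rule lower) (use u s in auto)
    finally show ?thesis .
  qed
  define A where "A = 1 / (k * m0 * m0)"
  have A: "A > 0" using k m0 by (simp add: A_def)
  have main: "(\<integral>\<^sup>+v. \<integral>\<^sup>+w. ennreal ((h v - h w)\<^sup>2) * (if norm v < R \<and> norm w < R then 1 else 0) \<partial>lborel \<partial>lborel)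
    \<le> ennreal (4 * A / S) * energy B h" if [measurable]: "h \<in> borel_measurable borel" for h
  proof -
    interpret sph: sigma_finite_measure "sph :: 'a measure" by (rule sigma_finite_sph)
    define I where "I v w = (if norm (v :: 'a) < R \<and> norm (w :: 'a) < R then 1 else 0 :: ennreal)" for v w
    define P where "P v w \<sigma> = ennreal ((h v - h (post_collisional v w \<sigma>))\<^sup>2) * I v w" for v w \<sigma>
    have P: "(\<lambda>(v, w, \<sigma>). P v w \<sigma>) \<in> borel_measurable borel"
      unfolding P_def I_def borel_prod[symmetric] by measurable
    have P': "(\<lambda>(v, w, \<sigma>). P w v \<sigma>) \<in> borel_measurable borel"
      unfolding P_def I_def borel_prod[symmetric] by measurable
    have P2: "(\<lambda>(v, w, \<sigma>). P v w \<sigma> + P w v \<sigma>) \<in> borel_measurable borel"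
      unfolding P_def I_def borel_prod[symmetric] by measurable
    note Pm [measurable] = borel_measurable_curried3[OF P]
    have sym: "post_collisional w v \<sigma> = post_collisional v w \<sigma>" for v w \<sigma> :: 'a
      by (simp add: post_collisional_def add.commute norm_minus_commute)
    let ?Z = "\<integral>\<^sup>+v. \<integral>\<^sup>+w. ennreal ((h v - h w)\<^sup>2) * I v w \<partial>lborel \<partial>lborel"
    have [measurable]: "(\<lambda>z. I (f z) (g z)) \<in> borel_measurable M"
      if [measurable]: "f \<in> borel_measurable M" "g \<in> borel_measurable M" for f g and M :: "('a \<times> 'a) measure"
      unfolding I_def by measurable
    have "ennreal S * ?Z = collision_integral (\<lambda>v w \<sigma>. ennreal ((h v - h w)\<^sup>2) * I v w)"
    proof -
      have "ennreal S * ?Z = (\<integral>\<^sup>+v. ennreal S * (\<integral>\<^sup>+w. ennreal ((h v - h w)\<^sup>2) * I v w \<partial>lborel) \<partial>lborel)"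
        by (rule nn_integral_cmult[symmetric]) measurable
      also have "\<dots> = (\<integral>\<^sup>+v. \<integral>\<^sup>+w. ennreal S * (ennreal ((h v - h w)\<^sup>2) * I v w) \<partial>lborel \<partial>lborel)"
        unfolding I_def by (rule nn_integral_cong, rule nn_integral_cmult[symmetric]) measurable
      finally show ?thesis
        unfolding collision_integral_def by (simp add: ES mult.commute)
    qed
    also have "\<dots> \<le> collision_integral (\<lambda>v w \<sigma>. 2 * (P v w \<sigma> + P w v \<sigma>))"
    proof (rule collision_integral_mono)
      fix v w \<sigma> :: 'a
      define a b where "a = h v - h (post_collisional v w \<sigma>)" and "b = h w - h (post_collisional v w \<sigma>)"
      have "(a - b)\<^sup>2 \<le> 2 * (a\<^sup>2 + b\<^sup>2)"
        using zero_le_power2[of "a + b"] by (simp add: power2_eq_square algebra_simps)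
      moreover have "h v - h w = a - b" by (simp add: a_def b_def)
      ultimately have "ennreal ((h v - h w)\<^sup>2) \<le> ennreal (2 * (a\<^sup>2 + b\<^sup>2))" by (intro ennreal_leI) simp
      also have "\<dots> = 2 * (ennreal (a\<^sup>2) + ennreal (b\<^sup>2))" by (simp add: ennreal_mult)
      finally have "ennreal ((h v - h w)\<^sup>2) * I v w \<le> 2 * (ennreal (a\<^sup>2) + ennreal (b\<^sup>2)) * I v w"
        by (rule mult_right_mono) simp
      also have "\<dots> = 2 * (P v w \<sigma> + P w v \<sigma>)"
        by (simp add: P_def a_def b_def sym[of v w] I_def distrib_right)
      finally show "ennreal ((h v - h w)\<^sup>2) * I v w \<le> 2 * (P v w \<sigma> + P w v \<sigma>)" .
    qed
    also have "\<dots> = 2 * (collision_integral P + collision_integral (\<lambda>v w. P w v))"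
      using collision_integral_cmult[OF P2, of "\<lambda>_. 2"] nn_integral_cmult
      unfolding collision_integral_add[OF P P', symmetric]
      by (simp add: collision_integral_def nn_integral_cmult)
    also have "collision_integral (\<lambda>v w. P w v) = collision_integral P"
      unfolding collision_integral_def by (rule lborel_pair.Fubini') measurable
    also have "2 * (collision_integral P + collision_integral P) = 4 * collision_integral P"
      by (simp add: mult_2[symmetric] mult.assoc[symmetric])
    also have "collision_integral P \<le> ennreal A * energy B h"
    proof (rule collision_integral_le_energy[OF P A])
      fix v w \<sigma> :: 'a assume s1: "norm \<sigma> = 1"
      let ?E = "(h v - h (post_collisional v w \<sigma>))\<^sup>2"
      show "P v w \<sigma> \<le> ennreal (A * (B (v - w) \<sigma> * maxwellian v * maxwellian w * ?E))"
      proof (cases "norm v < R \<and> norm w < R")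
        case True
        show ?thesis
        proof (cases "v - w = 0 \<or> \<sigma> = sgn (v - w)")
          case triv: True
          hence "norm (post_collisional v w \<sigma> - v) = 0"
            unfolding norm_post_collisional_diff by auto
          thus ?thesis by (simp add: P_def)
        next
          case False
          have "norm (v - w) \<le> 2 * R" using norm_triangle_ineq4[of v w] True by simp
          hence "k \<le> B (v - w) \<sigma>" using False s1 by (intro kB) auto
          hence "k * m0 * m0 \<le> B (v - w) \<sigma> * maxwellian v * maxwellian w"
            using True k m0 m0le by (intro mult_mono) (auto intro!: mult_nonneg_nonneg less_imp_le[OF maxwellian_pos])
          hence "1 \<le> A * (B (v - w) \<sigma> * maxwellian v * maxwellian w)"
            using k m0 by (simp add: A_def pos_le_divide_eq)
          hence "1 * ?E \<le> A * (B (v - w) \<sigma> * maxwellian v * maxwellian w) * ?E"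
            by (rule mult_right_mono) simp
          thus ?thesis using True by (simp add: P_def I_def mult.assoc ennreal_leI)
        qed
      qed (auto simp: P_def I_def)
    qed
    finally have *: "ennreal S * ?Z \<le> 4 * (ennreal A * energy B h)" by (simp add: mult_left_mono)
    have "?Z = ennreal (1 / S) * (ennreal S * ?Z)"
      using S by (simp add: mult.assoc[symmetric] ennreal_mult[symmetric])
    also have "\<dots> \<le> ennreal (1 / S) * (4 * (ennreal A * energy B h))"
      by (rule mult_left_mono[OF *]) simp
    also have "\<dots> = ennreal (4 * A / S) * energy B h"
    proof -
      have "ennreal (4 * A / S) = ennreal (1 / S) * (4 * ennreal A)"
      proof -
        have "ennreal (4 * A / S) = ennreal (1 / S * (4 * A))" by simp
        also have "\<dots> = ennreal (1 / S) * ennreal (4 * A)"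
          by (rule ennreal_mult) (use S A in auto)
        also have "ennreal (4 * A) = 4 * ennreal A"
          by (subst ennreal_mult) (use A in auto)
        finally show ?thesis .
      qed
      thus ?thesis by (simp add: mult.assoc)
    qed
    finally show ?thesis unfolding I_def .
  qed
  show ?thesis using main A S by (intro exI[of _ "4 * A / S"]) auto
qed

end

section \<open>The weighted Poincare inequality and the spectral gap\<close>
lemma integrable_maxwellian: "integrable lborel (maxwellian :: 'a::euclidean_space \<Rightarrow> real)"
  by (rule integrableI_nonneg) (auto simp: nn_integral_maxwellian less_imp_le[OF maxwellian_pos])

lemma integral_maxwellian: "(\<integral>v. maxwellian (v :: 'a::euclidean_space) \<partial>lborel) = 1"
  by (subst integral_eq_nn_integral) (auto simp: nn_integral_maxwellian less_imp_le[OF maxwellian_pos])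

lemma integrable_mult_maxwellian:
  fixes h :: "'a::euclidean_space \<Rightarrow> real"
  assumes [measurable]: "h \<in> borel_measurable borel"
    and fin: "(\<integral>\<^sup>+v. ennreal ((h v)\<^sup>2 * maxwellian v) \<partial>lborel) < \<infinity>"
  shows "integrable lborel (\<lambda>v. h v * maxwellian v)"
proof -
  have "integrable lborel (\<lambda>v. (h v)\<^sup>2 * maxwellian v)"
    by (rule integrableI_nonneg) (use fin in \<open>auto intro!: AE_I2 mult_nonneg_nonneg less_imp_le[OF maxwellian_pos]\<close>)
  hence "integrable lborel (\<lambda>v. (h v)\<^sup>2 * maxwellian v + maxwellian v)"
    using integrable_maxwellian by (rule Bochner_Integration.integrable_add)
  thus ?thesis
  proof (rule Bochner_Integration.integrable_bound)
    show "AE v in lborel. norm (h v * maxwellian v) \<le> norm ((h v)\<^sup>2 * maxwellian v + maxwellian v)"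
    proof (rule AE_I2)
      fix v
      have "\<bar>h v\<bar> \<le> (h v)\<^sup>2 + 1"
        using zero_le_power2[of "\<bar>h v\<bar> - 1"] by (simp add: power2_eq_square algebra_simps)
      hence "\<bar>h v\<bar> * maxwellian v \<le> ((h v)\<^sup>2 + 1) * maxwellian v"
        by (intro mult_right_mono less_imp_le[OF maxwellian_pos])
      moreover have "0 \<le> ((h v)\<^sup>2 + 1) * maxwellian v"
        by (intro mult_nonneg_nonneg less_imp_le[OF maxwellian_pos]) auto
      ultimately show "norm (h v * maxwellian v) \<le> norm ((h v)\<^sup>2 * maxwellian v + maxwellian v)"
        using maxwellian_pos[of v] by (simp add: abs_mult distrib_right)
    qed
  qed simp
qed

text \<open>
  Cauchy-Schwarz for \<open>\<integral>(h - a) M\<close>, with \<open>M\<close> split as the product of \<open>\<langle>v\<rangle> powr (- s / 2) * sqrt M\<close>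
  and \<open>\<langle>v\<rangle> powr (s / 2) * sqrt M\<close>.
\<close>
lemma mean_deviation_le:
  fixes h :: "'a::euclidean_space \<Rightarrow> real"
  assumes [measurable]: "h \<in> borel_measurable borel"
    and fin: "(\<integral>\<^sup>+v. ennreal ((h v)\<^sup>2 * maxwellian v) \<partial>lborel) < \<infinity>"
  shows "ennreal (((\<integral>v. h v * maxwellian v \<partial>lborel) - a)\<^sup>2)
    \<le> (\<integral>\<^sup>+v. ennreal (\<langle>v\<rangle> powr (- s) * maxwellian (v :: 'a)) \<partial>lborel) *
      (\<integral>\<^sup>+v. ennreal ((h v - a)\<^sup>2 * (\<langle>v\<rangle> powr s * maxwellian v)) \<partial>lborel)"
proof -
  define m where "m = (\<integral>v. h v * maxwellian v \<partial>lborel)"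
  have int: "integrable lborel (\<lambda>v. h v * maxwellian v)"
    by (rule integrable_mult_maxwellian) (use fin in auto)
  define f where "f v = \<langle>v\<rangle> powr (- s / 2) * sqrt (maxwellian v)" for v :: 'a
  define g where "g v = \<bar>h v - a\<bar> * (\<langle>v\<rangle> powr (s / 2) * sqrt (maxwellian v))" for v :: 'a
  have [measurable]: "f \<in> borel_measurable borel" "g \<in> borel_measurable borel"
    unfolding f_def g_def by measurable
  have jp: "\<langle>v\<rangle> > 0" for v :: 'a using japanese_bracket_ge_1[of v] by linarith
  have fg: "f v * g v = \<bar>(h v - a) * maxwellian v\<bar>" for v
  proof -
    have "\<langle>v\<rangle> powr (- s / 2) * \<langle>v\<rangle> powr (s / 2) = 1"
      using jp[of v] by (simp add: powr_add[symmetric])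
    moreover have "sqrt (maxwellian v) * sqrt (maxwellian v) = maxwellian v"
      using maxwellian_pos[of v] by simp
    moreover have "f v * g v = \<bar>h v - a\<bar> * (\<langle>v\<rangle> powr (- s / 2) * \<langle>v\<rangle> powr (s / 2)) * (sqrt (maxwellian v) * sqrt (maxwellian v))"
      by (simp only: f_def g_def mult_ac)
    ultimately show ?thesis using maxwellian_pos[of v] by (simp add: abs_mult)
  qed
  have sq: "(\<langle>v\<rangle> powr (t / 2) * sqrt (maxwellian v))\<^sup>2 = \<langle>v\<rangle> powr t * maxwellian v" for t and v :: 'a
    using jp[of v] maxwellian_pos[of v]
    by (simp add: power_mult_distrib power2_eq_square[of "\<langle>v\<rangle> powr _"] powr_add[symmetric])
  have "m - a = (\<integral>v. (h v - a) * maxwellian v \<partial>lborel)"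
    unfolding m_def left_diff_distrib
    by (subst Bochner_Integration.integral_diff)
      (auto simp: int integrable_maxwellian integral_maxwellian)
  hence "ennreal \<bar>m - a\<bar> \<le> (\<integral>\<^sup>+v. ennreal \<bar>(h v - a) * maxwellian v\<bar> \<partial>lborel)"
    using integral_norm_bound_ennreal[of lborel "\<lambda>v. (h v - a) * maxwellian v"] int integrable_maxwellian[where 'a='a]
    by (simp add: left_diff_distrib)
  also have "\<dots> = (\<integral>\<^sup>+v. ennreal (f v) * ennreal (g v) \<partial>lborel)"
    by (rule nn_integral_cong) (simp add: fg[symmetric] ennreal_mult f_def g_def less_imp_le[OF maxwellian_pos])
  finally have "(ennreal \<bar>m - a\<bar>)\<^sup>2 \<le> (\<integral>\<^sup>+v. ennreal (f v) * ennreal (g v) \<partial>lborel)\<^sup>2"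
    by (rule power_mono) simp
  also have "\<dots> \<le> (\<integral>\<^sup>+v. (ennreal (f v))\<^sup>2 \<partial>lborel) * (\<integral>\<^sup>+v. (ennreal (g v))\<^sup>2 \<partial>lborel)"
    by (rule Cauchy_Schwarz_nn_integral) measurable
  also have "(\<integral>\<^sup>+v. (ennreal (f v))\<^sup>2 \<partial>lborel) = (\<integral>\<^sup>+v. ennreal (\<langle>v\<rangle> powr (- s) * maxwellian (v :: 'a)) \<partial>lborel)"
  proof (rule nn_integral_cong)
    fix v :: 'a
    have "f v \<ge> 0" by (simp add: f_def less_imp_le[OF maxwellian_pos])
    thus "(ennreal (f v))\<^sup>2 = ennreal (\<langle>v\<rangle> powr (- s) * maxwellian v)"
      using sq[of v "- s"] by (simp add: f_def ennreal_power)
  qed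
  also have "(\<integral>\<^sup>+v. (ennreal (g v))\<^sup>2 \<partial>lborel) = (\<integral>\<^sup>+v. ennreal ((h v - a)\<^sup>2 * (\<langle>v\<rangle> powr s * maxwellian v)) \<partial>lborel)"
  proof (rule nn_integral_cong)
    fix v :: 'a
    have "g v \<ge> 0" by (simp add: g_def less_imp_le[OF maxwellian_pos])
    moreover have "(g v)\<^sup>2 = (h v - a)\<^sup>2 * (\<langle>v\<rangle> powr s * maxwellian v)"
      unfolding g_def power_mult_distrib[of "\<bar>h v - a\<bar>"] sq by simp
    ultimately show "(ennreal (g v))\<^sup>2 = ennreal ((h v - a)\<^sup>2 * (\<langle>v\<rangle> powr s * maxwellian v))"
      by (simp add: ennreal_power)
  qed
  finally show ?thesis unfolding m_def[symmetric] by (simp add: ennreal_power)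
qed

context kernel_lower_bound
begin

text \<open>
  For each \<open>w\<close> the function \<open>h - h(w)\<close> has the energy of \<open>h\<close>, and the tail estimate bounds its weighted norm
  \<open>Y(w)\<close> by the energy and \<open>Z(w)\<close>, its norm on the ball. Integrating over \<open>w\<close> in the ball, instead of selecting
  a good centring constant, makes the local estimate directly applicable to \<open>Z\<close>.
\<close>
theorem weighted_poincare:
  "\<exists>C>0. \<forall>h \<in> borel_measurable borel. (\<integral>\<^sup>+v. ennreal ((h v)\<^sup>2 * maxwellian v) \<partial>lborel) < \<infinity> \<longrightarrow>
    (\<integral>\<^sup>+v. ennreal ((h v - (\<integral>w. h w * maxwellian w \<partial>lborel))\<^sup>2 * (\<langle>v\<rangle> powr (\<gamma> + \<nu>) * maxwellian v)) \<partial>lborel)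
    \<le> ennreal C * energy B h"
proof -
  define s where "s = \<gamma> + \<nu>"
  obtain R C1 where R: "R > 0" and C1: "C1 > 0" and tail: "\<And>h. h \<in> borel_measurable borel \<Longrightarrow>
    (\<integral>\<^sup>+v. ennreal ((h v)\<^sup>2 * (\<langle>v\<rangle> powr s * maxwellian v)) * (if R \<le> norm v then 1 else 0) \<partial>lborel)
    \<le> ennreal C1 * (energy B h + (\<integral>\<^sup>+v. ennreal ((h v)\<^sup>2 * maxwellian v) * (if norm v < R then 1 else 0) \<partial>lborel))"
    using tail_estimate unfolding s_def by blast
  obtain C2 where C2: "C2 > 0" and loc: "\<And>h. h \<in> borel_measurable borel \<Longrightarrow>
    (\<integral>\<^sup>+v. \<integral>\<^sup>+w. ennreal ((h v - h w)\<^sup>2) * (if norm v < R \<and> norm w < R then 1 else 0) \<partial>lborel \<partial>lborel)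
    \<le> ennreal C2 * energy B h"
    using local_estimate[OF R] by blast
  obtain S1 where S1: "S1 \<ge> 0" "(\<integral>\<^sup>+v. ennreal (\<langle>v\<rangle> powr s * maxwellian (v :: 'a)) \<partial>lborel) = ennreal S1"
    using maxwellian_moment_finite[of s, where 'a='a]
    by (cases "\<integral>\<^sup>+v. ennreal (\<langle>v\<rangle> powr s * maxwellian (v :: 'a)) \<partial>lborel") auto
  obtain S2 where S2: "S2 \<ge> 0" "(\<integral>\<^sup>+v. ennreal (\<langle>v\<rangle> powr (- s) * maxwellian (v :: 'a)) \<partial>lborel) = ennreal S2"
    using maxwellian_moment_finite[of "- s", where 'a='a]
    by (cases "\<integral>\<^sup>+v. ennreal (\<langle>v\<rangle> powr (- s) * maxwellian (v :: 'a)) \<partial>lborel") auto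
  define \<mu> where "\<mu> = (2 * pi) powr (- real DIM('a) / 2)"
  have \<mu>: "\<mu> > 0" by (simp add: \<mu>_def)
  have M\<mu>: "maxwellian v \<le> \<mu>" for v :: 'a by (simp add: maxwellian_def \<mu>_def)
  define Q where "Q = (1 + R) powr \<bar>s\<bar>"
  have Q: "Q > 0" using R by (simp add: Q_def)
  have jQ: "\<langle>v\<rangle> powr s \<le> Q" if "norm v < R" for v :: 'a
  proof -
    have "\<langle>v\<rangle> \<le> sqrt ((1 + R)\<^sup>2)"
      unfolding japanese_bracket_def
    proof (rule real_sqrt_le_mono)
      have "(norm v)\<^sup>2 \<le> R\<^sup>2" using that R by (intro power_mono) auto
      moreover have "(1 + R)\<^sup>2 = 1 + R\<^sup>2 + 2 * R" by (simp add: power2_eq_square algebra_simps)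
      ultimately show "1 + (norm v)\<^sup>2 \<le> (1 + R)\<^sup>2" using R by linarith
    qed
    hence "\<langle>v\<rangle> \<le> 1 + R" using R by (simp only: real_sqrt_abs)
    moreover have "\<langle>v\<rangle> powr s \<le> \<langle>v\<rangle> powr \<bar>s\<bar>"
      by (rule powr_mono) (auto simp: japanese_bracket_ge_1)
    ultimately show ?thesis
      unfolding Q_def using japanese_bracket_ge_1[of v]
      by (intro order.trans[OF _ powr_mono2[of "\<bar>s\<bar>" "\<langle>v\<rangle>" "1 + R"]]) auto
  qed
  define V where "V = unit_ball_vol (real DIM('a)) * R ^ DIM('a)"
  have V: "V > 0" using R by (simp add: V_def)
  have EV: "(\<integral>\<^sup>+w. (if norm w < R then 1 else 0) \<partial>(lborel :: 'a measure)) = ennreal V"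
  proof -
    have "(\<integral>\<^sup>+w. (if norm w < R then 1 else 0) \<partial>(lborel :: 'a measure)) = (\<integral>\<^sup>+w. indicator (ball 0 R) w \<partial>(lborel :: 'a measure))"
      by (rule nn_integral_cong) (simp split: split_indicator)
    thus ?thesis using R by (simp add: emeasure_ball V_def)
  qed
  define D where "D = C1 * \<mu> + Q * \<mu>"
  have D: "D > 0" using C1 Q \<mu> by (simp add: D_def add_pos_pos)
  define K where "K = 2 + 2 * (S1 * S2)"
  have K: "K > 0" using S1 S2 by (simp add: K_def add_pos_nonneg)
  define C where "C = 1 / V * (K * (C1 * V + D * C2))"
  have C: "C > 0" using V K C1 D C2 by (simp add: C_def add_pos_pos)
  have main: "(\<integral>\<^sup>+v. ennreal ((h v - (\<integral>w. h w * maxwellian w \<partial>lborel))\<^sup>2 * (\<langle>v\<rangle> powr s * maxwellian v)) \<partial>lborel)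
    \<le> ennreal C * energy B h"
    if h[measurable]: "h \<in> borel_measurable borel"
      and fin: "(\<integral>\<^sup>+v. ennreal ((h v)\<^sup>2 * maxwellian v) \<partial>lborel) < \<infinity>" for h
  proof -
    define m where "m = (\<integral>w. h w * maxwellian w \<partial>lborel)"
    define W where "W = (\<integral>\<^sup>+v. ennreal ((h v - m)\<^sup>2 * (\<langle>v\<rangle> powr s * maxwellian v)) \<partial>lborel)"
    define Y where "Y w = (\<integral>\<^sup>+v. ennreal ((h v - h w)\<^sup>2 * (\<langle>v\<rangle> powr s * maxwellian v)) \<partial>lborel)" for w
    define Z where "Z w = (\<integral>\<^sup>+v. ennreal ((h v - h w)\<^sup>2) * (if norm v < R then 1 else 0) \<partial>lborel)" for w
    let ?E = "energy B h"
    have [measurable]: "Z \<in> borel_measurable borel" unfolding Z_def by measurable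
    have Y: "Y w \<le> ennreal C1 * ?E + ennreal D * Z w" for w
    proof -
      have "Y w = (\<integral>\<^sup>+v. ennreal ((h v - h w)\<^sup>2 * (\<langle>v\<rangle> powr s * maxwellian v)) * (if R \<le> norm v then 1 else 0)
          + ennreal ((h v - h w)\<^sup>2 * (\<langle>v\<rangle> powr s * maxwellian v)) * (if norm v < R then 1 else 0) \<partial>lborel)"
        unfolding Y_def by (rule nn_integral_cong) auto
      also have "\<dots> = (\<integral>\<^sup>+v. ennreal ((h v - h w)\<^sup>2 * (\<langle>v\<rangle> powr s * maxwellian v)) * (if R \<le> norm v then 1 else 0) \<partial>lborel)
          + (\<integral>\<^sup>+v. ennreal ((h v - h w)\<^sup>2 * (\<langle>v\<rangle> powr s * maxwellian v)) * (if norm v < R then 1 else 0) \<partial>lborel)"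
        by (rule nn_integral_add) measurable
      also have "(\<integral>\<^sup>+v. ennreal ((h v - h w)\<^sup>2 * (\<langle>v\<rangle> powr s * maxwellian v)) * (if norm v < R then 1 else 0) \<partial>lborel)
        \<le> (\<integral>\<^sup>+v. ennreal (Q * \<mu>) * (ennreal ((h v - h w)\<^sup>2) * (if norm v < R then 1 else 0)) \<partial>lborel)"
      proof (rule nn_integral_mono)
        fix v
        show "ennreal ((h v - h w)\<^sup>2 * (\<langle>v\<rangle> powr s * maxwellian v)) * (if norm v < R then 1 else 0)
          \<le> ennreal (Q * \<mu>) * (ennreal ((h v - h w)\<^sup>2) * (if norm v < R then 1 else 0))"
        proof (cases "norm v < R")
          case True
          have "\<langle>v\<rangle> powr s * maxwellian v \<le> Q * \<mu>"
            using Q by (intro mult_mono jQ True M\<mu>) (auto simp: less_imp_le[OF maxwellian_pos])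
          hence "(h v - h w)\<^sup>2 * (\<langle>v\<rangle> powr s * maxwellian v) \<le> (Q * \<mu>) * (h v - h w)\<^sup>2"
            by (subst mult.commute) (rule mult_right_mono, auto)
          thus ?thesis using True Q \<mu> by (simp add: ennreal_leI ennreal_mult[symmetric])
        qed simp
      qed
      also have "\<dots> = ennreal (Q * \<mu>) * Z w"
        unfolding Z_def by (rule nn_integral_cmult) measurable
      also have "(\<integral>\<^sup>+v. ennreal ((h v - h w)\<^sup>2 * (\<langle>v\<rangle> powr s * maxwellian v)) * (if R \<le> norm v then 1 else 0) \<partial>lborel)
        \<le> ennreal C1 * (energy B (\<lambda>v. h v - h w) + (\<integral>\<^sup>+v. ennreal ((h v - h w)\<^sup>2 * maxwellian v) * (if norm v < R then 1 else 0) \<partial>lborel))"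
        by (rule tail) measurable
      also have "energy B (\<lambda>v. h v - h w) = ?E" by (rule energy_diff_const)
      also have "(\<integral>\<^sup>+v. ennreal ((h v - h w)\<^sup>2 * maxwellian v) * (if norm v < R then 1 else 0) \<partial>lborel)
        \<le> (\<integral>\<^sup>+v. ennreal \<mu> * (ennreal ((h v - h w)\<^sup>2) * (if norm v < R then 1 else 0)) \<partial>lborel)"
      proof (rule nn_integral_mono)
        fix v
        have "(h v - h w)\<^sup>2 * maxwellian v \<le> \<mu> * (h v - h w)\<^sup>2"
          by (subst mult.commute) (rule mult_right_mono, auto simp: M\<mu>)
        thus "ennreal ((h v - h w)\<^sup>2 * maxwellian v) * (if norm v < R then 1 else 0)
          \<le> ennreal \<mu> * (ennreal ((h v - h w)\<^sup>2) * (if norm v < R then 1 else 0))"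
          using \<mu> by (simp add: ennreal_leI ennreal_mult[symmetric])
      qed
      also have "\<dots> = ennreal \<mu> * Z w"
        unfolding Z_def by (rule nn_integral_cmult) measurable
      finally have "Y w \<le> ennreal C1 * (?E + ennreal \<mu> * Z w) + ennreal (Q * \<mu>) * Z w"
        by (simp add: mult_left_mono add_left_mono add_right_mono)
      also have "\<dots> = ennreal C1 * ?E + ennreal D * Z w"
      proof -
        have "ennreal D = ennreal C1 * ennreal \<mu> + ennreal (Q * \<mu>)"
          unfolding D_def using C1 Q \<mu> by (simp add: ennreal_mult)
        thus ?thesis by (simp add: distrib_left distrib_right mult.assoc add.assoc)
      qed
      finally show ?thesis .
    qed
    \<comment> \<open>Replacing \<open>h(w)\<close> by the mean \<open>m\<close> costs only a constant factor, by \<open>mean_deviation_le\<close>.\<close>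
  have WY: "W \<le> ennreal K * Y w" for w
    proof -
      have "W \<le> (\<integral>\<^sup>+v. 2 * ennreal ((h v - h w)\<^sup>2 * (\<langle>v\<rangle> powr s * maxwellian v))
          + ennreal (2 * (m - h w)\<^sup>2) * ennreal (\<langle>v\<rangle> powr s * maxwellian v) \<partial>lborel)"
        unfolding W_def
      proof (rule nn_integral_mono)
        fix v :: 'a
        define c where "c = \<langle>v\<rangle> powr s * maxwellian v"
        have c: "c \<ge> 0" by (simp add: c_def less_imp_le[OF maxwellian_pos])
        have "(h v - m)\<^sup>2 \<le> 2 * (h v - h w)\<^sup>2 + 2 * (m - h w)\<^sup>2"
          using zero_le_power2[of "(h v - h w) + (m - h w)"] by (simp add: power2_eq_square algebra_simps)
        hence "(h v - m)\<^sup>2 * c \<le> (2 * (h v - h w)\<^sup>2 + 2 * (m - h w)\<^sup>2) * c"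
          using c by (rule mult_right_mono)
        hence "ennreal ((h v - m)\<^sup>2 * c) \<le> ennreal (2 * ((h v - h w)\<^sup>2 * c) + (2 * (m - h w)\<^sup>2) * c)"
          by (intro ennreal_leI) (simp add: distrib_right)
        also have "\<dots> = ennreal (2 * ((h v - h w)\<^sup>2 * c)) + ennreal ((2 * (m - h w)\<^sup>2) * c)"
          by (rule ennreal_plus) (use c in auto)
        also have "ennreal (2 * ((h v - h w)\<^sup>2 * c)) = 2 * ennreal ((h v - h w)\<^sup>2 * c)"
          using c by (subst ennreal_mult) auto
        also have "ennreal ((2 * (m - h w)\<^sup>2) * c) = ennreal (2 * (m - h w)\<^sup>2) * ennreal c"
          using c by (intro ennreal_mult) auto
        finally show "ennreal ((h v - m)\<^sup>2 * (\<langle>v\<rangle> powr s * maxwellian v)) \<le> 2 * ennreal ((h v - h w)\<^sup>2 * (\<langle>v\<rangle> powr s * maxwellian v))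
          + ennreal (2 * (m - h w)\<^sup>2) * ennreal (\<langle>v\<rangle> powr s * maxwellian v)"
          by (simp only: c_def)
      qed
      also have "\<dots> = 2 * Y w + ennreal (2 * (m - h w)\<^sup>2) * ennreal S1"
        unfolding Y_def S1(2)[symmetric]
        by (subst nn_integral_add) (auto simp: nn_integral_cmult)
      also have "ennreal (2 * (m - h w)\<^sup>2) \<le> 2 * (ennreal S2 * Y w)"
      proof -
        have "ennreal (2 * (m - h w)\<^sup>2) = 2 * ennreal ((m - h w)\<^sup>2)" by (subst ennreal_mult) auto
        also have "\<dots> \<le> 2 * (ennreal S2 * Y w)"
          unfolding S2(2)[symmetric] Y_def m_def by (intro mult_left_mono mean_deviation_le h fin) auto
        finally show ?thesis .
      qed
      finally have "W \<le> 2 * Y w + 2 * (ennreal S2 * Y w) * ennreal S1"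
        by (simp add: add_left_mono mult_right_mono)
      also have "\<dots> = ennreal K * Y w"
      proof -
        have "ennreal K = 2 + 2 * (ennreal S1 * ennreal S2)"
          unfolding K_def using S1 S2 by (simp add: ennreal_mult)
        thus ?thesis by (simp add: distrib_left distrib_right mult_ac)
      qed
      finally show ?thesis .
    qed
    have "ennreal V * W = (\<integral>\<^sup>+w. W * (if norm w < R then 1 else 0) \<partial>(lborel :: 'a measure))"
      by (subst nn_integral_cmult) (auto simp: EV mult.commute)
    also have "\<dots> \<le> (\<integral>\<^sup>+w. ennreal K * (ennreal C1 * ?E * (if norm w < R then 1 else 0) + ennreal D * (Z w * (if norm w < R then 1 else 0))) \<partial>lborel)"
    proof (rule nn_integral_mono)
      fix w :: 'a
      have "W \<le> ennreal K * (ennreal C1 * ?E + ennreal D * Z w)"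
        using WY[of w] mult_left_mono[OF Y[of w], of "ennreal K"] by (auto intro: order.trans)
      thus "W * (if norm w < R then 1 else 0) \<le> ennreal K * (ennreal C1 * ?E * (if norm w < R then 1 else 0) + ennreal D * (Z w * (if norm w < R then 1 else 0)))"
        by auto
    qed
    also have "\<dots> = ennreal K * (ennreal C1 * ?E * ennreal V + ennreal D * (\<integral>\<^sup>+w. Z w * (if norm w < R then 1 else 0) \<partial>lborel))"
      by (simp add: nn_integral_cmult nn_integral_add EV)
    also have "(\<integral>\<^sup>+w. Z w * (if norm w < R then 1 else 0) \<partial>lborel) \<le> ennreal C2 * ?E"
    proof -
      have "(\<integral>\<^sup>+w. Z w * (if norm w < R then 1 else 0) \<partial>lborel) =
         (\<integral>\<^sup>+v. \<integral>\<^sup>+w. ennreal ((h v - h w)\<^sup>2) * (if norm v < R \<and> norm w < R then 1 else 0) \<partial>lborel \<partial>lborel)"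
        unfolding Z_def
      proof (rule nn_integral_cong)
        fix w
        show "(\<integral>\<^sup>+v. ennreal ((h v - h w)\<^sup>2) * (if norm v < R then 1 else 0) \<partial>lborel) * (if norm w < R then 1 else 0)
          = (\<integral>\<^sup>+v. ennreal ((h w - h v)\<^sup>2) * (if norm w < R \<and> norm v < R then 1 else 0) \<partial>lborel)"
          by (auto simp: power2_commute intro!: nn_integral_cong)
      qed
      thus ?thesis using loc[OF h] by simp
    qed
    finally have "ennreal V * W \<le> ennreal K * (ennreal C1 * ?E * ennreal V + ennreal D * (ennreal C2 * ?E))"
      by (simp add: mult_left_mono add_left_mono)
    also have "\<dots> = ennreal (K * (C1 * V + D * C2)) * ?E"
    proof -
      have "ennreal (K * (C1 * V + D * C2)) = ennreal K * (ennreal C1 * ennreal V + ennreal D * ennreal C2)"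
        using K C1 V D C2 by (simp add: ennreal_mult)
      thus ?thesis by (simp add: distrib_left distrib_right mult_ac)
    qed
    finally have *: "ennreal V * W \<le> ennreal (K * (C1 * V + D * C2)) * ?E" .
    have "W = ennreal (1 / V) * (ennreal V * W)"
      using V by (simp add: mult.assoc[symmetric] ennreal_mult[symmetric])
    also have "\<dots> \<le> ennreal (1 / V) * (ennreal (K * (C1 * V + D * C2)) * ?E)"
      by (rule mult_left_mono[OF *]) simp
    also have "\<dots> = ennreal C * ?E"
      unfolding C_def using V K C1 D C2 by (subst ennreal_mult) (auto simp: mult.assoc intro!: mult_nonneg_nonneg add_nonneg_nonneg)
    finally show ?thesis unfolding W_def m_def .
  qed
  show ?thesis using main C unfolding s_def by blast
qed

end

theorem proposition6p1:
  fixes \<gamma> \<nu> c0 c1 :: real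
    and b :: "real \<Rightarrow> real"
    and B :: "'a::euclidean_space \<Rightarrow> 'a \<Rightarrow> real"
  assumes dim: "DIM('a) \<ge> 2"
    and gamma: "- real DIM('a) < \<gamma>" "\<gamma> < 0"
    and nu: "0 < \<nu>" "\<nu> < 2"
    and b_measurable: "b \<in> borel_measurable (restrict_space borel {-1..1})"
    and c01: "0 < c0" "c0 \<le> c1"
    and b_bounds: "\<And>\<theta>. \<theta> \<in> {0<..pi} \<Longrightarrow>
          c0 * \<bar>\<theta>\<bar> powr (- (real DIM('a) - 1) - \<nu>) \<le> b (cos \<theta>) \<and>
          b (cos \<theta>) \<le> c1 * \<bar>\<theta>\<bar> powr (- (real DIM('a) - 1) - \<nu>)"
    and kernel: "B = collision_kernel \<gamma> b"
  shows "(\<forall>\<epsilon>>0. \<exists>C>0. \<forall>f \<in> L2_space (\<lambda>v. inverse (maxwellian v)).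
            dirichlet_form B f \<ge>
              ennreal C *
                L2_norm_sq (\<lambda>v. \<langle>v\<rangle> powr (\<gamma> + \<nu> - \<epsilon>) * inverse (maxwellian v))
                  (\<lambda>v. f v - mass f * maxwellian v)) \<and>
         (\<gamma> + \<nu> > 0 \<longrightarrow>
           (\<exists>gap>0. \<forall>f \<in> L2_space (\<lambda>v. inverse (maxwellian v)).
             dirichlet_form B f \<ge>
               ennreal gap *
                 L2_norm_sq (\<lambda>v. inverse (maxwellian v)) (\<lambda>v. f v - mass f * maxwellian v)))"
proof -
  define p where "p = real (DIM('a) - 1) + \<nu>"
  have pe: "- (real DIM('a) - 1) - \<nu> = - p" using dim by (simp add: p_def of_nat_diff)
  interpret kernel_lower_bound B \<gamma> \<nu> p "c0 * 2 powr (- p)"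
  proof
    show "c0 * 2 powr (- p) * norm u powr \<gamma> * norm (\<sigma> - sgn u) powr (- p) \<le> B u \<sigma>"
      if "u \<noteq> 0" "norm \<sigma> = 1" "\<sigma> \<noteq> sgn u" for u \<sigma> :: 'a
      unfolding kernel
    proof (rule collision_kernel_ge)
      show "c0 * \<bar>\<theta>\<bar> powr (- p) \<le> b (cos \<theta>)" if "\<theta> \<in> {0<..pi}" for \<theta>
        using b_bounds[OF that] unfolding pe by blast
      show "0 \<le> p" using nu by (simp add: p_def)
    qed (use that c01 in auto)
  qed (use dim gamma nu c01 in \<open>auto simp: p_def\<close>)
  obtain K where K: "K > 0" and poincare: "\<And>h. h \<in> borel_measurable borel \<Longrightarrow>
    (\<integral>\<^sup>+v. ennreal ((h v)\<^sup>2 * maxwellian v) \<partial>lborel) < \<infinity> \<Longrightarrow>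
    (\<integral>\<^sup>+v. ennreal ((h v - (\<integral>w. h w * maxwellian w \<partial>lborel))\<^sup>2 * (\<langle>v\<rangle> powr (\<gamma> + \<nu>) * maxwellian v)) \<partial>lborel)
    \<le> ennreal K * energy B h"
    using weighted_poincare by blast
  define C where "C = 1 / (2 * K)"
  have C: "C > 0" using K by (simp add: C_def)
  have key: "ennreal C * L2_norm_sq (\<lambda>v. \<omega> v * inverse (maxwellian v)) (\<lambda>v. f v - mass f * maxwellian v) \<le> dirichlet_form B f"
    if f: "f \<in> L2_space (\<lambda>v. inverse (maxwellian v))"
      and \<omega>: "\<And>v::'a. \<omega> v \<le> \<langle>v\<rangle> powr (\<gamma> + \<nu>)" for f \<omega>
  proof -
    define h where "h v = f v / maxwellian v" for v
    have [measurable]: "f \<in> borel_measurable borel" using f by (simp add: L2_space_def)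
    have h [measurable]: "h \<in> borel_measurable borel" unfolding h_def by measurable
    have fh: "f v = h v * maxwellian v" for v
      using maxwellian_pos[of v] by (simp add: h_def)
    have "(\<integral>\<^sup>+v. ennreal ((h v)\<^sup>2 * maxwellian v) \<partial>lborel) = L2_norm_sq (\<lambda>v. inverse (maxwellian v)) f"
      unfolding L2_norm_sq_def
      by (rule nn_integral_cong) (use maxwellian_pos in \<open>simp add: h_def power2_eq_square field_simps\<close>)
    hence fin: "(\<integral>\<^sup>+v. ennreal ((h v)\<^sup>2 * maxwellian v) \<partial>lborel) < \<infinity>"
      using f by (simp add: L2_space_def)
    have mass: "mass f = (\<integral>w. h w * maxwellian w \<partial>lborel)" by (simp add: mass_def fh)
    have "L2_norm_sq (\<lambda>v. \<omega> v * inverse (maxwellian v)) (\<lambda>v. f v - mass f * maxwellian v)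
      \<le> (\<integral>\<^sup>+v. ennreal ((h v - (\<integral>w. h w * maxwellian w \<partial>lborel))\<^sup>2 * (\<langle>v\<rangle> powr (\<gamma> + \<nu>) * maxwellian v)) \<partial>lborel)"
      unfolding L2_norm_sq_def mass[symmetric]
    proof (intro nn_integral_mono ennreal_leI)
      fix v
      have "(f v - mass f * maxwellian v)\<^sup>2 * (\<omega> v * inverse (maxwellian v)) = (h v - mass f)\<^sup>2 * (\<omega> v * maxwellian v)"
        using maxwellian_pos[of v] unfolding fh[of v] left_diff_distrib[symmetric] power_mult_distrib
        by (simp add: power2_eq_square)
      also have "\<dots> \<le> (h v - mass f)\<^sup>2 * (\<langle>v\<rangle> powr (\<gamma> + \<nu>) * maxwellian v)"
        by (intro mult_left_mono mult_right_mono \<omega> less_imp_le[OF maxwellian_pos]) auto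
      finally show "(f v - mass f * maxwellian v)\<^sup>2 * (\<omega> v * inverse (maxwellian v)) \<le> (h v - mass f)\<^sup>2 * (\<langle>v\<rangle> powr (\<gamma> + \<nu>) * maxwellian v)" .
    qed
    also have "\<dots> \<le> ennreal K * energy B h" by (rule poincare[OF h fin])
    finally have "ennreal C * L2_norm_sq (\<lambda>v. \<omega> v * inverse (maxwellian v)) (\<lambda>v. f v - mass f * maxwellian v)
      \<le> ennreal C * (ennreal K * energy B h)" by (rule mult_left_mono) simp
    also have "\<dots> = ennreal (1 / 2) * energy B h"
      using K C by (simp add: mult.assoc[symmetric] ennreal_mult[symmetric] C_def)
    also have "\<dots> = dirichlet_form B f"
      by (simp add: dirichlet_form_def energy_def h_def)
    finally show ?thesis .
  qed
  have 1: "\<langle>v\<rangle> powr (\<gamma> + \<nu> - \<epsilon>) \<le> \<langle>v\<rangle> powr (\<gamma> + \<nu>)" if "\<epsilon> > 0" for \<epsilon> and v :: 'a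
    using that by (intro powr_mono japanese_bracket_ge_1) auto
  have 2: "1 \<le> \<langle>v\<rangle> powr (\<gamma> + \<nu>)" if "\<gamma> + \<nu> > 0" for v :: 'a
    using that by (intro ge_one_powr_ge_zero japanese_bracket_ge_1) auto
  show ?thesis
  proof (intro conjI allI impI)
    fix \<epsilon> :: real assume "\<epsilon> > 0"
    thus "\<exists>C>0. \<forall>f \<in> L2_space (\<lambda>v. inverse (maxwellian v)). dirichlet_form B f \<ge>
        ennreal C * L2_norm_sq (\<lambda>v. \<langle>v\<rangle> powr (\<gamma> + \<nu> - \<epsilon>) * inverse (maxwellian v)) (\<lambda>v. f v - mass f * maxwellian v)"
      using C by (intro exI[of _ C] conjI ballI key 1)
  next
    assume "\<gamma> + \<nu> > 0"
    thus "\<exists>gap>0. \<forall>f \<in> L2_space (\<lambda>v. inverse (maxwellian v)). dirichlet_form B f \<ge>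
        ennreal gap * L2_norm_sq (\<lambda>v. inverse (maxwellian v)) (\<lambda>v. f v - mass f * maxwellian v)"
      using C key[of _ "\<lambda>_. 1"] 2 by (intro exI[of _ C] conjI ballI) simp_all
  qed
qed

end
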